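(* Let $(\mathfrak{g},\bullet)$ be a (finite dimensional real) left symmetric algebra, $[u,v]=u\bullet v-v\bullet u$, let $G$ be a connected Lie group with Lie algebra $(\mathfrak{g},[\;,\;])$, and let $\rho:G\to\mathrm{GL}(\mathfrak{g})$ be the homomorphism of groups such that $d_e\rho=\mathrm{L}$, where $\mathrm{L}_uv=u\bullet v$. Endow $G\times\mathfrak{g}$ with the Lie group structure $(g,u).(h,v)=(gh,u+\rho(g)(v))$, whose Lie algebra is $\Phi(\mathfrak{g})=\mathfrak{g}\times\mathfrak{g}$ with bracket $[(a,b),(c,d)]=([a,c],a\bullet d-c\bullet b)$. Let $r\in\mathfrak{g}\otimes\mathfrak{g}$ be symmetric with $[[r,r]]=0$, let $r^-$ be the associated right invariant symmetric bivector field on $G$, and let $\nabla$ be the right invariant connection on $G$ given by $\nabla_{u^-}v^-=-(u\bullet v)^-$ (so that $(G,\nabla,r^-)$ is a contravariant pseudo-Hessian manifold). Let $\overline\nabla$, $J$ and $\Pi$ be the flat connection, complex structure and Poisson tensor on $TG$ associated to $(\nabla,r^-)$ (defined in the context). Identify $TG$ with $G\times\mathfrak{g}$ by $u_g\mapsto(g,T_gR_{g^{-1}}u_g)$ and denote also by $\Pi$, $\overline\nabla$, $J$ the images of these structures under this identification. Then $$\Pi=R^-,\qquad \overline\nabla=\widetilde\nabla,\qquad J=J_0^-,$$ where $R^-$, $\widetilde\nabla$ and $J_0^-$ are the right invariant bivector field, connection and endomorphism field on the Lie group $G\times\mathfrak{g}$ determined by $$R((\alpha_1,\beta_1),(\alpha_2,\beta_2))=r(\alpha_1,\beta_2)-r(\alpha_2,\beta_1),\quad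 \widetilde\nabla_{(a,b)^-}(c,d)^-=-(a\bullet c,a\bullet d)^-,\quad J_0^-(a,b)^-=(b,-a)^-$$ for $a,b,c,d\in\mathfrak{g}$ and $\alpha_1,\alpha_2,\beta_1,\beta_2\in\mathfrak{g}^*$.
   Context: A left symmetric algebra is an algebra with $\mathrm{ass}(u,v,w)=\mathrm{ass}(v,u,w)$, where $\mathrm{ass}(u,v,w)=(u\bullet v)\bullet w-u\bullet(v\bullet w)$; then $[u,v]=u\bullet v-v\bullet u$ is a Lie bracket and $u\mapsto\mathrm{L}_u$ is a representation of it. For an element (or tensor) of the Lie algebra of a Lie group, the superscript $-$ denotes the associated right invariant field. Here $R_g$ denotes right translation by $g$. For symmetric $r$, with $\langle\beta,r_\#(\alpha)\rangle=r(\alpha,\beta)$, $[[r,r]](\alpha,\beta,\gamma):=\langle\gamma,r_\#(\mathrm{L}^*_{r_\#(\alpha)}\beta-\mathrm{L}^*_{r_\#(\beta)}\alpha)-[r_\#(\alpha),r_\#(\beta)]\rangle$, where $\langle\mathrm{L}^*_u\alpha,v\rangle=-\langle\alpha,u\bullet v\rangle$. A triple $(M,\nabla,h)$, with $\nabla$ flat and torsion-free and $h$ a symmetric bivector field, is a contravariant pseudo-Hessian manifold if $(\nabla_{h_\#(\alpha)}h)(\beta,\gamma)=(\nabla_{h_\#(\beta)}h)(\alpha,\gamma)$ for all 1-forms $\alpha,\beta,\gamma$, where $\beta(h_\#(\alpha))=h(\alpha,\beta)$. Structures on the tangent bundle $p:TM\to M$ of $(M,\nabla,h)$: with $X^h$,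 $X^v$ the horizontal (with respect to $\nabla$) and vertical lifts of $X\in\Gamma(TM)$, and $\alpha^h,\alpha^v\in\Omega^1(TM)$ given by $\alpha^v(X^v)=\alpha(X)\circ p$, $\alpha^v(X^h)=0$, $\alpha^h(X^h)=\alpha(X)\circ p$, $\alpha^h(X^v)=0$, one sets: - $\overline\nabla_{X^h}Y^h=(\nabla_XY)^h$, $\overline\nabla_{X^h}Y^v=(\nabla_XY)^v$, $\overline\nabla_{X^v}Y^h=\overline\nabla_{X^v}Y^v=0$; - $JX^h=X^v$, $JX^v=-X^h$; - $\Pi(\alpha^v,\beta^v)=\Pi(\alpha^h,\beta^h)=0$, $\Pi(\alpha^h,\beta^v)=-\Pi(\beta^v,\alpha^h)=h(\alpha,\beta)\circ p$.
   Formalization: The sign of J_0 is corrected: the proved statement has J_0^-(a,b)^- = (-b,a)^- instead of (b,-a)^-, since JX^h = X^v and JX^v = -X^h force this; the printed sign fails whenever dim g > 0 (the trivial case dim g = 0 is left out). *)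

theory Defs
  imports "HOL-Analysis.Analysis" "HOL-Algebra.Group"
begin

section \<open>Smooth manifolds\<close>

text \<open>
  A manifold is given by an atlas: a set of charts \<open>(U, \<phi>)\<close>, where only the values of \<open>\<phi>\<close> on \<open>U\<close>
  matter. The points are the union of the chart domains and the topology is the one induced by the
  charts. No maximality is required: smoothness of maps, tangent vectors etc. do not depend on
  adding compatible charts.
\<close>

primrec C_k_on :: "nat \<Rightarrow> 'a::real_normed_vector set \<Rightarrow> ('a \<Rightarrow> 'b::real_normed_vector) \<Rightarrow> bool" where
  "C_k_on 0 S f \<longleftrightarrow> continuous_on S f"
| "C_k_on (Suc k) S f \<longleftrightarrow>
     (\<forall>x\<in>S. f differentiable (at x)) \<and>
     (\<forall>v. C_k_on k S (\<lambda>x. frechet_derivative f (at x) v))"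

text \<open>Only used for open \<open>S\<close> in a finite-dimensional space.\<close>

definition smooth_on :: "'a::real_normed_vector set \<Rightarrow> ('a \<Rightarrow> 'b::real_normed_vector) \<Rightarrow> bool" where
  "smooth_on S f \<longleftrightarrow> (\<forall>k. C_k_on k S f)"

type_synonym ('m, 'e) chart = "'m set \<times> ('m \<Rightarrow> 'e)"
type_synonym ('m, 'e) atlas = "('m, 'e) chart set"

definition points :: "('m, 'e) atlas \<Rightarrow> 'm set" where
  "points A = \<Union> (fst ` A)"

definition atlas_topology :: "('m, 'e::topological_space) atlas \<Rightarrow> 'm topology" where
  "atlas_topology A = topology (\<lambda>W. W \<subseteq> points A \<and> (\<forall>(U, \<phi>)\<in>A. open (\<phi> ` (W \<inter> U))))"

definition smooth_manifold :: "('m, 'e::real_normed_vector) atlas \<Rightarrow> bool" where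
  "smooth_manifold A \<longleftrightarrow>
     (\<forall>(U, \<phi>)\<in>A. inj_on \<phi> U \<and> open (\<phi> ` U)) \<and>
     (\<forall>(U, \<phi>)\<in>A. \<forall>(V, \<psi>)\<in>A.
        open (\<phi> ` (U \<inter> V)) \<and> smooth_on (\<phi> ` (U \<inter> V)) (\<psi> \<circ> inv_into U \<phi>)) \<and>
     Hausdorff_space (atlas_topology A) \<and> second_countable (atlas_topology A)"

definition smooth_map ::
    "('m, 'e::real_normed_vector) atlas \<Rightarrow> ('n, 'f::real_normed_vector) atlas \<Rightarrow> ('m \<Rightarrow> 'n) \<Rightarrow> bool" where
  "smooth_map A B f \<longleftrightarrow> f ` points A \<subseteq> points B \<and>
     (\<forall>(U, \<phi>)\<in>A. \<forall>(V, \<psi>)\<in>B.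
        open (\<phi> ` (U \<inter> f -` V)) \<and>
        smooth_on (\<phi> ` (U \<inter> f -` V)) (\<psi> \<circ> f \<circ> inv_into U \<phi>))"

definition vector_atlas :: "('e, 'e) atlas" where
  "vector_atlas = {(UNIV, \<lambda>x. x)}"

definition prod_atlas :: "('m, 'e) atlas \<Rightarrow> ('n, 'f) atlas \<Rightarrow> ('m \<times> 'n, 'e \<times> 'f) atlas" where
  "prod_atlas A B = {(U \<times> V, map_prod \<phi> \<psi>) | U \<phi> V \<psi>. (U, \<phi>) \<in> A \<and> (V, \<psi>) \<in> B}"

definition smooth_function :: "('m, 'e::real_normed_vector) atlas \<Rightarrow> ('m \<Rightarrow> real) \<Rightarrow> bool" where
  "smooth_function A f \<longleftrightarrow> smooth_map A vector_atlas f"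

section \<open>Tangent bundle\<close>

text \<open>
  A tangent vector at \<open>p\<close> is a pair \<open>(p, v)\<close>, where \<open>v\<close> assigns to every chart around \<open>p\<close> the
  component vector in that chart; components in different charts are related by the derivative of
  the transition map. For the other arguments \<open>v\<close> is set to \<open>0\<close>, to make \<open>v\<close> unique.
\<close>

type_synonym ('m, 'e) tvec = "'m \<times> (('m, 'e) chart \<Rightarrow> 'e)"

definition tangent_space :: "('m, 'e::real_normed_vector) atlas \<Rightarrow> 'm \<Rightarrow> ('m, 'e) tvec set" where
  "tangent_space A p = {(q, v). q = p \<and> p \<in> points A \<and>
     (\<forall>c\<in>A. \<forall>d\<in>A. p \<in> fst c \<and> p \<in> fst d \<longrightarrow>
        v d = frechet_derivative (snd d \<circ> inv_into (fst c) (snd c)) (at (snd c p)) (v c)) \<and>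
     (\<forall>c. \<not> (c \<in> A \<and> p \<in> fst c) \<longrightarrow> v c = 0)}"

definition tadd :: "('m, 'e::real_normed_vector) tvec \<Rightarrow> ('m, 'e) tvec \<Rightarrow> ('m, 'e) tvec" where
  "tadd w w' = (fst w, \<lambda>c. snd w c + snd w' c)"

definition tscale :: "real \<Rightarrow> ('m, 'e::real_normed_vector) tvec \<Rightarrow> ('m, 'e) tvec" where
  "tscale t w = (fst w, \<lambda>c. t *\<^sub>R snd w c)"

definition tdiff :: "('m, 'e::real_normed_vector) tvec \<Rightarrow> ('m, 'e) tvec \<Rightarrow> ('m, 'e) tvec" where
  "tdiff w w' = tadd w (tscale (-1) w')"

definition tangent_bundle ::
    "('m, 'e::real_normed_vector) atlas \<Rightarrow> (('m, 'e) tvec, 'e \<times> 'e) atlas" where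
  "tangent_bundle A =
     (\<lambda>(U, \<phi>). (\<Union>p\<in>U. tangent_space A p, \<lambda>w. (\<phi> (fst w), snd w (U, \<phi>)))) ` A"

text \<open>The tangent map, computed in an arbitrary chart around the base point of the argument.\<close>

definition tangent_map ::
    "('m, 'e::real_normed_vector) atlas \<Rightarrow> ('n, 'f::real_normed_vector) atlas \<Rightarrow> ('m \<Rightarrow> 'n) \<Rightarrow>
     ('m, 'e) tvec \<Rightarrow> ('n, 'f) tvec" where
  "tangent_map A B f w = (f (fst w), \<lambda>d.
     if d \<in> B \<and> f (fst w) \<in> fst d then
       (let c = (SOME c. c \<in> A \<and> fst w \<in> fst c)
        in frechet_derivative (snd d \<circ> f \<circ> inv_into (fst c) (snd c)) (at (snd c (fst w))) (snd w c))
     else 0)"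

text \<open>The vector \<open>v\<close>, as a tangent vector at the point \<open>u\<close> of a vector space.\<close>

definition vec_tangent :: "'e::real_normed_vector \<Rightarrow> 'e \<Rightarrow> ('e, 'e) tvec" where
  "vec_tangent u v = (u, \<lambda>c. if c = (UNIV, \<lambda>x. x) then v else 0)"

definition differential ::
    "('m, 'e::real_normed_vector) atlas \<Rightarrow> ('m \<Rightarrow> 'b::real_normed_vector) \<Rightarrow> ('m, 'e) tvec \<Rightarrow> 'b" where
  "differential A f w = snd (tangent_map A vector_atlas f w) (UNIV, \<lambda>x. x)"

section \<open>Tensor fields and connections\<close>

definition vector_field ::
    "('m, 'e::real_normed_vector) atlas \<Rightarrow> ('m \<Rightarrow> ('m, 'e) tvec) \<Rightarrow> bool" where
  "vector_field A X \<longleftrightarrow>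
     smooth_map A (tangent_bundle A) X \<and> (\<forall>p\<in>points A. X p \<in> tangent_space A p)"

definition lie_bracket ::
    "('m, 'e::real_normed_vector) atlas \<Rightarrow> ('m \<Rightarrow> ('m, 'e) tvec) \<Rightarrow> ('m \<Rightarrow> ('m, 'e) tvec) \<Rightarrow>
     'm \<Rightarrow> ('m, 'e) tvec" where
  "lie_bracket A X Y p = (p, \<lambda>c. if c \<in> A \<and> p \<in> fst c then
     (let Xc = (\<lambda>x. snd (X (inv_into (fst c) (snd c) x)) c);
          Yc = (\<lambda>x. snd (Y (inv_into (fst c) (snd c) x)) c);
          x = snd c p
      in frechet_derivative Yc (at x) (Xc x) - frechet_derivative Xc (at x) (Yc x))
     else 0)"

text \<open>
  A covector at \<open>p\<close> is a function on tangent vectors that is linear on the tangent space at \<open>p\<close>;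
  its other values are irrelevant. A 1-form is a smooth function on the total space of the tangent
  bundle that is linear on the fibres.
\<close>

definition covector :: "('m, 'e::real_normed_vector) atlas \<Rightarrow> 'm \<Rightarrow> (('m, 'e) tvec \<Rightarrow> real) \<Rightarrow> bool" where
  "covector A p \<alpha> \<longleftrightarrow>
     (\<forall>w\<in>tangent_space A p. \<forall>w'\<in>tangent_space A p. \<alpha> (tadd w w') = \<alpha> w + \<alpha> w') \<and>
     (\<forall>t. \<forall>w\<in>tangent_space A p. \<alpha> (tscale t w) = t * \<alpha> w)"

definition one_form :: "('m, 'e::real_normed_vector) atlas \<Rightarrow> (('m, 'e) tvec \<Rightarrow> real) \<Rightarrow> bool" where
  "one_form A \<alpha> \<longleftrightarrow> smooth_function (tangent_bundle A) \<alpha> \<and> (\<forall>p\<in>points A. covector A p \<alpha>)"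

text \<open>
  Bivector fields in the sense of contravariant tensor fields of degree 2, symmetric or not. The
  second conjunct says that the value depends only on the covectors at the given point, not on the
  irrelevant values of the functions representing them.
\<close>

definition bivector_field ::
    "('m, 'e::real_normed_vector) atlas \<Rightarrow>
     ('m \<Rightarrow> (('m, 'e) tvec \<Rightarrow> real) \<Rightarrow> (('m, 'e) tvec \<Rightarrow> real) \<Rightarrow> real) \<Rightarrow> bool" where
  "bivector_field A P \<longleftrightarrow>
     (\<forall>\<alpha> \<beta>. one_form A \<alpha> \<and> one_form A \<beta> \<longrightarrow> smooth_function A (\<lambda>p. P p \<alpha> \<beta>)) \<and>
     (\<forall>p\<in>points A. \<forall>\<alpha> \<alpha>' \<beta> \<beta>'.
        covector A p \<alpha> \<and> covector A p \<alpha>' \<and> covector A p \<beta> \<and> covector A p \<beta>' \<and>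
        (\<forall>w\<in>tangent_space A p. \<alpha> w = \<alpha>' w \<and> \<beta> w = \<beta>' w) \<longrightarrow> P p \<alpha> \<beta> = P p \<alpha>' \<beta>') \<and>
     (\<forall>p\<in>points A. \<forall>\<alpha> \<beta> \<gamma> t. covector A p \<alpha> \<and> covector A p \<beta> \<and> covector A p \<gamma> \<longrightarrow>
        P p (\<lambda>w. \<alpha> w + t * \<beta> w) \<gamma> = P p \<alpha> \<gamma> + t * P p \<beta> \<gamma> \<and>
        P p \<gamma> (\<lambda>w. \<alpha> w + t * \<beta> w) = P p \<gamma> \<alpha> + t * P p \<gamma> \<beta>)"

definition endomorphism_field ::
    "('m, 'e::real_normed_vector) atlas \<Rightarrow> (('m, 'e) tvec \<Rightarrow> ('m, 'e) tvec) \<Rightarrow> bool" where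
  "endomorphism_field A J \<longleftrightarrow> smooth_map (tangent_bundle A) (tangent_bundle A) J \<and>
     (\<forall>p\<in>points A. \<forall>w\<in>tangent_space A p. J w \<in> tangent_space A p \<and>
        (\<forall>w'\<in>tangent_space A p. J (tadd w w') = tadd (J w) (J w')) \<and>
        (\<forall>t. J (tscale t w) = tscale t (J w)))"

text \<open>
  Vector fields are functions on the ambient type of the manifold; \<open>points_eq\<close> expresses that they
  agree as vector fields.
\<close>

definition points_eq :: "('m, 'e) atlas \<Rightarrow> ('m \<Rightarrow> 'b) \<Rightarrow> ('m \<Rightarrow> 'b) \<Rightarrow> bool" where
  "points_eq A X Y \<longleftrightarrow> (\<forall>p\<in>points A. X p = Y p)"

definition connection ::
    "('m, 'e::real_normed_vector) atlas \<Rightarrow>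
     (('m \<Rightarrow> ('m, 'e) tvec) \<Rightarrow> ('m \<Rightarrow> ('m, 'e) tvec) \<Rightarrow> 'm \<Rightarrow> ('m, 'e) tvec) \<Rightarrow> bool" where
  "connection A D \<longleftrightarrow>
     (\<forall>X Y. vector_field A X \<and> vector_field A Y \<longrightarrow> vector_field A (D X Y)) \<and>
     (\<forall>X X' Y Y'. vector_field A X \<and> vector_field A X' \<and> vector_field A Y \<and> vector_field A Y' \<and>
        points_eq A X X' \<and> points_eq A Y Y' \<longrightarrow> points_eq A (D X Y) (D X' Y')) \<and>
     (\<forall>X X' Y. vector_field A X \<and> vector_field A X' \<and> vector_field A Y \<longrightarrow>
        points_eq A (D (\<lambda>p. tadd (X p) (X' p)) Y) (\<lambda>p. tadd (D X Y p) (D X' Y p))) \<and>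
     (\<forall>f X Y. smooth_function A f \<and> vector_field A X \<and> vector_field A Y \<longrightarrow>
        points_eq A (D (\<lambda>p. tscale (f p) (X p)) Y) (\<lambda>p. tscale (f p) (D X Y p))) \<and>
     (\<forall>X Y Y'. vector_field A X \<and> vector_field A Y \<and> vector_field A Y' \<longrightarrow>
        points_eq A (D X (\<lambda>p. tadd (Y p) (Y' p))) (\<lambda>p. tadd (D X Y p) (D X Y' p))) \<and>
     (\<forall>f X Y. smooth_function A f \<and> vector_field A X \<and> vector_field A Y \<longrightarrow>
        points_eq A (D X (\<lambda>p. tscale (f p) (Y p)))
          (\<lambda>p. tadd (tscale (f p) (D X Y p)) (tscale (differential A f (X p)) (Y p))))"

section \<open>Transport along a diffeomorphism\<close>

definition push_field where
  "push_field A B F X = (\<lambda>y. tangent_map A B F (X (inv_into (points A) F y)))"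

definition push_connection where
  "push_connection A B F D = (\<lambda>X Y. push_field A B F
     (D (push_field B A (inv_into (points A) F) X) (push_field B A (inv_into (points A) F) Y)))"

definition push_endomorphism where
  "push_endomorphism A B F J =
     (\<lambda>w. tangent_map A B F (J (tangent_map B A (inv_into (points A) F) w)))"

definition push_bivector where
  "push_bivector A B F P =
     (\<lambda>y \<alpha> \<beta>. P (inv_into (points A) F y) (\<alpha> \<circ> tangent_map A B F) (\<beta> \<circ> tangent_map A B F))"

section \<open>Structures on the tangent bundle of a manifold with a connection\<close>

text \<open>The bundle projection is \<^const>\<open>fst\<close>. All lifts below are to the point \<open>v\<close> of \<open>TM\<close>.\<close>

text \<open>The vertical lift is the velocity at \<open>t = 0\<close> of the curve \<open>t \<mapsto> v + t w\<close> in the fibre.\<close>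

definition vertical_lift ::
    "('m, 'e::real_normed_vector) atlas \<Rightarrow> ('m, 'e) tvec \<Rightarrow> ('m, 'e) tvec \<Rightarrow>
     (('m, 'e) tvec, 'e \<times> 'e) tvec" where
  "vertical_lift A w v =
     tangent_map vector_atlas (tangent_bundle A) (\<lambda>t::real. tadd v (tscale t w)) (vec_tangent 0 1)"

text \<open>
  The horizontal lift of \<open>w\<close> is characterised by \<open>T Y (w) = w\<^sup>h + (D\<^sub>w Y)\<^sup>v\<close> for every vector field \<open>Y\<close>
  through \<open>v\<close>: it is the velocity along \<open>w\<close> of a field \<open>Y\<close> with \<open>D\<^sub>w Y = 0\<close>.
\<close>

definition horizontal_lift ::
    "('m, 'e::real_normed_vector) atlas \<Rightarrow>
     (('m \<Rightarrow> ('m, 'e) tvec) \<Rightarrow> ('m \<Rightarrow> ('m, 'e) tvec) \<Rightarrow> 'm \<Rightarrow> ('m, 'e) tvec) \<Rightarrow>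
     ('m, 'e) tvec \<Rightarrow> ('m, 'e) tvec \<Rightarrow> (('m, 'e) tvec, 'e \<times> 'e) tvec" where
  "horizontal_lift A D w v = (THE \<xi>. \<forall>X Y.
     vector_field A X \<and> vector_field A Y \<and> X (fst w) = w \<and> Y (fst v) = v \<longrightarrow>
     \<xi> = tdiff (tangent_map A (tangent_bundle A) Y w) (vertical_lift A (D X Y (fst v)) v))"

definition hlift_field where
  "hlift_field A D X = (\<lambda>v. horizontal_lift A D (X (fst v)) v)"

definition vlift_field where
  "vlift_field A X = (\<lambda>v. vertical_lift A (X (fst v)) v)"

text \<open>
  The components \<open>w\<close>, \<open>w'\<close> of \<open>\<xi> = w\<^sup>h + w'\<^sup>v\<close>, and the forms \<open>\<alpha>\<^sup>h\<close>, \<open>\<alpha>\<^sup>v\<close>, whose values on \<open>\<xi>\<close> are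
  \<open>\<alpha>(w)\<close> and \<open>\<alpha>(w')\<close>.
\<close>

definition horizontal_part where
  "horizontal_part A D \<xi> = (THE w. w \<in> tangent_space A (fst (fst \<xi>)) \<and>
     (\<exists>w'\<in>tangent_space A (fst (fst \<xi>)).
        \<xi> = tadd (horizontal_lift A D w (fst \<xi>)) (vertical_lift A w' (fst \<xi>))))"

definition vertical_part where
  "vertical_part A D \<xi> = (THE w'. w' \<in> tangent_space A (fst (fst \<xi>)) \<and>
     (\<exists>w\<in>tangent_space A (fst (fst \<xi>)).
        \<xi> = tadd (horizontal_lift A D w (fst \<xi>)) (vertical_lift A w' (fst \<xi>))))"

definition hlift_form where
  "hlift_form A D \<alpha> = (\<lambda>\<xi>. \<alpha> (horizontal_part A D \<xi>))"

definition vlift_form where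
  "vlift_form A D \<alpha> = (\<lambda>\<xi>. \<alpha> (vertical_part A D \<xi>))"

definition is_tangent_connection where
  "is_tangent_connection A D Dbar \<longleftrightarrow> connection (tangent_bundle A) Dbar \<and>
     (\<forall>X Y. vector_field A X \<and> vector_field A Y \<longrightarrow>
        points_eq (tangent_bundle A) (Dbar (hlift_field A D X) (hlift_field A D Y))
          (hlift_field A D (D X Y)) \<and>
        points_eq (tangent_bundle A) (Dbar (hlift_field A D X) (vlift_field A Y))
          (vlift_field A (D X Y)) \<and>
        points_eq (tangent_bundle A) (Dbar (vlift_field A X) (hlift_field A D Y))
          (\<lambda>v. (v, \<lambda>_. 0)) \<and>
        points_eq (tangent_bundle A) (Dbar (vlift_field A X) (vlift_field A Y))
          (\<lambda>v. (v, \<lambda>_. 0)))"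

definition is_tangent_complex_structure where
  "is_tangent_complex_structure A D J \<longleftrightarrow> endomorphism_field (tangent_bundle A) J \<and>
     (\<forall>X. vector_field A X \<longrightarrow> (\<forall>v\<in>points (tangent_bundle A).
        J (hlift_field A D X v) = vlift_field A X v \<and>
        J (vlift_field A X v) = tscale (-1) (hlift_field A D X v)))"

definition is_tangent_poisson where
  "is_tangent_poisson A D h P \<longleftrightarrow> bivector_field (tangent_bundle A) P \<and>
     (\<forall>\<alpha> \<beta>. one_form A \<alpha> \<and> one_form A \<beta> \<longrightarrow> (\<forall>v\<in>points (tangent_bundle A).
        P v (vlift_form A D \<alpha>) (vlift_form A D \<beta>) = 0 \<and>
        P v (hlift_form A D \<alpha>) (hlift_form A D \<beta>) = 0 \<and>
        P v (hlift_form A D \<alpha>) (vlift_form A D \<beta>) = h (fst v) \<alpha> \<beta> \<and>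
        P v (vlift_form A D \<beta>) (hlift_form A D \<alpha>) = - h (fst v) \<alpha> \<beta>))"

section \<open>Lie groups and right invariant objects\<close>

definition lie_group :: "'a monoid \<Rightarrow> ('a, 'e::real_normed_vector) atlas \<Rightarrow> bool" where
  "lie_group G A \<longleftrightarrow> group G \<and> smooth_manifold A \<and> points A = carrier G \<and>
     smooth_map (prod_atlas A A) A (\<lambda>(x, y). x \<otimes>\<^bsub>G\<^esub> y) \<and>
     smooth_map A A (\<lambda>x. inv\<^bsub>G\<^esub> x)"

text \<open>
  In the following \<open>\<iota>\<close> identifies a vector space with the tangent space of the group at the
  identity.
\<close>

definition is_identification ::
    "'a monoid \<Rightarrow> ('a, 'e::real_normed_vector) atlas \<Rightarrow> ('g::real_vector \<Rightarrow> ('a, 'e) tvec) \<Rightarrow> bool" where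
  "is_identification G A \<iota> \<longleftrightarrow>
     bij_betw \<iota> UNIV (tangent_space A \<one>\<^bsub>G\<^esub>) \<and>
     (\<forall>u v. \<iota> (u + v) = tadd (\<iota> u) (\<iota> v)) \<and> (\<forall>t u. \<iota> (t *\<^sub>R u) = tscale t (\<iota> u))"

definition left_inv_field where
  "left_inv_field G A \<iota> u = (\<lambda>x. tangent_map A A (\<lambda>y. x \<otimes>\<^bsub>G\<^esub> y) (\<iota> u))"

definition right_inv_field where
  "right_inv_field G A \<iota> u = (\<lambda>x. tangent_map A A (\<lambda>y. y \<otimes>\<^bsub>G\<^esub> x) (\<iota> u))"

text \<open>
  The bracket on the tangent space at the identity is, as usual, the one given by left invariant
  vector fields.
\<close>

definition has_lie_algebra where
  "has_lie_algebra G A \<iota> br \<longleftrightarrow> is_identification G A \<iota> \<and>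
     (\<forall>u v. \<iota> (br u v) =
        lie_bracket A (left_inv_field G A \<iota> u) (left_inv_field G A \<iota> v) \<one>\<^bsub>G\<^esub>)"

text \<open>
  Contravariant 2-tensors on \<open>'g\<close> are bilinear forms on the dual space \<open>'g \<Rightarrow>\<^sub>L real\<close>. The right
  invariant field is obtained by pulling covectors back to the identity.
\<close>

definition right_inv_bivector where
  "right_inv_bivector G A \<iota> r = (\<lambda>x \<alpha> \<beta>.
     r (Blinfun (\<lambda>u. \<alpha> (right_inv_field G A \<iota> u x)))
       (Blinfun (\<lambda>u. \<beta> (right_inv_field G A \<iota> u x))))"

text \<open>The endomorphism field with \<open>J\<^sup>- u\<^sup>- = (J u)\<^sup>-\<close>.\<close>

definition right_inv_endomorphism where
  "right_inv_endomorphism G A \<iota> J = (\<lambda>w.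
     right_inv_field G A \<iota> (J (THE u. right_inv_field G A \<iota> u (fst w) = w)) (fst w))"

text \<open>The right invariant connection with \<open>D\<^bsub>u\<^sup>-\<^esub> v\<^sup>- = (b u v)\<^sup>-\<close>.\<close>

definition is_right_inv_connection where
  "is_right_inv_connection G A \<iota> b D \<longleftrightarrow> connection A D \<and>
     (\<forall>u v. points_eq A (D (right_inv_field G A \<iota> u) (right_inv_field G A \<iota> v))
        (right_inv_field G A \<iota> (b u v)))"

definition general_linear_group :: "('g::real_normed_vector \<Rightarrow>\<^sub>L 'g) monoid" where
  "general_linear_group =
     \<lparr>carrier = {f. \<exists>f'. f o\<^sub>L f' = id_blinfun \<and> f' o\<^sub>L f = id_blinfun},
      mult = (o\<^sub>L), one = id_blinfun\<rparr>"

definition semidirect ::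
    "'a monoid \<Rightarrow> ('a \<Rightarrow> 'g::real_normed_vector \<Rightarrow>\<^sub>L 'g) \<Rightarrow> ('a \<times> 'g) monoid" where
  "semidirect G \<rho> =
     \<lparr>carrier = carrier G \<times> UNIV,
      mult = (\<lambda>(g, u) (h, v). (g \<otimes>\<^bsub>G\<^esub> h, u + blinfun_apply (\<rho> g) v)),
      one = (\<one>\<^bsub>G\<^esub>, 0)\<rparr>"

text \<open>The identification of \<open>'g \<times> 'g\<close> with the tangent space of \<open>G \<times> 'g\<close> at \<open>(1, 0)\<close>.\<close>

definition prod_identification ::
    "'a monoid \<Rightarrow> ('a, 'e::real_normed_vector) atlas \<Rightarrow>
     ('g::real_normed_vector \<Rightarrow> ('a, 'e) tvec) \<Rightarrow> 'g \<times> 'g \<Rightarrow> ('a \<times> 'g, 'e \<times> 'g) tvec" where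
  "prod_identification G A \<iota> = (\<lambda>(a, b).
     tadd (tangent_map A (prod_atlas A vector_atlas) (\<lambda>x. (x, 0)) (\<iota> a))
          (tangent_map vector_atlas (prod_atlas A vector_atlas) (\<lambda>u. (\<one>\<^bsub>G\<^esub>, u)) (vec_tangent 0 b)))"

text \<open>The diffeomorphism from \<open>TG\<close> to \<open>G \<times> 'g\<close> given by right translation to the identity.\<close>

definition right_trivialization ::
    "'a monoid \<Rightarrow> ('a, 'e::real_normed_vector) atlas \<Rightarrow> ('g \<Rightarrow> ('a, 'e) tvec) \<Rightarrow>
     ('a, 'e) tvec \<Rightarrow> 'a \<times> 'g" where
  "right_trivialization G A \<iota> w = (fst w,
     inv_into UNIV \<iota> (tangent_map A A (\<lambda>y. y \<otimes>\<^bsub>G\<^esub> inv\<^bsub>G\<^esub> (fst w)) w))"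

section \<open>Left symmetric algebras\<close>

definition associator :: "('g::real_vector \<Rightarrow> 'g \<Rightarrow> 'g) \<Rightarrow> 'g \<Rightarrow> 'g \<Rightarrow> 'g \<Rightarrow> 'g" where
  "associator m u v w = m (m u v) w - m u (m v w)"

definition left_symmetric_algebra :: "('g::real_vector \<Rightarrow> 'g \<Rightarrow> 'g) \<Rightarrow> bool" where
  "left_symmetric_algebra m \<longleftrightarrow>
     bilinear m \<and> (\<forall>u v w. associator m u v w = associator m v u w)"

definition commutator :: "('g::real_vector \<Rightarrow> 'g \<Rightarrow> 'g) \<Rightarrow> 'g \<Rightarrow> 'g \<Rightarrow> 'g" where
  "commutator m u v = m u v - m v u"

definition sharp ::
    "(('g::real_normed_vector \<Rightarrow>\<^sub>L real) \<Rightarrow> ('g \<Rightarrow>\<^sub>L real) \<Rightarrow> real) \<Rightarrow> ('g \<Rightarrow>\<^sub>L real) \<Rightarrow> 'g" where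
  "sharp r \<alpha> = (THE u. \<forall>\<beta>. blinfun_apply \<beta> u = r \<alpha> \<beta>)"

definition coleft ::
    "('g::real_normed_vector \<Rightarrow> 'g \<Rightarrow> 'g) \<Rightarrow> 'g \<Rightarrow> ('g \<Rightarrow>\<^sub>L real) \<Rightarrow> ('g \<Rightarrow>\<^sub>L real)" where
  "coleft m u \<alpha> = Blinfun (\<lambda>v. - blinfun_apply \<alpha> (m u v))"

definition schouten ::
    "('g::real_normed_vector \<Rightarrow> 'g \<Rightarrow> 'g) \<Rightarrow> (('g \<Rightarrow>\<^sub>L real) \<Rightarrow> ('g \<Rightarrow>\<^sub>L real) \<Rightarrow> real) \<Rightarrow>
     ('g \<Rightarrow>\<^sub>L real) \<Rightarrow> ('g \<Rightarrow>\<^sub>L real) \<Rightarrow> ('g \<Rightarrow>\<^sub>L real) \<Rightarrow> real" where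
  "schouten m r \<alpha> \<beta> \<gamma> = blinfun_apply \<gamma>
     (sharp r (coleft m (sharp r \<alpha>) \<beta> - coleft m (sharp r \<beta>) \<alpha>)
      - commutator m (sharp r \<alpha>) (sharp r \<beta>))"

text \<open>
  A covector \<open>\<theta>\<close> on \<open>'g \<times> 'g\<close> corresponds to the pair of its restrictions to the two factors.
\<close>

definition dual_fst :: "(('g::real_normed_vector \<times> 'g) \<Rightarrow>\<^sub>L real) \<Rightarrow> ('g \<Rightarrow>\<^sub>L real)" where
  "dual_fst \<theta> = Blinfun (\<lambda>a. blinfun_apply \<theta> (a, 0))"

definition dual_snd :: "(('g::real_normed_vector \<times> 'g) \<Rightarrow>\<^sub>L real) \<Rightarrow> ('g \<Rightarrow>\<^sub>L real)" where
  "dual_snd \<theta> = Blinfun (\<lambda>b. blinfun_apply \<theta> (0, b))"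

definition double_tensor where
  "double_tensor r \<theta>\<^sub>1 \<theta>\<^sub>2 =
     r (dual_fst \<theta>\<^sub>1) (dual_snd \<theta>\<^sub>2) - r (dual_fst \<theta>\<^sub>2) (dual_snd \<theta>\<^sub>1)"

definition double_product :: "('g::real_vector \<Rightarrow> 'g \<Rightarrow> 'g) \<Rightarrow> 'g \<times> 'g \<Rightarrow> 'g \<times> 'g \<Rightarrow> 'g \<times> 'g" where
  "double_product m = (\<lambda>(a, b) (c, d). (m a c, m a d))"

text \<open>
  The source writes \<open>(b, -a)\<close> here, which is incompatible with \<open>J X\<^sup>h = X\<^sup>v\<close>, \<open>J X\<^sup>v = - X\<^sup>h\<close>: in the
  right trivialization \<open>(a, b)\<^sup>- = (a\<^sup>-)\<^sup>h + (b\<^sup>-)\<^sup>v\<close>, and \<open>J\<close> maps this to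
  \<open>- (b\<^sup>-)\<^sup>h + (a\<^sup>-)\<^sup>v = (-b, a)\<^sup>-\<close>. The sign is corrected.
\<close>

definition double_complex_structure :: "'g::real_vector \<times> 'g \<Rightarrow> 'g \<times> 'g" where
  "double_complex_structure = (\<lambda>(a, b). (-b, a))"

end

theory Submission
  imports Defs
begin

text \<open>
  In the right trivialization, vector fields \<open>X\<close>, \<open>Y\<close> on \<open>G\<close> are functions \<open>x\<close>, \<open>y\<close> with values in the
  algebra, and \<open>\<nabla>\<^sub>X Y\<close> becomes \<open>dy(X) - x \<bullet> y\<close>. Hence the horizontal lift of \<open>a\<^sup>-\<close> to the point \<open>(g, v)\<close>
  has components \<open>(a\<^sup>-, a \<bullet> v)\<close>. Since \<open>d\<rho> = L\<close>, this is the right invariant field \<open>(a, 0)\<^sup>-\<close> of the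
  semidirect product; the vertical lift of \<open>b\<^sup>-\<close> is \<open>(0, b)\<^sup>-\<close>. So the structures transported from \<open>TG\<close>
  and the right invariant ones agree on a global frame, which determines them. Both lifts are computed
  without charts, by the chain rule for \<open>Y = \<Phi> \<circ> (id, y)\<close> with \<open>\<Phi>(g, u) = u\<^sup>-(g)\<close>.
\<close>

section \<open>Smooth maps between open sets\<close>

text \<open>Agreement on a frame settles little by itself: a connection is recovered only after both
  fields are expanded with smooth coefficients, and \<open>P\<close>, being prescribed on lifted
  1-forms, yields values on a covector only once that covector is extended to a 1-form. Both steps
  call for a frame that is smooth and has smooth coordinates, which is the notion
  \<open>parallelism\<close>. Its source is the partial tangent map of the multiplication in the
  first factor, smooth in the tangent vector and the group element together. On TG the frame is not
  assembled from the lifts; it is carried over from the semidirect product by \<open>\<Phi>\<close>,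
  and the lifts inherit their smoothness by being recognised as its members.

  Tangent vectors are families of components over all charts. Charts are left behind through two
  reductions: one component determines a tangent vector, and a tangent vector of a product with a
  vector space is determined by its two projections.\<close>

lemma frechet_derivative_cong_open:
  assumes "open S" "x \<in> S" "\<And>y. y \<in> S \<Longrightarrow> f y = g y"
  shows "frechet_derivative f (at x) = frechet_derivative g (at x)"
proof -
  \<comment> \<open>\<open>frechet_derivative\<close> is a choice among all derivatives, so it
    depends only on the predicate \<open>has_derivative\<close>. Equivalence for every
    \<open>D\<close> gives equality even where no derivative exists.\<close>
  have "(f has_derivative D) (at x) \<longleftrightarrow> (g has_derivative D) (at x)" for D
    using has_derivative_transform_within_open[OF _ assms(1,2), of f D UNIV g]
      has_derivative_transform_within_open[OF _ assms(1,2), of g D UNIV f] assms(3)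
    by auto
  then show ?thesis
    by (simp add: frechet_derivative_def)
qed

lemma differentiable_cong_open:
  assumes "open S" "x \<in> S" "\<And>y. y \<in> S \<Longrightarrow> f y = g y" "f differentiable (at x)"
  shows "g differentiable (at x)"
  using assms(4) has_derivative_transform_within_open[OF _ assms(1,2), of f _ UNIV g] assms(3)
  unfolding differentiable_def by blast

lemma C_k_on_cong:
  assumes "open S" "\<And>x. x \<in> S \<Longrightarrow> f x = g x" "C_k_on k S f"
  shows "C_k_on k S g"
  using assms(2,3)
proof (induction k arbitrary: f g)
  case 0
  then show ?case
    by (simp cong: continuous_on_cong)
next
  case (Suc k)
  have "g differentiable (at x)" if "x \<in> S" for x
    using differentiable_cong_open[OF assms(1) that Suc.prems(1)] Suc.prems(2) that by simp
  moreover have "C_k_on k S (\<lambda>x. frechet_derivative g (at x) v)" for v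
  proof (rule Suc.IH)
    show "frechet_derivative f (at x) v = frechet_derivative g (at x) v" if "x \<in> S" for x
      using frechet_derivative_cong_open[OF assms(1) that Suc.prems(1)] by simp
    show "C_k_on k S (\<lambda>x. frechet_derivative f (at x) v)"
      using Suc.prems(2) by simp
  qed
  ultimately show ?case
    by simp
qed

lemma C_k_on_subset: "C_k_on k S f \<Longrightarrow> T \<subseteq> S \<Longrightarrow> C_k_on k T f"
  by (induction k arbitrary: f) (auto intro: continuous_on_subset)

text \<open>Each derivative in \<open>C_k_on\<close> is taken over a full neighbourhood of its
  point, so the condition is local. This glues the local representatives in
  \<open>smooth_map_localI\<close>.\<close>

lemma C_k_on_local:
  assumes "\<And>x. x \<in> S \<Longrightarrow> \<exists>T. open T \<and> x \<in> T \<and> C_k_on k T f"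
  shows "C_k_on k S f"
  using assms
proof (induction k arbitrary: f)
  case 0
  show ?case
    unfolding C_k_on.simps
  proof (rule continuous_at_imp_continuous_on, rule ballI)
    fix x assume "x \<in> S"
    then obtain T where "open T" "x \<in> T" "continuous_on T f"
      using "0" unfolding C_k_on.simps by blast
    then show "isCont f x"
      by (simp add: continuous_on_eq_continuous_at)
  qed
next
  case (Suc k)
  have *: "\<exists>T. open T \<and> x \<in> T \<and> f differentiable (at x) \<and>
      (\<forall>v. C_k_on k T (\<lambda>x. frechet_derivative f (at x) v))" if "x \<in> S" for x
    using Suc.prems[OF that] unfolding C_k_on.simps by blast
  have "C_k_on k S (\<lambda>x. frechet_derivative f (at x) v)" for v
  proof (rule Suc.IH)
    show "\<exists>T. open T \<and> x \<in> T \<and> C_k_on k T (\<lambda>x. frechet_derivative f (at x) v)" if "x \<in> S" for x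
      using *[OF that] by blast
  qed
  moreover have "\<forall>x\<in>S. f differentiable (at x)"
    using * by blast
  ultimately show ?case
    unfolding C_k_on.simps by blast
qed

lemma C_k_on_SucD: "C_k_on (Suc k) S f \<Longrightarrow> C_k_on k S f"
proof (induction k arbitrary: f)
  case 0
  then show ?case
    by (auto intro: continuous_at_imp_continuous_on differentiable_imp_continuous_within)
next
  case (Suc k)
  have "\<forall>x\<in>S. f differentiable at x" "\<And>v. C_k_on (Suc k) S (\<lambda>x. frechet_derivative f (at x) v)"
    using Suc.prems unfolding C_k_on.simps(2)[of "Suc k"] by blast+
  then have "\<And>v. C_k_on k S (\<lambda>x. frechet_derivative f (at x) v)"
    using Suc.IH by blast
  with \<open>\<forall>x\<in>S. f differentiable at x\<close> show ?case
    unfolding C_k_on.simps(2)[of k] by blast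
qed

text \<open>An explicit derivative replaces the choice inside \<open>frechet_derivative\<close>. The
  closure lemmas for sums, pairs, products and composites are inductions on \<open>k\<close> through
  this rule, fed with the matching differentiation rule.\<close>

lemma C_k_on_SucI:
  assumes "open S"
    and "\<And>x. x \<in> S \<Longrightarrow> (f has_derivative f' x) (at x)"
    and "\<And>v. C_k_on k S (\<lambda>x. f' x v)"
  shows "C_k_on (Suc k) S f"
proof -
  have "C_k_on k S (\<lambda>x. frechet_derivative f (at x) v)" for v
    by (rule C_k_on_cong[OF assms(1) _ assms(3)[of v]]) (simp add: frechet_derivative_at[OF assms(2)])
  then show ?thesis
    using assms(2) by (auto simp: differentiable_def)
qed

lemma C_k_on_SucE:
  assumes "C_k_on (Suc k) S f" "x \<in> S"
  shows "(f has_derivative frechet_derivative f (at x)) (at x)"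
  using assms by (simp add: frechet_derivative_works[symmetric])

lemma C_k_on_const: "open S \<Longrightarrow> C_k_on k S (\<lambda>x. c)"
proof (induction k arbitrary: c)
  case (Suc k)
  show ?case
    by (rule C_k_on_SucI[where f' = "\<lambda>x v. 0"]) (use Suc in auto)
qed simp

lemma C_k_on_add:
  assumes "open S" "C_k_on k S f" "C_k_on k S g"
  shows "C_k_on k S (\<lambda>x. f x + g x)"
  using assms(2,3)
proof (induction k arbitrary: f g)
  case (Suc k)
  show ?case
    by (rule C_k_on_SucI[OF assms(1) has_derivative_add[OF C_k_on_SucE C_k_on_SucE]])
      (use Suc in auto)
qed (auto intro: continuous_on_add)

lemma C_k_on_Pair:
  assumes "open S" "C_k_on k S f" "C_k_on k S g"
  shows "C_k_on k S (\<lambda>x. (f x, g x))"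
  using assms(2,3)
proof (induction k arbitrary: f g)
  case (Suc k)
  show ?case
    by (rule C_k_on_SucI[OF assms(1) has_derivative_Pair[OF C_k_on_SucE C_k_on_SucE]])
      (use Suc in auto)
qed (auto intro: continuous_on_Pair)

lemma C_k_on_bounded_linear:
  assumes "bounded_linear L" "open S" "C_k_on k S f"
  shows "C_k_on k S (\<lambda>x. L (f x))"
  using assms(3)
proof (induction k arbitrary: f)
  case 0
  then show ?case
    using bounded_linear.continuous_on[OF assms(1)] by simp
next
  case (Suc k)
  show ?case
    by (rule C_k_on_SucI[OF assms(2) bounded_linear.has_derivative[OF assms(1) C_k_on_SucE]])
      (use Suc in auto)
qed

lemma C_k_on_bounded_bilinear:
  assumes "bounded_bilinear b" "open S" "C_k_on k S f" "C_k_on k S g"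
  shows "C_k_on k S (\<lambda>x. b (f x) (g x))"
  using assms(3,4)
proof (induction k arbitrary: f g)
  case 0
  then show ?case
    using bounded_bilinear.continuous_on[OF assms(1)] by simp
next
  case (Suc k)
  \<comment> \<open>The Leibniz rule pairs each derivative with an undifferentiated factor; the
    latter has to be lowered to class \<open>k\<close> before the induction hypothesis
    applies.\<close>
  note f = C_k_on_SucD[OF Suc.prems(1)] and g = C_k_on_SucD[OF Suc.prems(2)]
  show ?case
  proof (rule C_k_on_SucI[OF assms(2) bounded_bilinear.FDERIV[OF assms(1) C_k_on_SucE C_k_on_SucE]])
    show "C_k_on k S (\<lambda>x. b (f x) (frechet_derivative g (at x) v) + b (frechet_derivative f (at x) v) (g x))" for v
      using Suc f g by (intro C_k_on_add[OF assms(2)] Suc.IH) auto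
  qed (use Suc.prems in auto)
qed

lemma C_k_on_sum:
  assumes "open S" "\<And>i. i \<in> I \<Longrightarrow> C_k_on k S (f i)"
  shows "C_k_on k S (\<lambda>x. \<Sum>i\<in>I. f i x)"
  using assms(2)
  by (induction I rule: infinite_finite_induct) (auto intro: C_k_on_const C_k_on_add assms(1))

lemma linear_eq_sum_Basis:
  fixes f :: "'a::euclidean_space \<Rightarrow> 'b::real_vector"
  assumes "linear f"
  shows "f x = (\<Sum>i\<in>Basis. (x \<bullet> i) *\<^sub>R f i)"
  using linear_sum[OF assms, of "\<lambda>i. (x \<bullet> i) *\<^sub>R i" Basis]
  by (simp add: euclidean_representation linear_cmul[OF assms])

text \<open>\<open>C_k_on\<close> controls the derivative only in fixed directions, while the chain
  rule evaluates the derivative of \<open>f\<close> in the moving direction given by the derivative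
  of \<open>g\<close>. Expanding that direction over \<open>Basis\<close> leaves scalar coefficients
  times derivatives in fixed directions; hence the Euclidean space in the middle.\<close>

lemma C_k_on_compose:
  fixes f :: "'b::euclidean_space \<Rightarrow> 'c::real_normed_vector"
  assumes "open S" "open T" "C_k_on k S g" "C_k_on k T f" "g ` S \<subseteq> T"
  shows "C_k_on k S (\<lambda>x. f (g x))"
  using assms(3,4)
proof (induction k arbitrary: f)
  case 0
  then show ?case
    using continuous_on_compose2[of T f S g] assms(5) by simp
next
  case (Suc k)
  note g = C_k_on_SucD[OF Suc.prems(1)]
  show ?case
  proof (rule C_k_on_SucI[OF assms(1)])
    fix x assume x: "x \<in> S"
    have f': "(f has_derivative frechet_derivative f (at (g x))) (at (g x))"
      using C_k_on_SucE[OF Suc.prems(2)] x assms(5) by auto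
    show "((\<lambda>x. f (g x)) has_derivative
        (\<lambda>v. \<Sum>i\<in>Basis. (frechet_derivative g (at x) v \<bullet> i) *\<^sub>R frechet_derivative f (at (g x)) i)) (at x)"
      using has_derivative_compose[OF C_k_on_SucE[OF Suc.prems(1) x] f']
      by (simp only: linear_eq_sum_Basis[OF has_derivative_linear[OF f'], symmetric])
  next
    fix v
    show "C_k_on k S (\<lambda>x. \<Sum>i\<in>Basis. (frechet_derivative g (at x) v \<bullet> i) *\<^sub>R frechet_derivative f (at (g x)) i)"
      using Suc.prems g
      by (intro C_k_on_sum C_k_on_bounded_bilinear[OF bounded_bilinear_scaleR] assms(1) Suc.IH
          C_k_on_bounded_linear[OF bounded_linear_inner_left]) auto
  qed
qed

lemma smooth_on_cong: "open S \<Longrightarrow> (\<And>x. x \<in> S \<Longrightarrow> f x = g x) \<Longrightarrow> smooth_on S f \<Longrightarrow> smooth_on S g"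
  unfolding smooth_on_def using C_k_on_cong by blast

lemma smooth_on_subset: "smooth_on S f \<Longrightarrow> T \<subseteq> S \<Longrightarrow> smooth_on T f"
  unfolding smooth_on_def using C_k_on_subset by blast

lemma smooth_on_local:
  assumes "\<And>x. x \<in> S \<Longrightarrow> \<exists>T. open T \<and> x \<in> T \<and> smooth_on T f"
  shows "smooth_on S f"
  unfolding smooth_on_def
proof
  fix k
  have "\<exists>T. open T \<and> x \<in> T \<and> C_k_on k T f" if "x \<in> S" for x
    using assms[OF that] unfolding smooth_on_def by blast
  then show "C_k_on k S f"
    by (rule C_k_on_local)
qed

lemma smooth_on_differentiable: "smooth_on S f \<Longrightarrow> x \<in> S \<Longrightarrow> f differentiable (at x)"
  unfolding smooth_on_def by (metis C_k_on.simps(2))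

lemma smooth_on_has_derivative:
  "smooth_on S f \<Longrightarrow> x \<in> S \<Longrightarrow> (f has_derivative frechet_derivative f (at x)) (at x)"
  using smooth_on_differentiable frechet_derivative_works by blast

lemma smooth_on_continuous: "smooth_on S f \<Longrightarrow> continuous_on S f"
  unfolding smooth_on_def by (metis C_k_on.simps(1))

lemma smooth_on_const: "open S \<Longrightarrow> smooth_on S (\<lambda>x. c)"
  by (simp add: smooth_on_def C_k_on_const)

lemma smooth_on_add: "open S \<Longrightarrow> smooth_on S f \<Longrightarrow> smooth_on S g \<Longrightarrow> smooth_on S (\<lambda>x. f x + g x)"
  by (simp add: smooth_on_def C_k_on_add)

lemma smooth_on_Pair: "open S \<Longrightarrow> smooth_on S f \<Longrightarrow> smooth_on S g \<Longrightarrow> smooth_on S (\<lambda>x. (f x, g x))"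
  by (simp add: smooth_on_def C_k_on_Pair)

lemma smooth_on_linear_compose:
  "bounded_linear L \<Longrightarrow> open S \<Longrightarrow> smooth_on S f \<Longrightarrow> smooth_on S (\<lambda>x. L (f x))"
  by (simp add: smooth_on_def C_k_on_bounded_linear)

lemma smooth_on_bilinear:
  "bounded_bilinear b \<Longrightarrow> open S \<Longrightarrow> smooth_on S f \<Longrightarrow> smooth_on S g \<Longrightarrow> smooth_on S (\<lambda>x. b (f x) (g x))"
  by (simp add: smooth_on_def C_k_on_bounded_bilinear)

lemma smooth_on_sum:
  "open S \<Longrightarrow> (\<And>i. i \<in> I \<Longrightarrow> smooth_on S (f i)) \<Longrightarrow> smooth_on S (\<lambda>x. \<Sum>i\<in>I. f i x)"
  by (simp add: smooth_on_def C_k_on_sum)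

lemma smooth_on_compose:
  fixes f :: "'b::euclidean_space \<Rightarrow> 'c::real_normed_vector"
  shows "open S \<Longrightarrow> open T \<Longrightarrow> smooth_on S g \<Longrightarrow> smooth_on T f \<Longrightarrow> g ` S \<subseteq> T \<Longrightarrow>
    smooth_on S (\<lambda>x. f (g x))"
  unfolding smooth_on_def by (blast intro: C_k_on_compose)

lemma smooth_on_id:
  assumes "open S"
  shows "smooth_on S (\<lambda>x. x)"
  unfolding smooth_on_def
proof
  show "C_k_on k S (\<lambda>x. x)" for k
  proof (cases k)
    case (Suc n)
    show ?thesis
      unfolding Suc by (rule C_k_on_SucI[where f' = "\<lambda>x v. v"]) (simp_all add: assms C_k_on_const)
  qed simp
qed

lemma smooth_on_bounded_linear: "bounded_linear L \<Longrightarrow> open S \<Longrightarrow> smooth_on S L"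
  using smooth_on_linear_compose smooth_on_id by blast

text \<open>Joint smoothness in base point and direction, by the same expansion over
  \<open>Basis\<close>. It makes the transition maps of the tangent bundle and all tangent maps
  smooth.\<close>

lemma smooth_on_derivative:
  fixes f :: "'a::euclidean_space \<Rightarrow> 'b::real_normed_vector"
  assumes "open S" "open T" "smooth_on S f" "smooth_on T g" "smooth_on T h" "g ` T \<subseteq> S"
  shows "smooth_on T (\<lambda>x. frechet_derivative f (at (g x)) (h x))"
proof (rule smooth_on_cong[OF assms(2)])
  fix x assume "x \<in> T"
  then show "(\<Sum>i\<in>Basis. (h x \<bullet> i) *\<^sub>R frechet_derivative f (at (g x)) i) =
      frechet_derivative f (at (g x)) (h x)"
    using linear_eq_sum_Basis[OF has_derivative_linear[OF smooth_on_has_derivative[OF assms(3)]]] assms(6)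
    by (metis image_subset_iff)
next
  have "smooth_on S (\<lambda>y. frechet_derivative f (at y) i)" for i
    using assms(3) unfolding smooth_on_def by (metis C_k_on.simps(2))
  then have "smooth_on T (\<lambda>x. frechet_derivative f (at (g x)) i)" for i
    using smooth_on_compose[OF assms(2,1,4) _ assms(6)] by blast
  then have "smooth_on T (\<lambda>x. (h x \<bullet> i) *\<^sub>R frechet_derivative f (at (g x)) i)" for i
    using smooth_on_bilinear[OF bounded_bilinear_scaleR assms(2)]
      smooth_on_linear_compose[OF bounded_linear_inner_left assms(2,5)] by blast
  then show "smooth_on T (\<lambda>x. \<Sum>i\<in>Basis. (h x \<bullet> i) *\<^sub>R frechet_derivative f (at (g x)) i)"
    by (rule smooth_on_sum[OF assms(2)])
qed

section \<open>Smooth maps between manifolds\<close>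

text \<open>The chart compatibility clauses of \<open>smooth_manifold\<close>, the property that is
  passed on below to products and tangent bundles.\<close>

definition smooth_atlas :: "('m, 'e::real_normed_vector) atlas \<Rightarrow> bool" where
  "smooth_atlas A \<longleftrightarrow>
     (\<forall>c\<in>A. inj_on (snd c) (fst c) \<and> open (snd c ` fst c)) \<and>
     (\<forall>c\<in>A. \<forall>d\<in>A. open (snd c ` (fst c \<inter> fst d)) \<and>
        smooth_on (snd c ` (fst c \<inter> fst d)) (snd d \<circ> inv_into (fst c) (snd c)))"

lemma smooth_manifold_smooth_atlas: "smooth_manifold A \<Longrightarrow> smooth_atlas A"
  unfolding smooth_manifold_def smooth_atlas_def by (simp add: case_prod_beta)

abbreviation chart_inv :: "('m, 'e) chart \<Rightarrow> 'e \<Rightarrow> 'm" where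
  "chart_inv c \<equiv> inv_into (fst c) (snd c)"

lemma
  assumes "smooth_atlas A" "c \<in> A"
  shows smooth_atlas_inj: "inj_on (snd c) (fst c)"
    and smooth_atlas_open: "open (snd c ` fst c)"
    and chart_inv_left: "p \<in> fst c \<Longrightarrow> chart_inv c (snd c p) = p"
  using assms by (auto simp: smooth_atlas_def)

lemma
  assumes "smooth_atlas A" "c \<in> A" "d \<in> A"
  shows transition_open: "open (snd c ` (fst c \<inter> fst d))"
    and transition_smooth: "smooth_on (snd c ` (fst c \<inter> fst d)) (\<lambda>x. snd d (chart_inv c x))"
  using assms unfolding smooth_atlas_def comp_def by blast+

lemma image_chart_Int_iff:
  assumes "smooth_atlas A" "c \<in> A"
  shows "x \<in> snd c ` (fst c \<inter> W) \<longleftrightarrow> x \<in> snd c ` fst c \<and> chart_inv c x \<in> W"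
  using chart_inv_left[OF assms] by auto

lemma smooth_map_iff:
  "smooth_map A B f \<longleftrightarrow> (\<forall>p\<in>points A. f p \<in> points B) \<and>
     (\<forall>c\<in>A. \<forall>d\<in>B. open (snd c ` (fst c \<inter> f -` fst d)) \<and>
        smooth_on (snd c ` (fst c \<inter> f -` fst d)) (\<lambda>x. snd d (f (chart_inv c x))))"
  unfolding smooth_map_def comp_def case_prod_beta image_subset_iff ..

lemma smooth_map_points: "smooth_map A B f \<Longrightarrow> p \<in> points A \<Longrightarrow> f p \<in> points B"
  by (auto simp: smooth_map_def)

lemma
  assumes "smooth_map A B f" "c \<in> A" "d \<in> B"
  shows smooth_map_open: "open (snd c ` (fst c \<inter> f -` fst d))"
    and smooth_map_smooth: "smooth_on (snd c ` (fst c \<inter> f -` fst d)) (\<lambda>x. snd d (f (chart_inv c x)))"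
  using assms unfolding smooth_map_iff by blast+

lemma points_chart: "p \<in> points A \<Longrightarrow> \<exists>c\<in>A. p \<in> fst c"
  by (auto simp: points_def)

lemma points_chartI: "c \<in> A \<Longrightarrow> p \<in> fst c \<Longrightarrow> p \<in> points A"
  by (auto simp: points_def)

text \<open>\<open>smooth_map\<close> quantifies over all pairs of charts, but in practice
  smoothness is seen near each point in one suitable pair. Transition maps on both sides carry it to
  every other pair.\<close>

lemma smooth_map_localI:
  fixes A :: "('m, 'e::euclidean_space) atlas" and B :: "('n, 'f::euclidean_space) atlas"
  assumes A: "smooth_atlas A" and B: "smooth_atlas B"
    and loc: "\<And>p. p \<in> points A \<Longrightarrow> \<exists>c\<in>A. \<exists>d\<in>B. \<exists>N. open N \<and> p \<in> fst c \<and> snd c p \<in> N \<and>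
      N \<subseteq> snd c ` fst c \<and> (\<forall>x\<in>N. f (chart_inv c x) \<in> fst d) \<and> smooth_on N (\<lambda>x. snd d (f (chart_inv c x)))"
  shows "smooth_map A B f"
proof -
  have f_points: "f p \<in> points B" if p: "p \<in> points A" for p
  proof -
    obtain c d N where "c \<in> A" "d \<in> B" "p \<in> fst c" "snd c p \<in> N" "\<forall>x\<in>N. f (chart_inv c x) \<in> fst d"
      using loc[OF p] by blast
    then have "f p \<in> fst d"
      using chart_inv_left[OF A] by metis
    then show ?thesis
      using \<open>d \<in> B\<close> by (rule points_chartI[rotated])
  qed
  have main: "\<exists>T. open T \<and> x \<in> T \<and> T \<subseteq> snd c' ` (fst c' \<inter> f -` fst d') \<and> smooth_on T (\<lambda>x. snd d' (f (chart_inv c' x)))"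
    if c': "c' \<in> A" and d': "d' \<in> B" and x: "x \<in> snd c' ` (fst c' \<inter> f -` fst d')" for c' d' x
  proof -
    obtain q where q: "q \<in> fst c'" "f q \<in> fst d'" "x = snd c' q"
      using x by blast
    have "q \<in> points A"
      using points_chartI c' q(1) .
    then obtain c d N where c: "c \<in> A" and d: "d \<in> B" and N: "open N" "q \<in> fst c" "snd c q \<in> N"
      "N \<subseteq> snd c ` fst c" "\<forall>x\<in>N. f (chart_inv c x) \<in> fst d" "smooth_on N (\<lambda>x. snd d (f (chart_inv c x)))"
      using loc by blast
    define t where "t = (\<lambda>x. snd c (chart_inv c' x))"
    define r where "r = (\<lambda>x. snd d (f (chart_inv c x)))"
    define T1 where "T1 = snd c' ` (fst c' \<inter> fst c)"
    define M where "M = snd d ` (fst d \<inter> fst d')"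
    \<comment> \<open>\<open>T2\<close> is where the transition \<open>t\<close> from
      \<open>c'\<close> to \<open>c\<close> lands in \<open>N\<close>; on \<open>T\<close> the local
      representative \<open>r\<close> moreover lands in the overlap of \<open>d\<close> and
      \<open>d'\<close>. Both are open as preimages, and on \<open>T\<close> the representative in
      \<open>c'\<close>, \<open>d'\<close> is the transition from \<open>d\<close> to
      \<open>d'\<close> after \<open>r\<close> after \<open>t\<close>.\<close>
    define T2 where "T2 = T1 \<inter> t -` N"
    define T where "T = T2 \<inter> (\<lambda>x. r (t x)) -` M"
    have T1: "open T1" "smooth_on T1 t"
      unfolding T1_def t_def by (rule transition_open[OF A c' c] transition_smooth[OF A c' c])+
    have M: "open M" "smooth_on M (\<lambda>x. snd d' (chart_inv d x))"
      unfolding M_def by (rule transition_open[OF B d d'] transition_smooth[OF B d d'])+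
    have T2: "open T2" "smooth_on T2 t" "t ` T2 \<subseteq> N"
      unfolding T2_def
      using continuous_open_preimage[OF smooth_on_continuous[OF T1(2)] T1(1) N(1)] smooth_on_subset[OF T1(2)]
      by auto
    have rt: "smooth_on T2 (\<lambda>x. r (t x))"
      using smooth_on_compose[OF T2(1) N(1) T2(2) N(6) T2(3)] by (simp add: r_def)
    have T: "open T" "smooth_on T (\<lambda>x. r (t x))" "(\<lambda>x. r (t x)) ` T \<subseteq> M"
      unfolding T_def using continuous_open_preimage[OF smooth_on_continuous[OF rt] T2(1) M(1)] smooth_on_subset[OF rt]
      by auto
    have inv_t: "chart_inv c (t y) = chart_inv c' y" "f (chart_inv c' y) \<in> fst d" if "y \<in> T2" for y
    proof -
      have "chart_inv c' y \<in> fst c"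
        using that image_chart_Int_iff[OF A c'] by (auto simp: T2_def T1_def)
      then show "chart_inv c (t y) = chart_inv c' y"
        unfolding t_def by (rule chart_inv_left[OF A c])
      then show "f (chart_inv c' y) \<in> fst d"
        using N(5) T2(3) that by (metis image_subset_iff)
    qed
    have r_t: "r (t y) = snd d (f (chart_inv c' y))" if "y \<in> T2" for y
      using inv_t[OF that] by (simp add: r_def)
    have sub: "T \<subseteq> snd c' ` (fst c' \<inter> f -` fst d')"
    proof
      fix y assume y: "y \<in> T"
      then have y2: "y \<in> T2"
        by (simp add: T_def)
      have "r (t y) \<in> M"
        using T(3) y by blast
      then have "f (chart_inv c' y) \<in> fst d'"
        using image_chart_Int_iff[OF B d] chart_inv_left[OF B d inv_t(2)[OF y2]] r_t[OF y2]
        unfolding M_def by metis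
      then show "y \<in> snd c' ` (fst c' \<inter> f -` fst d')"
        using y2 image_chart_Int_iff[OF A c'] by (auto simp: T2_def T1_def)
    qed
    have "chart_inv c' x = q"
      using chart_inv_left[OF A c' q(1)] q(3) by simp
    moreover have "x \<in> T1"
      using q N(2) by (auto simp: T1_def)
    ultimately have x2: "x \<in> T2"
      using N(3) by (auto simp: T2_def t_def)
    have "f q \<in> fst d"
      using inv_t(2)[OF x2] \<open>chart_inv c' x = q\<close> by simp
    then have "x \<in> T"
      using x2 r_t[OF x2] \<open>chart_inv c' x = q\<close> q(2) by (auto simp: T_def M_def)
    moreover have "smooth_on T (\<lambda>x. snd d' (f (chart_inv c' x)))"
    proof (rule smooth_on_cong[OF T(1)])
      show "smooth_on T (\<lambda>x. snd d' (chart_inv d (r (t x))))"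
        using smooth_on_compose[OF T(1) M(1) T(2) M(2) T(3)] .
      show "snd d' (chart_inv d (r (t y))) = snd d' (f (chart_inv c' y))" if "y \<in> T" for y
        using that r_t[of y] inv_t(2)[of y] chart_inv_left[OF B d] by (simp add: T_def)
    qed
    ultimately show ?thesis
      using T(1) sub by blast
  qed
  have "open (snd c' ` (fst c' \<inter> f -` fst d'))" if "c' \<in> A" "d' \<in> B" for c' d'
  proof (rule Topological_Spaces.openI)
    show "\<exists>T. open T \<and> x \<in> T \<and> T \<subseteq> snd c' ` (fst c' \<inter> f -` fst d')"
      if "x \<in> snd c' ` (fst c' \<inter> f -` fst d')" for x
      using main[OF \<open>c' \<in> A\<close> \<open>d' \<in> B\<close> that] by (elim exE conjE) (intro exI conjI)
  qed
  moreover have "smooth_on (snd c' ` (fst c' \<inter> f -` fst d')) (\<lambda>x. snd d' (f (chart_inv c' x)))"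
    if "c' \<in> A" "d' \<in> B" for c' d'
  proof (rule smooth_on_local)
    show "\<exists>T. open T \<and> x \<in> T \<and> smooth_on T (\<lambda>x. snd d' (f (chart_inv c' x)))"
      if "x \<in> snd c' ` (fst c' \<inter> f -` fst d')" for x
      using main[OF \<open>c' \<in> A\<close> \<open>d' \<in> B\<close> that] by (elim exE conjE) (intro exI conjI)
  qed
  ultimately show ?thesis
    using f_points unfolding smooth_map_iff by blast
qed

lemma smooth_map_localE:
  assumes "smooth_map A B f" "smooth_atlas A" "p \<in> points A"
  obtains c d N where "c \<in> A" "d \<in> B" "open N" "p \<in> fst c" "f p \<in> fst d" "snd c p \<in> N" "N \<subseteq> snd c ` fst c"
    "\<And>x. x \<in> N \<Longrightarrow> f (chart_inv c x) \<in> fst d" "smooth_on N (\<lambda>x. snd d (f (chart_inv c x)))"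
proof -
  obtain c d where cd: "c \<in> A" "p \<in> fst c" "d \<in> B" "f p \<in> fst d"
    using points_chart assms smooth_map_points by metis
  show ?thesis
    by (rule that[OF cd(1,3) smooth_map_open[OF assms(1) cd(1,3)] cd(2,4) _ _ _ smooth_map_smooth[OF assms(1) cd(1,3)]])
      (use cd image_chart_Int_iff[OF assms(2) cd(1)] chart_inv_left[OF assms(2) cd(1,2)] in auto)
qed

lemma smooth_map_compose:
  fixes A :: "('m, 'e::euclidean_space) atlas" and B :: "('n, 'f::euclidean_space) atlas"
    and C :: "('k, 'h::euclidean_space) atlas"
  assumes A: "smooth_atlas A" and B: "smooth_atlas B" and C: "smooth_atlas C"
    and f: "smooth_map A B f" and g: "smooth_map B C g"
  shows "smooth_map A C (\<lambda>p. g (f p))"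
proof (rule smooth_map_localI[OF A C])
  fix p assume p: "p \<in> points A"
  obtain c d N where N: "c \<in> A" "d \<in> B" "open N" "p \<in> fst c" "f p \<in> fst d" "snd c p \<in> N" "N \<subseteq> snd c ` fst c"
    "\<And>x. x \<in> N \<Longrightarrow> f (chart_inv c x) \<in> fst d" "smooth_on N (\<lambda>x. snd d (f (chart_inv c x)))"
    using smooth_map_localE[OF f A p] by blast
  obtain e where e: "e \<in> C" "g (f p) \<in> fst e"
    using points_chart smooth_map_points p f g by metis
  let ?M = "snd d ` (fst d \<inter> g -` fst e)"
  let ?r = "\<lambda>x. snd d (f (chart_inv c x))"
  let ?T = "N \<inter> ?r -` ?M"
  have T: "open ?T"
    using continuous_open_preimage[OF smooth_on_continuous[OF N(9)] N(3) smooth_map_open[OF g N(2) e(1)]] .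
  have d_f: "chart_inv d (?r x) = f (chart_inv c x)" if "x \<in> N" for x
    using chart_inv_left[OF B N(2)] N(8)[OF that] by simp
  have "smooth_on ?T (\<lambda>x. snd e (g (chart_inv d (?r x))))"
    by (rule smooth_on_compose[OF T smooth_map_open[OF g N(2) e(1)] smooth_on_subset[OF N(9)]
          smooth_map_smooth[OF g N(2) e(1)]]) auto
  then have "smooth_on ?T (\<lambda>x. snd e (g (f (chart_inv c x))))"
    by (rule smooth_on_cong[OF T, rotated]) (use d_f in auto)
  moreover have "snd c p \<in> ?T"
    using N e chart_inv_left[OF A N(1,4)] by auto
  moreover have "\<forall>x\<in>?T. g (f (chart_inv c x)) \<in> fst e"
    using d_f image_chart_Int_iff[OF B N(2)] by (metis IntE vimageE vimageI2 vimage_def mem_Collect_eq)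
  ultimately show "\<exists>c\<in>A. \<exists>d\<in>C. \<exists>N. open N \<and> p \<in> fst c \<and> snd c p \<in> N \<and> N \<subseteq> snd c ` fst c \<and>
      (\<forall>x\<in>N. g (f (chart_inv c x)) \<in> fst d) \<and> smooth_on N (\<lambda>x. snd d (g (f (chart_inv c x))))"
    using T N(1,4,7) e(1) by blast
qed

lemma smooth_map_cong:
  assumes A: "smooth_atlas A" and f: "smooth_map A B f" and fg: "\<And>p. p \<in> points A \<Longrightarrow> f p = g p"
  shows "smooth_map A B g"
proof -
  \<comment> \<open>\<open>f\<close> and \<open>g\<close> may differ off the manifold, so their
    preimages agree only inside chart domains.\<close>
  have eq: "fst c \<inter> g -` W = fst c \<inter> f -` W" if "c \<in> A" for c W
    using fg points_chartI[OF that] by auto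
  have "smooth_on (snd c ` (fst c \<inter> f -` fst d)) (\<lambda>x. snd d (g (chart_inv c x)))" if "c \<in> A" "d \<in> B" for c d
    by (rule smooth_on_cong[OF smooth_map_open[OF f that] _ smooth_map_smooth[OF f that]])
      (use fg points_chartI[OF that(1)] chart_inv_left[OF A that(1)] in auto)
  then show ?thesis
    using smooth_map_open[OF f] smooth_map_points[OF f] fg eq
    unfolding smooth_map_iff by simp
qed

lemma smooth_map_id:
  assumes "smooth_atlas A"
  shows "smooth_map A A (\<lambda>p. p)"
  using transition_open[OF assms] transition_smooth[OF assms] unfolding smooth_map_iff vimage_ident by blast

section \<open>Maps with values in a vector space\<close>

lemma points_vector_atlas [simp]: "points vector_atlas = UNIV"
  by (simp add: points_def vector_atlas_def)

abbreviation vector_chart :: "('e, 'e) chart" where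
  "vector_chart \<equiv> (UNIV, \<lambda>x. x)"

lemma mem_vector_atlas [simp]: "c \<in> vector_atlas \<longleftrightarrow> c = vector_chart"
  by (simp add: vector_atlas_def)

lemma chart_inv_vector [simp]: "inv_into UNIV (\<lambda>x. x) = (\<lambda>x. x)"
  using inv_id[unfolded id_def] .

lemma smooth_atlas_vector: "smooth_atlas (vector_atlas :: ('e::real_normed_vector, 'e) atlas)"
  by (simp add: smooth_atlas_def comp_def smooth_on_id)

lemma smooth_map_vector_iff:
  assumes "smooth_atlas A"
  shows "smooth_map A vector_atlas f \<longleftrightarrow> (\<forall>c\<in>A. smooth_on (snd c ` fst c) (\<lambda>x. f (chart_inv c x)))"
  using smooth_atlas_open[OF assms] unfolding smooth_map_iff by simp

lemma smooth_map_const: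
  assumes A: "smooth_atlas A" and B: "smooth_atlas B" and q: "q \<in> points B"
  shows "smooth_map A B (\<lambda>p. q)"
proof -
  have "fst c \<inter> (\<lambda>p. q) -` W = (if q \<in> W then fst c else {})" for c and W
    by simp
  then show ?thesis
    using smooth_atlas_open[OF A] q smooth_on_const[of "{}"]
    by (simp add: smooth_map_iff smooth_on_const)
qed

lemma
  assumes A: "smooth_atlas A" and f: "smooth_map A vector_atlas f"
  shows smooth_map_linear_compose: "bounded_linear L \<Longrightarrow> smooth_map A vector_atlas (\<lambda>p. L (f p))"
    and smooth_map_add: "smooth_map A vector_atlas g \<Longrightarrow> smooth_map A vector_atlas (\<lambda>p. f p + g p)"
    and smooth_map_vector_Pair: "smooth_map A vector_atlas h \<Longrightarrow> smooth_map A vector_atlas (\<lambda>p. (f p, h p))"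
    and smooth_map_bilinear: "bounded_bilinear b \<Longrightarrow> smooth_map A vector_atlas k \<Longrightarrow>
      smooth_map A vector_atlas (\<lambda>p. b (f p) (k p))"
  using f smooth_atlas_open[OF A] unfolding smooth_map_vector_iff[OF A]
  by (auto intro: smooth_on_linear_compose smooth_on_add smooth_on_Pair smooth_on_bilinear)

lemma smooth_map_sum:
  assumes A: "smooth_atlas A" and f: "\<And>i. i \<in> I \<Longrightarrow> smooth_map A vector_atlas (f i)"
  shows "smooth_map A vector_atlas (\<lambda>p. \<Sum>i\<in>I. f i p)"
  using f smooth_atlas_open[OF A] unfolding smooth_map_vector_iff[OF A]
  by (simp add: smooth_on_sum)

subsection \<open>Products\<close>

definition prod_chart :: "('m, 'e) chart \<Rightarrow> ('n, 'f) chart \<Rightarrow> ('m \<times> 'n, 'e \<times> 'f) chart" where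
  "prod_chart c d = (fst c \<times> fst d, map_prod (snd c) (snd d))"

lemma fst_prod_chart [simp]: "fst (prod_chart c d) = fst c \<times> fst d"
  and snd_prod_chart [simp]: "snd (prod_chart c d) (x, y) = (snd c x, snd d y)"
  by (simp_all add: prod_chart_def)

lemma mem_prod_atlas: "e \<in> prod_atlas A B \<longleftrightarrow> (\<exists>c\<in>A. \<exists>d\<in>B. e = prod_chart c d)"
  by (simp add: prod_atlas_def prod_chart_def Bex_def split_paired_Ex) blast

lemma points_prod_atlas [simp]: "points (prod_atlas A B) = points A \<times> points B"
proof (intro Set.set_eqI iffI)
  show "p \<in> points A \<times> points B" if p: "p \<in> points (prod_atlas A B)" for p
  proof -
    obtain c d where "c \<in> A" "d \<in> B" "p \<in> fst c \<times> fst d"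
      using points_chart[OF p] mem_prod_atlas fst_prod_chart by metis
    then show ?thesis
      using points_chartI[of c A "fst p"] points_chartI[of d B "snd p"] by (simp add: mem_Times_iff)
  qed
  show "p \<in> points (prod_atlas A B)" if p: "p \<in> points A \<times> points B" for p
  proof -
    obtain c d where "c \<in> A" "d \<in> B" "p \<in> fst (prod_chart c d)"
      using p points_chart by (metis mem_Times_iff fst_prod_chart)
    then show ?thesis
      using points_chartI[of "prod_chart c d"] mem_prod_atlas by blast
  qed
qed

lemma prod_chart_image: "snd (prod_chart c d) ` (S \<times> T) = snd c ` S \<times> snd d ` T"
  by (force simp: prod_chart_def)

lemma chart_inv_prod:
  assumes "smooth_atlas A" "smooth_atlas B" "c \<in> A" "d \<in> B" "x \<in> snd c ` fst c" "y \<in> snd d ` fst d"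
  shows "inv_into (fst c \<times> fst d) (snd (prod_chart c d)) (x, y) = (chart_inv c x, chart_inv d y)"
proof (rule inv_into_f_eq)
  show "inj_on (snd (prod_chart c d)) (fst c \<times> fst d)"
    unfolding prod_chart_def snd_conv
    by (rule map_prod_inj_on) (use assms smooth_atlas_inj in blast)+
qed (use assms in \<open>auto simp: chart_inv_left\<close>)

lemma smooth_atlas_prod:
  fixes A :: "('m, 'e::euclidean_space) atlas" and B :: "('n, 'f::euclidean_space) atlas"
  assumes A: "smooth_atlas A" and B: "smooth_atlas B"
  shows "smooth_atlas (prod_atlas A B)"
proof -
  have "inj_on (snd (prod_chart c d)) (fst (prod_chart c d)) \<and> open (snd (prod_chart c d) ` fst (prod_chart c d))"
    if "c \<in> A" "d \<in> B" for c d
    using map_prod_inj_on[OF smooth_atlas_inj[OF A that(1)] smooth_atlas_inj[OF B that(2)]]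
      smooth_atlas_open[OF A that(1)] smooth_atlas_open[OF B that(2)]
    by (simp add: prod_chart_image open_Times) (simp add: prod_chart_def)
  moreover have "open (snd (prod_chart c d) ` (fst (prod_chart c d) \<inter> fst (prod_chart c' d'))) \<and>
      smooth_on (snd (prod_chart c d) ` (fst (prod_chart c d) \<inter> fst (prod_chart c' d')))
        (snd (prod_chart c' d') \<circ> chart_inv (prod_chart c d))"
    if "c \<in> A" "d \<in> B" "c' \<in> A" "d' \<in> B" for c d c' d'
  proof -
    let ?S = "snd c ` (fst c \<inter> fst c')" and ?T = "snd d ` (fst d \<inter> fst d')"
    have ST: "open ?S" "open ?T" "smooth_on ?S (\<lambda>x. snd c' (chart_inv c x))" "smooth_on ?T (\<lambda>x. snd d' (chart_inv d x))"
      using transition_open[OF A that(1,3)] transition_open[OF B that(2,4)]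
        transition_smooth[OF A that(1,3)] transition_smooth[OF B that(2,4)] by auto
    then have o: "open (?S \<times> ?T)"
      by (simp add: open_Times)
    have "smooth_on (?S \<times> ?T) (\<lambda>z. (snd c' (chart_inv c (fst z)), snd d' (chart_inv d (snd z))))"
      using smooth_on_compose[OF o ST(1) smooth_on_bounded_linear[OF bounded_linear_fst o] ST(3)]
        smooth_on_compose[OF o ST(2) smooth_on_bounded_linear[OF bounded_linear_snd o] ST(4)]
      by (intro smooth_on_Pair[OF o]) auto
    then have "smooth_on (?S \<times> ?T) (snd (prod_chart c' d') \<circ> chart_inv (prod_chart c d))"
      by (rule smooth_on_cong[OF o, rotated]) (use that A B in \<open>auto simp: chart_inv_prod\<close>)
    then show ?thesis
      using o by (simp add: Times_Int_Times prod_chart_image)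
  qed
  ultimately show ?thesis
    unfolding smooth_atlas_def Ball_def mem_prod_atlas by metis
qed

lemma smooth_map_Pair:
  fixes A :: "('m, 'e::euclidean_space) atlas" and B :: "('n, 'f::euclidean_space) atlas"
    and C :: "('k, 'h::euclidean_space) atlas"
  assumes A: "smooth_atlas A" and B: "smooth_atlas B" and C: "smooth_atlas C"
    and f: "smooth_map A B f" and g: "smooth_map A C g"
  shows "smooth_map A (prod_atlas B C) (\<lambda>p. (f p, g p))"
proof (rule smooth_map_localI[OF A smooth_atlas_prod[OF B C]])
  fix p assume p: "p \<in> points A"
  obtain c d N where N: "c \<in> A" "d \<in> B" "open N" "p \<in> fst c" "f p \<in> fst d" "snd c p \<in> N" "N \<subseteq> snd c ` fst c"
    "\<And>x. x \<in> N \<Longrightarrow> f (chart_inv c x) \<in> fst d" "smooth_on N (\<lambda>x. snd d (f (chart_inv c x)))"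
    using smooth_map_localE[OF f A p] by blast
  obtain e where e: "e \<in> C" "g p \<in> fst e"
    using points_chart smooth_map_points[OF g p] by metis
  let ?T = "N \<inter> snd c ` (fst c \<inter> g -` fst e)"
  have T: "open ?T"
    using N(3) smooth_map_open[OF g N(1) e(1)] by blast
  have "smooth_on ?T (\<lambda>x. (snd d (f (chart_inv c x)), snd e (g (chart_inv c x))))"
    by (rule smooth_on_Pair[OF T smooth_on_subset[OF N(9)] smooth_on_subset[OF smooth_map_smooth[OF g N(1) e(1)]]]) auto
  then have "open ?T \<and> p \<in> fst c \<and> snd c p \<in> ?T \<and> ?T \<subseteq> snd c ` fst c \<and>
      (\<forall>x\<in>?T. (f (chart_inv c x), g (chart_inv c x)) \<in> fst (prod_chart d e)) \<and>
      smooth_on ?T (\<lambda>x. snd (prod_chart d e) (f (chart_inv c x), g (chart_inv c x)))"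
    using T N e image_chart_Int_iff[OF A N(1)] chart_inv_left[OF A N(1,4)] by auto
  then show "\<exists>c\<in>A. \<exists>d\<in>prod_atlas B C. \<exists>N. open N \<and> p \<in> fst c \<and> snd c p \<in> N \<and> N \<subseteq> snd c ` fst c \<and>
      (\<forall>x\<in>N. (f (chart_inv c x), g (chart_inv c x)) \<in> fst d) \<and>
      smooth_on N (\<lambda>x. snd d (f (chart_inv c x), g (chart_inv c x)))"
    using N(1,2) e(1) mem_prod_atlas by blast
qed

lemma
  fixes A :: "('m, 'e::euclidean_space) atlas" and B :: "('n, 'f::euclidean_space) atlas"
  assumes A: "smooth_atlas A" and B: "smooth_atlas B"
  shows smooth_map_fst: "smooth_map (prod_atlas A B) A fst"
    and smooth_map_snd: "smooth_map (prod_atlas A B) B snd"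
proof -
  note AB = smooth_atlas_prod[OF A B]
  have "\<exists>c d. c \<in> A \<and> d \<in> B \<and> prod_chart c d \<in> prod_atlas A B \<and> p \<in> fst (prod_chart c d) \<and>
      snd (prod_chart c d) p \<in> snd c ` fst c \<times> snd d ` fst d \<and>
      snd (prod_chart c d) ` fst (prod_chart c d) = snd c ` fst c \<times> snd d ` fst d \<and>
      open (snd c ` fst c \<times> snd d ` fst d)"
    if "p \<in> points (prod_atlas A B)" for p
  proof -
    obtain c d where "c \<in> A" "d \<in> B" "fst p \<in> fst c" "snd p \<in> fst d"
      using \<open>p \<in> points (prod_atlas A B)\<close> points_chart by (metis mem_Times_iff points_prod_atlas)
    then show ?thesis
      using smooth_atlas_open[OF A] smooth_atlas_open[OF B]
      by (intro exI[of _ c] exI[of _ d])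
        (auto simp: prod_chart_image mem_prod_atlas mem_Times_iff open_Times prod_chart_def)
  qed note ch = this
  show "smooth_map (prod_atlas A B) A fst"
  proof (rule smooth_map_localI[OF AB A])
    fix p assume "p \<in> points (prod_atlas A B)"
    from ch[OF this] obtain c d where cd: "c \<in> A" "d \<in> B" "prod_chart c d \<in> prod_atlas A B" "p \<in> fst (prod_chart c d)"
      "snd (prod_chart c d) p \<in> snd c ` fst c \<times> snd d ` fst d"
      "snd (prod_chart c d) ` fst (prod_chart c d) = snd c ` fst c \<times> snd d ` fst d"
      "open (snd c ` fst c \<times> snd d ` fst d)" by blast
    have "smooth_on (snd c ` fst c \<times> snd d ` fst d) (\<lambda>x. snd c (fst (chart_inv (prod_chart c d) x)))"
      by (rule smooth_on_cong[OF cd(7) _ smooth_on_bounded_linear[OF bounded_linear_fst cd(7)]])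
        (use cd A B in \<open>auto simp: chart_inv_prod chart_inv_left\<close>)
    moreover have "\<forall>x\<in>snd c ` fst c \<times> snd d ` fst d. fst (chart_inv (prod_chart c d) x) \<in> fst c"
      using cd A B by (auto simp: chart_inv_prod chart_inv_left)
    ultimately show "\<exists>c\<in>prod_atlas A B. \<exists>d\<in>A. \<exists>N. open N \<and> p \<in> fst c \<and> snd c p \<in> N \<and> N \<subseteq> snd c ` fst c \<and>
      (\<forall>x\<in>N. fst (chart_inv c x) \<in> fst d) \<and> smooth_on N (\<lambda>x. snd d (fst (chart_inv c x)))"
      using cd by blast
  qed
  show "smooth_map (prod_atlas A B) B snd"
  proof (rule smooth_map_localI[OF AB B])
    fix p assume "p \<in> points (prod_atlas A B)"
    from ch[OF this] obtain c d where cd: "c \<in> A" "d \<in> B" "prod_chart c d \<in> prod_atlas A B" "p \<in> fst (prod_chart c d)"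
      "snd (prod_chart c d) p \<in> snd c ` fst c \<times> snd d ` fst d"
      "snd (prod_chart c d) ` fst (prod_chart c d) = snd c ` fst c \<times> snd d ` fst d"
      "open (snd c ` fst c \<times> snd d ` fst d)" by blast
    have "smooth_on (snd c ` fst c \<times> snd d ` fst d) (\<lambda>x. snd d (snd (chart_inv (prod_chart c d) x)))"
      by (rule smooth_on_cong[OF cd(7) _ smooth_on_bounded_linear[OF bounded_linear_snd cd(7)]])
        (use cd A B in \<open>auto simp: chart_inv_prod chart_inv_left\<close>)
    moreover have "\<forall>x\<in>snd c ` fst c \<times> snd d ` fst d. snd (chart_inv (prod_chart c d) x) \<in> fst d"
      using cd A B by (auto simp: chart_inv_prod chart_inv_left)
    ultimately show "\<exists>c\<in>prod_atlas A B. \<exists>d\<in>B. \<exists>N. open N \<and> p \<in> fst c \<and> snd c p \<in> N \<and> N \<subseteq> snd c ` fst c \<and>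
      (\<forall>x\<in>N. snd (chart_inv c x) \<in> fst d) \<and> smooth_on N (\<lambda>x. snd d (snd (chart_inv c x)))"
      using cd by blast
  qed
qed

section \<open>Tangent vectors and tangent maps\<close>

text \<open>For \<open>f\<close> the identity this is the derivative of a transition map, so a
  single chain rule serves changes of chart as well as tangent maps.\<close>

definition chart_deriv ::
    "('m, 'e::real_normed_vector) chart \<Rightarrow> ('n, 'f::real_normed_vector) chart \<Rightarrow> ('m \<Rightarrow> 'n) \<Rightarrow> 'm \<Rightarrow> 'e \<Rightarrow> 'f" where
  "chart_deriv c d f p = frechet_derivative (\<lambda>x. snd d (f (chart_inv c x))) (at (snd c p))"

lemma smooth_map_has_derivative:
  assumes "smooth_map A B f" "c \<in> A" "d \<in> B" "p \<in> fst c" "f p \<in> fst d"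
  shows "((\<lambda>x. snd d (f (chart_inv c x))) has_derivative chart_deriv c d f p) (at (snd c p))"
  unfolding chart_deriv_def
  by (rule smooth_on_has_derivative[OF smooth_map_smooth[OF assms(1-3)]]) (use assms(4,5) in auto)

lemma chart_deriv_linear:
  assumes "smooth_map A B f" "c \<in> A" "d \<in> B" "p \<in> fst c" "f p \<in> fst d"
  shows "linear (chart_deriv c d f p)"
  using has_derivative_linear[OF smooth_map_has_derivative[OF assms]] .

lemma chart_deriv_chain:
  assumes A: "smooth_atlas A" and B: "smooth_atlas B"
    and f: "smooth_map A B f" and g: "smooth_map B C g"
    and c: "c \<in> A" "p \<in> fst c" and d: "d \<in> B" "f p \<in> fst d" and e: "e \<in> C" "g (f p) \<in> fst e"
  shows "chart_deriv c e (\<lambda>p. g (f p)) p \<xi> = chart_deriv d e g (f p) (chart_deriv c d f p \<xi>)"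
proof -
  let ?S = "snd c ` (fst c \<inter> f -` fst d)"
  have S: "open ?S" "snd c p \<in> ?S"
    using smooth_map_open[OF f c(1) d(1)] c d by auto
  have "((\<lambda>x. snd e (g (chart_inv d x))) has_derivative chart_deriv d e g (f p))
      (at (snd d (f (chart_inv c (snd c p)))))"
    using smooth_map_has_derivative[OF g d(1) e(1) d(2) e(2)] chart_inv_left[OF A c] by simp
  note has_derivative_compose[OF smooth_map_has_derivative[OF f c(1) d(1) c(2) d(2)] this]
  then have "((\<lambda>x. snd e (g (f (chart_inv c x)))) has_derivative
      (\<lambda>\<xi>. chart_deriv d e g (f p) (chart_deriv c d f p \<xi>))) (at (snd c p))"
    by (rule has_derivative_transform_within_open[OF _ S])
      (use chart_inv_left[OF A c(1)] chart_inv_left[OF B d(1)] in auto)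
  then show ?thesis
    unfolding chart_deriv_def[of c e] using frechet_derivative_at by metis
qed

lemma chart_deriv_id:
  assumes A: "smooth_atlas A" and c: "c \<in> A" "p \<in> fst c"
  shows "chart_deriv c c (\<lambda>p. p) p \<xi> = \<xi>"
proof -
  have "((\<lambda>x. snd c (chart_inv c x)) has_derivative (\<lambda>\<xi>. \<xi>)) (at (snd c p))"
    by (rule has_derivative_transform_within_open[OF has_derivative_ident smooth_atlas_open[OF A c(1)]])
      (use chart_inv_left[OF A c(1)] c in auto)
  then show ?thesis
    unfolding chart_deriv_def using frechet_derivative_at by metis
qed

lemma chart_deriv_cong:
  assumes A: "smooth_atlas A" and c: "c \<in> A" "p \<in> fst c" and fg: "\<And>q. q \<in> points A \<Longrightarrow> f q = g q"
  shows "chart_deriv c d f p = chart_deriv c d g p"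
  unfolding chart_deriv_def
  by (rule frechet_derivative_cong_open[OF smooth_atlas_open[OF A c(1)]])
    (use c points_chartI[OF c(1)] fg chart_inv_left[OF A c(1)] in auto)

lemma tangent_space_iff:
  "w \<in> tangent_space A p \<longleftrightarrow> fst w = p \<and> p \<in> points A \<and>
     (\<forall>c\<in>A. \<forall>d\<in>A. p \<in> fst c \<longrightarrow> p \<in> fst d \<longrightarrow> snd w d = chart_deriv c d (\<lambda>p. p) p (snd w c)) \<and>
     (\<forall>c. \<not> (c \<in> A \<and> p \<in> fst c) \<longrightarrow> snd w c = 0)"
  by (cases w) (auto simp: tangent_space_def chart_deriv_def comp_def)

lemma tangent_space_fst: "w \<in> tangent_space A p \<Longrightarrow> fst w = p"
  and tangent_space_point: "w \<in> tangent_space A p \<Longrightarrow> p \<in> points A"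
  and tangent_space_transition: "w \<in> tangent_space A p \<Longrightarrow> c \<in> A \<Longrightarrow> d \<in> A \<Longrightarrow> p \<in> fst c \<Longrightarrow> p \<in> fst d \<Longrightarrow>
    snd w d = chart_deriv c d (\<lambda>p. p) p (snd w c)"
  and tangent_space_zero: "w \<in> tangent_space A p \<Longrightarrow> \<not> (c \<in> A \<and> p \<in> fst c) \<Longrightarrow> snd w c = 0"
  unfolding tangent_space_iff by blast+

text \<open>One component fixes those in the other charts around \<open>p\<close> through the
  transition derivatives, and all remaining components have the default value 0. Equality of tangent
  vectors thus becomes a computation in one chart.\<close>

lemma tangent_space_eqI:
  assumes w: "w \<in> tangent_space A p" "w' \<in> tangent_space A p" and c: "c \<in> A" "p \<in> fst c" and eq: "snd w c = snd w' c"
  shows "w = w'"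
proof (rule prod_eqI)
  show "fst w = fst w'"
    using w by (simp add: tangent_space_fst)
  show "snd w = snd w'"
  proof
    show "snd w d = snd w' d" for d
    proof (cases "d \<in> A \<and> p \<in> fst d")
      case True
      then show ?thesis
        using tangent_space_transition[OF w(1) c(1) _ c(2)] tangent_space_transition[OF w(2) c(1) _ c(2)] eq by simp
    next
      case False
      then show ?thesis
        using w by (simp add: tangent_space_zero)
    qed
  qed
qed

lemma fst_tadd [simp]: "fst (tadd w w') = fst w"
  and snd_tadd [simp]: "snd (tadd w w') c = snd w c + snd w' c"
  and fst_tscale [simp]: "fst (tscale t w) = fst w"
  and snd_tscale [simp]: "snd (tscale t w) c = t *\<^sub>R snd w c"
  by (simp_all add: tadd_def tscale_def)

lemma tvec_eqI: "fst w = fst w' \<Longrightarrow> (\<And>c. snd w c = snd w' c) \<Longrightarrow> w = w'"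
  by (rule prod_eqI) auto

lemma
  assumes A: "smooth_atlas A" and w: "w \<in> tangent_space A p"
  shows tadd_tangent_space: "w' \<in> tangent_space A p \<Longrightarrow> tadd w w' \<in> tangent_space A p"
    and tscale_tangent_space: "tscale t w \<in> tangent_space A p"
proof -
  have lin: "linear (chart_deriv c d (\<lambda>p. p) p)" if "c \<in> A" "d \<in> A" "p \<in> fst c" "p \<in> fst d" for c d
    using chart_deriv_linear[OF smooth_map_id[OF A]] that by blast
  note p = tangent_space_fst[OF w] tangent_space_point[OF w] tangent_space_zero[OF w]
  show "tscale t w \<in> tangent_space A p"
    unfolding tangent_space_iff[of "tscale t w"]
  proof (intro conjI ballI allI impI)
    fix c d assume cd: "c \<in> A" "d \<in> A" "p \<in> fst c" "p \<in> fst d"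
    show "snd (tscale t w) d = chart_deriv c d (\<lambda>p. p) p (snd (tscale t w) c)"
      using tangent_space_transition[OF w cd] by (simp add: linear_cmul[OF lin[OF cd]])
  qed (simp_all add: p)
  show "tadd w w' \<in> tangent_space A p" if w': "w' \<in> tangent_space A p"
    unfolding tangent_space_iff[of "tadd w w'"]
  proof (intro conjI ballI allI impI)
    fix c d assume cd: "c \<in> A" "d \<in> A" "p \<in> fst c" "p \<in> fst d"
    show "snd (tadd w w') d = chart_deriv c d (\<lambda>p. p) p (snd (tadd w w') c)"
      using tangent_space_transition[OF w cd] tangent_space_transition[OF w' cd]
      by (simp add: linear_add[OF lin[OF cd]])
  qed (simp_all add: p tangent_space_zero[OF w'])
qed

text \<open>The inverse of taking the component in \<open>c\<close>. The value 0 in the last branch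
  is the default demanded by \<open>tangent_space\<close>.\<close>

definition chart_vec :: "('m, 'e::real_normed_vector) atlas \<Rightarrow> ('m, 'e) chart \<Rightarrow> 'm \<Rightarrow> 'e \<Rightarrow> ('m, 'e) tvec" where
  "chart_vec A c p \<xi> = (p, \<lambda>d. if d \<in> A \<and> p \<in> fst d then chart_deriv c d (\<lambda>p. p) p \<xi> else 0)"

lemma fst_chart_vec [simp]: "fst (chart_vec A c p \<xi>) = p"
  by (simp add: chart_vec_def)

lemma
  assumes A: "smooth_atlas A" and c: "c \<in> A" "p \<in> fst c"
  shows chart_vec_tangent_space: "chart_vec A c p \<xi> \<in> tangent_space A p"
    and snd_chart_vec: "snd (chart_vec A c p \<xi>) c = \<xi>"
proof -
  show "chart_vec A c p \<xi> \<in> tangent_space A p"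
    unfolding tangent_space_iff
  proof (intro conjI ballI allI impI)
    fix d e assume de: "d \<in> A" "e \<in> A" "p \<in> fst d" "p \<in> fst e"
    show "snd (chart_vec A c p \<xi>) e = chart_deriv d e (\<lambda>p. p) p (snd (chart_vec A c p \<xi>) d)"
      unfolding chart_vec_def snd_conv
      using chart_deriv_chain[OF A A smooth_map_id[OF A] smooth_map_id[OF A] c de(1,3,2,4)] de by simp
  qed (use c in \<open>auto simp: chart_vec_def points_chartI\<close>)
  show "snd (chart_vec A c p \<xi>) c = \<xi>"
    using chart_deriv_id[OF A c] c by (simp add: chart_vec_def)
qed

lemma fst_tangent_map [simp]: "fst (tangent_map A B f w) = f (fst w)"
  by (simp add: tangent_map_def)

text \<open>Independence of the chart that \<open>tangent_map\<close> picks by \<open>SOME\<close>: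
  passing from \<open>c\<close> to the chosen \<open>c0\<close> is absorbed by the chain rule, with
  the identity as inner map.\<close>

lemma snd_tangent_map:
  assumes A: "smooth_atlas A" and f: "smooth_map A B f"
    and w: "w \<in> tangent_space A p" and c: "c \<in> A" "p \<in> fst c" and d: "d \<in> B" "f p \<in> fst d"
  shows "snd (tangent_map A B f w) d = chart_deriv c d f p (snd w c)"
proof -
  define c0 where "c0 = (SOME c. c \<in> A \<and> fst w \<in> fst c)"
  have "\<exists>c. c \<in> A \<and> fst w \<in> fst c"
    using c tangent_space_fst[OF w] by blast
  then have c0: "c0 \<in> A" "p \<in> fst c0"
    using someI_ex[of "\<lambda>c. c \<in> A \<and> fst w \<in> fst c"] tangent_space_fst[OF w] unfolding c0_def by auto
  have "snd (tangent_map A B f w) d = chart_deriv c0 d f p (snd w c0)"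
    using d tangent_space_fst[OF w] by (simp add: tangent_map_def Let_def chart_deriv_def comp_def c0_def)
  also have "\<dots> = chart_deriv c0 d f p (chart_deriv c c0 (\<lambda>p. p) p (snd w c))"
    using tangent_space_transition[OF w c(1) c0(1) c(2) c0(2)] by simp
  also have "\<dots> = chart_deriv c d f p (snd w c)"
    using chart_deriv_chain[OF A A smooth_map_id[OF A] f c c0 d] by simp
  finally show ?thesis .
qed

lemma snd_tangent_map_zero: "\<not> (d \<in> B \<and> f (fst w) \<in> fst d) \<Longrightarrow> snd (tangent_map A B f w) d = 0"
  unfolding tangent_map_def by auto

lemma tangent_map_tangent_space:
  assumes A: "smooth_atlas A" and B: "smooth_atlas B" and f: "smooth_map A B f" and w: "w \<in> tangent_space A p"
  shows "tangent_map A B f w \<in> tangent_space B (f p)"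
proof -
  obtain c where c: "c \<in> A" "p \<in> fst c"
    using points_chart[OF tangent_space_point[OF w]] by blast
  show ?thesis
    unfolding tangent_space_iff
  proof (intro conjI ballI allI impI)
    fix d e assume d: "d \<in> B" "e \<in> B" "f p \<in> fst d" "f p \<in> fst e"
    show "snd (tangent_map A B f w) e = chart_deriv d e (\<lambda>p. p) (f p) (snd (tangent_map A B f w) d)"
      using snd_tangent_map[OF A f w c d(1,3)] snd_tangent_map[OF A f w c d(2,4)]
        chart_deriv_chain[OF A B f smooth_map_id[OF B] c d(1,3,2,4)] by simp
  next
    show "snd (tangent_map A B f w) c = 0" if "\<not> (c \<in> B \<and> f p \<in> fst c)" for c
      using snd_tangent_map_zero that tangent_space_fst[OF w] by metis
  qed (use tangent_space_fst[OF w] smooth_map_points[OF f tangent_space_point[OF w]] in auto)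
qed

text \<open>Functoriality, by the chain rule in one triple of charts. Smoothness of the composite is
  a hypothesis of its own because the model spaces are merely normed here, while
  \<open>smooth_map_compose\<close> expands over a basis.\<close>

lemma tangent_map_compose:
  assumes A: "smooth_atlas A" and B: "smooth_atlas B" and C: "smooth_atlas C"
    and f: "smooth_map A B f" and g: "smooth_map B C g" and gf: "smooth_map A C (\<lambda>p. g (f p))"
    and w: "w \<in> tangent_space A p"
  shows "tangent_map B C g (tangent_map A B f w) = tangent_map A C (\<lambda>p. g (f p)) w"
proof -
  obtain c where c: "c \<in> A" "p \<in> fst c"
    using points_chart[OF tangent_space_point[OF w]] by blast
  obtain d where d: "d \<in> B" "f p \<in> fst d"
    using points_chart smooth_map_points[OF f tangent_space_point[OF w]] by metis
  obtain e where e: "e \<in> C" "g (f p) \<in> fst e"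
    using points_chart smooth_map_points[OF gf tangent_space_point[OF w]] by metis
  note fw = tangent_map_tangent_space[OF A B f w]
  show ?thesis
    by (rule tangent_space_eqI[OF tangent_map_tangent_space[OF B C g fw] tangent_map_tangent_space[OF A C gf w] e])
      (simp add: snd_tangent_map[OF A f w c d] snd_tangent_map[OF A gf w c e] snd_tangent_map[OF B g fw d e]
        chart_deriv_chain[OF A B f g c d e])
qed

lemma tangent_map_id:
  assumes A: "smooth_atlas A" and w: "w \<in> tangent_space A p"
  shows "tangent_map A A (\<lambda>p. p) w = w"
proof -
  obtain c where c: "c \<in> A" "p \<in> fst c"
    using points_chart[OF tangent_space_point[OF w]] by blast
  show ?thesis
    by (rule tangent_space_eqI[OF tangent_map_tangent_space[OF A A smooth_map_id[OF A] w] w c])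
      (simp add: snd_tangent_map[OF A smooth_map_id[OF A] w c c] chart_deriv_id[OF A c])
qed

lemma tangent_map_cong:
  assumes A: "smooth_atlas A" and w: "w \<in> tangent_space A p" and f: "smooth_map A B f"
    and fg: "\<And>q. q \<in> points A \<Longrightarrow> f q = g q"
  shows "tangent_map A B f w = tangent_map A B g w"
proof (rule tvec_eqI)
  have p: "fst w = p" "f p = g p"
    using fg tangent_space_point[OF w] tangent_space_fst[OF w] by auto
  then show "fst (tangent_map A B f w) = fst (tangent_map A B g w)"
    by simp
  obtain c where c: "c \<in> A" "p \<in> fst c"
    using points_chart[OF tangent_space_point[OF w]] by blast
  show "snd (tangent_map A B f w) d = snd (tangent_map A B g w) d" for d
  proof (cases "d \<in> B \<and> f p \<in> fst d")
    case True
    then show ?thesis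
      using snd_tangent_map[OF A f w c] snd_tangent_map[OF A smooth_map_cong[OF A f fg] w c]
        chart_deriv_cong[OF A c, of f g d] fg p by simp
  next
    case False
    then show ?thesis
      using p snd_tangent_map_zero by metis
  qed
qed

lemma
  assumes A: "smooth_atlas A" and B: "smooth_atlas B" and f: "smooth_map A B f" and w: "w \<in> tangent_space A p"
  shows tangent_map_tadd: "w' \<in> tangent_space A p \<Longrightarrow>
      tangent_map A B f (tadd w w') = tadd (tangent_map A B f w) (tangent_map A B f w')"
    and tangent_map_tscale: "tangent_map A B f (tscale t w) = tscale t (tangent_map A B f w)"
proof -
  obtain c where c: "c \<in> A" "p \<in> fst c"
    using points_chart[OF tangent_space_point[OF w]] by blast
  obtain d where d: "d \<in> B" "f p \<in> fst d"
    using points_chart smooth_map_points[OF f tangent_space_point[OF w]] by metis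
  note lin = chart_deriv_linear[OF f c(1) d(1) c(2) d(2)]
  note fw = tangent_map_tangent_space[OF A B f]
  show "tangent_map A B f (tadd w w') = tadd (tangent_map A B f w) (tangent_map A B f w')" if w': "w' \<in> tangent_space A p"
    by (rule tangent_space_eqI[OF fw tadd_tangent_space[OF B fw fw] d])
      (use w w' in \<open>auto simp: snd_tangent_map[OF A f _ c d] tadd_tangent_space[OF A] linear_add[OF lin]\<close>)
  show "tangent_map A B f (tscale t w) = tscale t (tangent_map A B f w)"
    by (rule tangent_space_eqI[OF fw tscale_tangent_space[OF B fw] d])
      (use w in \<open>auto simp: snd_tangent_map[OF A f _ c d] tscale_tangent_space[OF A] linear_cmul[OF lin]\<close>)
qed

section \<open>Differentials of vector valued maps\<close>

lemma fst_vec_tangent [simp]: "fst (vec_tangent u v) = u"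
  and snd_vec_tangent [simp]: "snd (vec_tangent u v) vector_chart = v"
  by (simp_all add: vec_tangent_def)

lemma vec_tangent_tangent_space: "vec_tangent u v \<in> tangent_space vector_atlas u"
  using chart_deriv_id[OF smooth_atlas_vector, of vector_chart u]
  unfolding tangent_space_iff by (auto simp: vec_tangent_def)

lemma differential_chart:
  assumes A: "smooth_atlas A" and f: "smooth_map A vector_atlas f" and w: "w \<in> tangent_space A p"
    and c: "c \<in> A" "p \<in> fst c"
  shows "differential A f w = frechet_derivative (\<lambda>x. f (chart_inv c x)) (at (snd c p)) (snd w c)"
  using snd_tangent_map[OF A f w c, of vector_chart] by (simp add: differential_def chart_deriv_def)

lemma
  assumes A: "smooth_atlas A" and f: "smooth_map A vector_atlas f" and w: "w \<in> tangent_space A p"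
  shows differential_linear_compose: "bounded_linear L \<Longrightarrow> differential A (\<lambda>p. L (f p)) w = L (differential A f w)"
    and differential_add: "smooth_map A vector_atlas g \<Longrightarrow>
      differential A (\<lambda>p. f p + g p) w = differential A f w + differential A g w"
proof -
  obtain c where c: "c \<in> A" "p \<in> fst c"
    using points_chart[OF tangent_space_point[OF w]] by blast
  have deriv: "((\<lambda>x. h (chart_inv c x)) has_derivative chart_deriv c vector_chart h p) (at (snd c p))"
    if "smooth_map A vector_atlas h" for h :: "_ \<Rightarrow> 'z::real_normed_vector"
    using smooth_map_has_derivative[OF that c(1) _ c(2), of vector_chart] by simp
  have dif: "differential A h w = D (snd w c)"
    if "smooth_map A vector_atlas h" "((\<lambda>x. h (chart_inv c x)) has_derivative D) (at (snd c p))"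
    for h :: "_ \<Rightarrow> 'z::real_normed_vector" and D
    using differential_chart[OF A that(1) w c] frechet_derivative_at[OF that(2)] by simp
  show "differential A (\<lambda>p. L (f p)) w = L (differential A f w)" if "bounded_linear L"
    using dif[OF smooth_map_linear_compose[OF A f that] bounded_linear.has_derivative[OF that deriv[OF f]]]
      dif[OF f deriv[OF f]] by simp
  show "differential A (\<lambda>p. f p + g p) w = differential A f w + differential A g w" if "smooth_map A vector_atlas g"
    using dif[OF smooth_map_add[OF A f that] has_derivative_add[OF deriv[OF f] deriv[OF that]]]
      dif[OF f deriv[OF f]] dif[OF that deriv[OF that]] by simp
qed

lemma differential_compose:
  assumes A: "smooth_atlas A" and B: "smooth_atlas B"
    and f: "smooth_map A B f" and g: "smooth_map B vector_atlas g" and gf: "smooth_map A vector_atlas (\<lambda>p. g (f p))"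
    and w: "w \<in> tangent_space A p"
  shows "differential B g (tangent_map A B f w) = differential A (\<lambda>p. g (f p)) w"
  using tangent_map_compose[OF A B smooth_atlas_vector f g gf w] by (simp add: differential_def)

lemma tangent_map_const:
  assumes A: "smooth_atlas A" and B: "smooth_atlas B" and q: "q \<in> points B" and w: "w \<in> tangent_space A p"
  shows "tangent_map A B (\<lambda>p. q) w = (q, \<lambda>_. 0)"
proof (rule tvec_eqI)
  obtain c where c: "c \<in> A" "p \<in> fst c"
    using points_chart[OF tangent_space_point[OF w]] by blast
  show "snd (tangent_map A B (\<lambda>p. q) w) d = snd (q, \<lambda>_. 0) d" for d
    using snd_tangent_map[OF A smooth_map_const[OF A B q] w c, of d] snd_tangent_map_zero[of d B "\<lambda>p. q" w A]
    by (cases "d \<in> B \<and> q \<in> fst d") (simp_all add: chart_deriv_def frechet_derivative_const)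
qed simp

subsection \<open>The tangent bundle\<close>

definition bundle_chart ::
    "('m, 'e::real_normed_vector) atlas \<Rightarrow> ('m, 'e) chart \<Rightarrow> (('m, 'e) tvec, 'e \<times> 'e) chart" where
  "bundle_chart A c = (\<Union>p\<in>fst c. tangent_space A p, \<lambda>w. (snd c (fst w), snd w c))"

lemma mem_tangent_bundle: "e \<in> tangent_bundle A \<longleftrightarrow> (\<exists>c\<in>A. e = bundle_chart A c)"
  by (auto simp: tangent_bundle_def bundle_chart_def image_iff case_prod_beta)

lemma mem_fst_bundle_chart: "w \<in> fst (bundle_chart A c) \<longleftrightarrow> w \<in> tangent_space A (fst w) \<and> fst w \<in> fst c"
  using tangent_space_fst[of w A] by (auto simp: bundle_chart_def)

lemma snd_bundle_chart [simp]: "snd (bundle_chart A c) w = (snd c (fst w), snd w c)"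
  by (simp add: bundle_chart_def)

lemma mem_points_bundle: "w \<in> points (tangent_bundle A) \<longleftrightarrow> w \<in> tangent_space A (fst w)"
proof
  assume "w \<in> points (tangent_bundle A)"
  from points_chart[OF this] show "w \<in> tangent_space A (fst w)"
    using mem_tangent_bundle mem_fst_bundle_chart by metis
next
  assume w: "w \<in> tangent_space A (fst w)"
  obtain c where "c \<in> A" "fst w \<in> fst c"
    using points_chart[OF tangent_space_point[OF w]] by blast
  then show "w \<in> points (tangent_bundle A)"
    using w mem_tangent_bundle mem_fst_bundle_chart by (metis points_chartI)
qed

lemma points_bundle_fst: "w \<in> points (tangent_bundle A) \<Longrightarrow> fst w \<in> points A"
  using mem_points_bundle tangent_space_point by metis

text \<open>Every model vector is a component, by \<open>chart_vec\<close>; hence the full second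
  factor. Taking \<open>W\<close> to be \<open>UNIV\<close> gives the whole chart, taking it to be
  another chart domain gives the overlap.\<close>

lemma bundle_chart_image:
  fixes A :: "('m, 'e::real_normed_vector) atlas"
  assumes A: "smooth_atlas A" and c: "c \<in> A"
  shows "snd (bundle_chart A c) ` (fst (bundle_chart A c) \<inter> fst -` W) = snd c ` (fst c \<inter> W) \<times> (UNIV :: 'e set)"
proof (intro equalityI subsetI)
  fix z :: "'e \<times> 'e" assume "z \<in> snd c ` (fst c \<inter> W) \<times> UNIV"
  then obtain p \<xi> where p: "z = (snd c p, \<xi>)" "p \<in> fst c" "p \<in> W"
    by auto
  then have "snd (bundle_chart A c) (chart_vec A c p \<xi>) = z"
    "chart_vec A c p \<xi> \<in> fst (bundle_chart A c) \<inter> fst -` W"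
    using snd_chart_vec[OF A c] chart_vec_tangent_space[OF A c] by (auto simp: mem_fst_bundle_chart)
  then show "z \<in> snd (bundle_chart A c) ` (fst (bundle_chart A c) \<inter> fst -` W)"
    by (metis image_eqI)
qed (auto simp: mem_fst_bundle_chart)

lemma bundle_chart_inj:
  assumes A: "smooth_atlas A" and c: "c \<in> A"
  shows "inj_on (snd (bundle_chart A c)) (fst (bundle_chart A c))"
proof (rule inj_onI)
  fix w w' assume w: "w \<in> fst (bundle_chart A c)" "w' \<in> fst (bundle_chart A c)"
    and eq: "snd (bundle_chart A c) w = snd (bundle_chart A c) w'"
  have w': "w \<in> tangent_space A (fst w)" "w' \<in> tangent_space A (fst w')" "fst w \<in> fst c" "fst w' \<in> fst c"
    using w by (simp_all add: mem_fst_bundle_chart)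
  have "fst w = fst w'"
    using inj_onD[OF smooth_atlas_inj[OF A c]] w' eq by simp
  then show "w = w'"
    using tangent_space_eqI[of w A "fst w" w' c] w' c eq by simp
qed

lemma chart_inv_bundle:
  assumes A: "smooth_atlas A" and c: "c \<in> A" and x: "x \<in> snd c ` fst c"
  shows "chart_inv (bundle_chart A c) (x, \<xi>) = chart_vec A c (chart_inv c x) \<xi>"
proof (rule inv_into_f_eq[OF bundle_chart_inj[OF A c]])
  have "chart_inv c x \<in> fst c" "snd c (chart_inv c x) = x"
    using x chart_inv_left[OF A c] by auto
  then show "chart_vec A c (chart_inv c x) \<xi> \<in> fst (bundle_chart A c)"
    "snd (bundle_chart A c) (chart_vec A c (chart_inv c x) \<xi>) = (x, \<xi>)"
    using chart_vec_tangent_space[OF A c] snd_chart_vec[OF A c] by (auto simp: mem_fst_bundle_chart)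
qed

text \<open>A transition map \<open>t\<close> of the base induces \<open>(x, \<xi>)\<close> to
  \<open>(t x, Dt(x) \<xi>)\<close> on the bundle charts, which is smooth by
  \<open>smooth_on_derivative\<close>.\<close>

lemma smooth_atlas_bundle:
  fixes A :: "('m, 'e::euclidean_space) atlas"
  assumes A: "smooth_atlas A"
  shows "smooth_atlas (tangent_bundle A)"
proof -
  have 1: "open (snd (bundle_chart A c) ` fst (bundle_chart A c))" if "c \<in> A" for c
    using bundle_chart_image[OF A that, of UNIV] smooth_atlas_open[OF A that] by (simp add: open_Times)
  have 2: "open (snd (bundle_chart A c) ` (fst (bundle_chart A c) \<inter> fst (bundle_chart A d))) \<and>
      smooth_on (snd (bundle_chart A c) ` (fst (bundle_chart A c) \<inter> fst (bundle_chart A d)))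
        (snd (bundle_chart A d) \<circ> chart_inv (bundle_chart A c))" if c: "c \<in> A" and d: "d \<in> A" for c d
  proof -
    let ?S = "snd c ` (fst c \<inter> fst d)"
    let ?t = "\<lambda>x. snd d (chart_inv c x)"
    have "fst (bundle_chart A c) \<inter> fst (bundle_chart A d) = fst (bundle_chart A c) \<inter> fst -` fst d"
      by (auto simp: mem_fst_bundle_chart)
    then have im: "snd (bundle_chart A c) ` (fst (bundle_chart A c) \<inter> fst (bundle_chart A d)) = ?S \<times> UNIV"
      using bundle_chart_image[OF A c] by simp
    have S: "open ?S" "smooth_on ?S ?t"
      using transition_open[OF A c d] transition_smooth[OF A c d] by auto
    then have o: "open (?S \<times> (UNIV :: 'e set))"
      by (simp add: open_Times)
    note pr = smooth_on_bounded_linear[OF bounded_linear_fst o] smooth_on_bounded_linear[OF bounded_linear_snd o]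
    have "smooth_on (?S \<times> (UNIV :: 'e set)) (\<lambda>z. (?t (fst z), frechet_derivative ?t (at (fst z)) (snd z)))"
      by (rule smooth_on_Pair[OF o smooth_on_compose[OF o S(1) pr(1) S(2)] smooth_on_derivative[OF S(1) o S(2) pr]]) auto
    then have "smooth_on (?S \<times> UNIV) (snd (bundle_chart A d) \<circ> chart_inv (bundle_chart A c))"
    proof (rule smooth_on_cong[OF o, rotated])
      fix z :: "'e \<times> 'e" assume "z \<in> ?S \<times> UNIV"
      then obtain p \<xi> where p: "z = (snd c p, \<xi>)" "p \<in> fst c" "p \<in> fst d"
        by auto
      have "snd (chart_vec A c p \<xi>) d = chart_deriv c d (\<lambda>p. p) p \<xi>"
        using p d by (simp add: chart_vec_def)
      then show "(?t (fst z), frechet_derivative ?t (at (fst z)) (snd z)) =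
          (snd (bundle_chart A d) \<circ> chart_inv (bundle_chart A c)) z"
        using p chart_inv_bundle[OF A c] chart_inv_left[OF A c] by (simp add: chart_deriv_def)
    qed
    then show ?thesis
      using o unfolding im by blast
  qed
  show ?thesis
    unfolding smooth_atlas_def Ball_def mem_tangent_bundle using 1 2 bundle_chart_inj[OF A] by metis
qed

lemma smooth_map_bundle_fst:
  fixes A :: "('m, 'e::euclidean_space) atlas"
  assumes A: "smooth_atlas A"
  shows "smooth_map (tangent_bundle A) A fst"
proof (rule smooth_map_localI[OF smooth_atlas_bundle[OF A] A])
  fix w assume w: "w \<in> points (tangent_bundle A)"
  obtain c where c: "c \<in> A" "fst w \<in> fst c"
    using points_chart[OF points_bundle_fst[OF w]] by blast
  let ?N = "snd (bundle_chart A c) ` fst (bundle_chart A c)"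
  have b: "bundle_chart A c \<in> tangent_bundle A"
    using c(1) mem_tangent_bundle by blast
  note N = smooth_atlas_open[OF smooth_atlas_bundle[OF A] b]
  note left = chart_inv_left[OF smooth_atlas_bundle[OF A] b]
  have w': "w \<in> fst (bundle_chart A c)"
    using w c by (simp add: mem_fst_bundle_chart mem_points_bundle)
  have "smooth_on ?N (\<lambda>x. snd c (fst (chart_inv (bundle_chart A c) x)))"
    by (rule smooth_on_cong[OF N _ smooth_on_bounded_linear[OF bounded_linear_fst N]]) (use left in auto)
  moreover have "\<forall>x\<in>?N. fst (chart_inv (bundle_chart A c) x) \<in> fst c"
    using left mem_fst_bundle_chart by (metis (no_types, lifting) imageE)
  ultimately show "\<exists>b\<in>tangent_bundle A. \<exists>d\<in>A. \<exists>N. open N \<and> w \<in> fst b \<and> snd b w \<in> N \<and> N \<subseteq> snd b ` fst b \<and>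
      (\<forall>x\<in>N. fst (chart_inv b x) \<in> fst d) \<and> smooth_on N (\<lambda>x. snd d (fst (chart_inv b x)))"
    using b c(1) N w' by blast
qed

text \<open>The differential in the first argument, smooth jointly with the parameter in the second.
  With \<open>\<mu>\<close> the group multiplication this is the tangent map of a right translation,
  with the translating element allowed to vary; the smoothness of right invariant fields and of
  their coordinates comes from here.\<close>

lemma smooth_map_partial_tangent_map:
  fixes A :: "('m, 'e::euclidean_space) atlas" and B :: "('n, 'f::euclidean_space) atlas"
    and C :: "('k, 'h::euclidean_space) atlas"
  assumes A: "smooth_atlas A" and B: "smooth_atlas B" and C: "smooth_atlas C"
    and \<mu>: "smooth_map (prod_atlas A B) C \<mu>"
  shows "smooth_map (prod_atlas (tangent_bundle A) B) (tangent_bundle C)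
    (\<lambda>z. tangent_map A C (\<lambda>p. \<mu> (p, snd z)) (fst z))"
proof (rule smooth_map_localI[OF smooth_atlas_prod[OF smooth_atlas_bundle[OF A] B] smooth_atlas_bundle[OF C]])
  fix z assume z: "z \<in> points (prod_atlas (tangent_bundle A) B)"
  obtain w q where wq: "z = (w, q)" "w \<in> tangent_space A (fst w)" "q \<in> points B" "fst w \<in> points A"
    using z mem_points_bundle points_bundle_fst by (metis SigmaE points_prod_atlas)
  obtain c where c: "c \<in> A" "fst w \<in> fst c"
    using points_chart[OF wq(4)] by blast
  obtain b where b: "b \<in> B" "q \<in> fst b"
    using points_chart[OF wq(3)] by blast
  obtain d where d: "d \<in> C" "\<mu> (fst w, q) \<in> fst d"
    using points_chart[OF smooth_map_points[OF \<mu>, of "(fst w, q)"]] wq(3,4) by auto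
  have cb: "prod_chart c b \<in> prod_atlas A B"
    using c b mem_prod_atlas by blast
  define N0 where "N0 = snd (prod_chart c b) ` (fst (prod_chart c b) \<inter> \<mu> -` fst d)"
  define M where "M = (\<lambda>y. snd d (\<mu> (chart_inv (prod_chart c b) y)))"
  have N0: "open N0" "smooth_on N0 M"
    using smooth_map_open[OF \<mu> cb d(1)] smooth_map_smooth[OF \<mu> cb d(1)] by (simp_all add: N0_def M_def)
  have in_N0: "x \<in> snd c ` fst c" "y \<in> snd b ` fst b" "\<mu> (chart_inv c x, chart_inv b y) \<in> fst d" if "(x, y) \<in> N0" for x y
    using that chart_inv_left[OF A c(1)] chart_inv_left[OF B b(1)] unfolding N0_def by auto
  have M_eq: "M (x, y) = snd d (\<mu> (chart_inv c x, chart_inv b y))" if "x \<in> snd c ` fst c" "y \<in> snd b ` fst b" for x y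
    using chart_inv_prod[OF A B c(1) b(1) that] by (simp add: M_def)
  have \<mu>q: "smooth_map A C (\<lambda>p. \<mu> (p, q))" if "q \<in> points B" for q
    using smooth_map_compose[OF A smooth_atlas_prod[OF A B] C
        smooth_map_Pair[OF A A B smooth_map_id[OF A] smooth_map_const[OF A B that]] \<mu>] .
  \<comment> \<open>Freezing the second argument composes \<open>M\<close> with the map taking
    \<open>x\<close> to \<open>(x, y)\<close>, whose derivative takes \<open>\<xi>\<close> to
    \<open>(\<xi>, 0)\<close>. The partial derivative is thereby a total derivative of one function
    of both variables, to which \<open>smooth_on_derivative\<close> applies.\<close>
  have part: "chart_deriv c d (\<lambda>p. \<mu> (p, chart_inv b y)) (chart_inv c x) \<xi> = frechet_derivative M (at (x, y)) (\<xi>, 0)"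
    if xy: "(x, y) \<in> N0" for x y \<xi>
  proof -
    have "((\<lambda>x. (x, y)) has_derivative (\<lambda>\<xi>. (\<xi>, 0))) (at x)"
      by (auto intro!: derivative_eq_intros)
    from has_derivative_compose[OF this smooth_on_has_derivative[OF N0(2) xy]]
    have "((\<lambda>x. M (x, y)) has_derivative (\<lambda>\<xi>. frechet_derivative M (at (x, y)) (\<xi>, 0))) (at x)" .
    then have "((\<lambda>x. snd d (\<mu> (chart_inv c x, chart_inv b y))) has_derivative
        (\<lambda>\<xi>. frechet_derivative M (at (x, y)) (\<xi>, 0))) (at x)"
      by (rule has_derivative_transform_within_open[OF _ smooth_atlas_open[OF A c(1)] in_N0(1)[OF xy]])
        (use in_N0(2)[OF xy] M_eq in auto)
    moreover have "snd c (chart_inv c x) = x"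
      using in_N0(1)[OF xy] chart_inv_left[OF A c(1)] by auto
    ultimately show ?thesis
      unfolding chart_deriv_def using frechet_derivative_at by metis
  qed
  let ?b = "prod_chart (bundle_chart A c) b"
  let ?g = "\<lambda>u :: ('e \<times> 'e) \<times> 'f. (fst (fst u), snd u)"
  let ?F = "\<lambda>z. tangent_map A C (\<lambda>p. \<mu> (p, snd z)) (fst z)"
  \<comment> \<open>Only the base point and the parameter are constrained; the fibre component is
    free.\<close>
  define N where "N = ?g -` N0"
  have "bounded_linear ?g"
    by (intro bounded_linear_Pair bounded_linear_snd bounded_linear_compose[OF bounded_linear_fst bounded_linear_fst])
  then have N: "open N" "smooth_on N ?g"
    using open_vimage[OF N0(1), of ?g] smooth_on_bounded_linear[of ?g N]
    by (auto simp: N_def linear_continuous_on)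
  have inv: "chart_inv ?b ((x, \<xi>), y) = (chart_vec A c (chart_inv c x) \<xi>, chart_inv b y)"
    if "((x, \<xi>), y) \<in> N" for x \<xi> y
  proof -
    have xy: "x \<in> snd c ` fst c" "y \<in> snd b ` fst b"
      using that in_N0 by (auto simp: N_def)
    moreover have "(x, \<xi>) \<in> snd (bundle_chart A c) ` fst (bundle_chart A c)"
      using bundle_chart_image[OF A c(1), of UNIV] xy by auto
    ultimately show ?thesis
      using chart_inv_prod[OF smooth_atlas_bundle[OF A] B _ b(1)] chart_inv_bundle[OF A c(1)] c(1) mem_tangent_bundle
      by (metis fst_prod_chart)
  qed
  have F: "?F (chart_inv ?b u) \<in> fst (bundle_chart C d) \<and> snd (bundle_chart C d) (?F (chart_inv ?b u)) =
      (M (?g u), frechet_derivative M (at (?g u)) (snd (fst u), 0))" if u: "u \<in> N" for u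
  proof -
    obtain x \<xi> y where u': "u = ((x, \<xi>), y)"
      by (metis prod.collapse)
    then have xy: "(x, y) \<in> N0"
      using u by (simp add: N_def)
    let ?p = "chart_inv c x" and ?q = "chart_inv b y"
    have p: "?p \<in> fst c" "?q \<in> points B"
      using in_N0(1,2)[OF xy] chart_inv_left[OF A c(1)] chart_inv_left[OF B b(1)] points_chartI[OF b(1)] by auto
    note v = chart_vec_tangent_space[OF A c(1) p(1)]
    have "?F (chart_inv ?b u) = tangent_map A C (\<lambda>p. \<mu> (p, ?q)) (chart_vec A c ?p \<xi>)"
      using u inv u' by simp
    moreover have "tangent_map A C (\<lambda>p. \<mu> (p, ?q)) (chart_vec A c ?p \<xi>) \<in> tangent_space C (\<mu> (?p, ?q))"
      using tangent_map_tangent_space[OF A C \<mu>q[OF p(2)] v] .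
    moreover have "snd (tangent_map A C (\<lambda>p. \<mu> (p, ?q)) (chart_vec A c ?p \<xi>)) d = frechet_derivative M (at (x, y)) (\<xi>, 0)"
      using snd_tangent_map[OF A \<mu>q[OF p(2)] v c(1) p(1) d(1) in_N0(3)[OF xy]] part[OF xy] snd_chart_vec[OF A c(1) p(1)]
      by simp
    ultimately show ?thesis
      using in_N0[OF xy] M_eq u' by (simp add: mem_fst_bundle_chart)
  qed
  have 1: "smooth_on N (\<lambda>u. M (?g u))"
    by (rule smooth_on_compose[OF N(1) N0(1) N(2) N0(2)]) (auto simp: N_def)
  have "bounded_linear (\<lambda>u :: ('e \<times> 'e) \<times> 'f. (snd (fst u), 0 :: 'f))"
    by (intro bounded_linear_Pair bounded_linear_zero bounded_linear_compose[OF bounded_linear_snd bounded_linear_fst])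
  then have "smooth_on N (\<lambda>u. frechet_derivative M (at (?g u)) (snd (fst u), 0))"
    by (intro smooth_on_derivative[OF N0(1) N(1) N0(2) N(2)] smooth_on_bounded_linear N(1)) (auto simp: N_def)
  from smooth_on_Pair[OF N(1) 1 this]
  have "smooth_on N (\<lambda>u. snd (bundle_chart C d) (?F (chart_inv ?b u)))"
    by (rule smooth_on_cong[OF N(1), rotated]) (use F in metis)
  moreover have "N \<subseteq> snd ?b ` fst ?b"
  proof
    fix u assume "u \<in> N"
    then obtain x \<xi> y where u': "u = ((x, \<xi>), y)" "(x, y) \<in> N0"
      unfolding N_def by (metis prod.collapse vimageE)
    then show "u \<in> snd ?b ` fst ?b"
      using in_N0(1,2) bundle_chart_image[OF A c(1), of UNIV] unfolding fst_prod_chart prod_chart_image by auto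
  qed
  moreover have "z \<in> fst ?b" "snd ?b z \<in> N"
    using wq c b d by (auto simp: mem_fst_bundle_chart N_def N0_def intro!: image_eqI[of _ _ "(fst w, q)"])
  moreover have "?b \<in> prod_atlas (tangent_bundle A) B" "bundle_chart C d \<in> tangent_bundle C"
    using c b d mem_prod_atlas mem_tangent_bundle by blast+
  ultimately show "\<exists>c\<in>prod_atlas (tangent_bundle A) B. \<exists>d\<in>tangent_bundle C. \<exists>N. open N \<and> z \<in> fst c \<and> snd c z \<in> N \<and>
      N \<subseteq> snd c ` fst c \<and> (\<forall>x\<in>N. ?F (chart_inv c x) \<in> fst d) \<and> smooth_on N (\<lambda>x. snd d (?F (chart_inv c x)))"
    using N(1) F by blast
qed

text \<open>The partial tangent map with a dummy real parameter on which the map does not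
  depend.\<close>

lemma smooth_map_tangent_map:
  fixes A :: "('m, 'e::euclidean_space) atlas" and B :: "('n, 'f::euclidean_space) atlas"
  assumes A: "smooth_atlas A" and B: "smooth_atlas B" and f: "smooth_map A B f"
  shows "smooth_map (tangent_bundle A) (tangent_bundle B) (tangent_map A B f)"
proof -
  note V = smooth_atlas_vector[where 'e = real] and TA = smooth_atlas_bundle[OF A]
  have "smooth_map (tangent_bundle A) (prod_atlas (tangent_bundle A) vector_atlas) (\<lambda>w. (w, 0 :: real))"
    by (rule smooth_map_Pair[OF TA TA V smooth_map_id[OF TA] smooth_map_const[OF TA V]]) simp
  moreover have "smooth_map (prod_atlas A vector_atlas) B (\<lambda>z. f (fst (z :: 'm \<times> real)))"
    by (rule smooth_map_compose[OF smooth_atlas_prod[OF A V] A B smooth_map_fst[OF A V] f])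
  from smooth_map_partial_tangent_map[OF A V B this]
  have "smooth_map (prod_atlas (tangent_bundle A) vector_atlas) (tangent_bundle B)
      (\<lambda>z. tangent_map A B f (fst (z :: ('m, 'e) tvec \<times> real)))"
    by simp
  ultimately show ?thesis
    using smooth_map_compose[OF TA smooth_atlas_prod[OF TA V] smooth_atlas_bundle[OF B]] by fastforce
qed

text \<open>For a map into a single fibre one bundle chart sees all values. Applied to right
  translation to the identity, whose values lie over the neutral element.\<close>

lemma smooth_map_fibre_coordinates:
  assumes M: "smooth_atlas M" and f: "smooth_map M (tangent_bundle A) f"
    and p: "\<And>x. x \<in> points M \<Longrightarrow> fst (f x) = p" and c: "c \<in> A" "p \<in> fst c"
  shows "smooth_map M vector_atlas (\<lambda>x. snd (f x) c)"
  unfolding smooth_map_vector_iff[OF M]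
proof
  fix k assume k: "k \<in> M"
  have b: "bundle_chart A c \<in> tangent_bundle A"
    using c(1) mem_tangent_bundle by blast
  have "f x \<in> fst (bundle_chart A c)" if "x \<in> fst k" for x
    using smooth_map_points[OF f] p points_chartI[OF k that] c(2) by (metis mem_points_bundle mem_fst_bundle_chart)
  then have "fst k \<inter> f -` fst (bundle_chart A c) = fst k"
    by blast
  then have "smooth_on (snd k ` fst k) (\<lambda>x. snd (bundle_chart A c) (f (chart_inv k x)))"
    using smooth_map_smooth[OF f k b] by metis
  from smooth_on_linear_compose[OF bounded_linear_snd smooth_atlas_open[OF M k] this]
  show "smooth_on (snd k ` fst k) (\<lambda>x. snd (f (chart_inv k x)) c)"
    by simp
qed

text \<open>The converse passage, from smooth components to a smooth map into one fibre; it handles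
  the linear parametrization \<open>\<iota>\<close> of the tangent space at the identity.\<close>

lemma smooth_map_chart_vec:
  fixes A :: "('m, 'e::euclidean_space) atlas" and M :: "('n, 'f::euclidean_space) atlas"
  assumes M: "smooth_atlas M" and A: "smooth_atlas A" and c: "c \<in> A" "p \<in> fst c"
    and g: "smooth_map M vector_atlas g"
  shows "smooth_map M (tangent_bundle A) (\<lambda>x. chart_vec A c p (g x))"
proof (rule smooth_map_localI[OF M smooth_atlas_bundle[OF A]])
  fix x assume x: "x \<in> points M"
  obtain k where k: "k \<in> M" "x \<in> fst k"
    using points_chart[OF x] by blast
  have "smooth_on (snd k ` fst k) (\<lambda>x. (snd c p, g (chart_inv k x)))"
    using smooth_on_Pair[OF smooth_atlas_open[OF M k(1)] smooth_on_const[OF smooth_atlas_open[OF M k(1)]]]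
      g[unfolded smooth_map_vector_iff[OF M]] k(1) by blast
  then have "smooth_on (snd k ` fst k) (\<lambda>x. snd (bundle_chart A c) (chart_vec A c p (g (chart_inv k x))))"
    by (simp add: snd_chart_vec[OF A c])
  moreover have "chart_vec A c p (g y) \<in> fst (bundle_chart A c)" for y
    using chart_vec_tangent_space[OF A c] c by (simp add: mem_fst_bundle_chart)
  ultimately show "\<exists>k\<in>M. \<exists>d\<in>tangent_bundle A. \<exists>N. open N \<and> x \<in> fst k \<and> snd k x \<in> N \<and> N \<subseteq> snd k ` fst k \<and>
      (\<forall>x\<in>N. chart_vec A c p (g (chart_inv k x)) \<in> fst d) \<and>
      smooth_on N (\<lambda>x. snd d (chart_vec A c p (g (chart_inv k x))))"
    using k c(1) mem_tangent_bundle smooth_atlas_open[OF M k(1)] by blast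
qed

text \<open>The tangent map is smooth, and the tangent bundle of a vector space has a single chart,
  in which the velocity is the second coordinate.\<close>

lemma smooth_map_velocity:
  fixes A :: "('m, 'e::euclidean_space) atlas" and f :: "'m \<Rightarrow> 'f::euclidean_space"
  assumes A: "smooth_atlas A" and f: "smooth_map A vector_atlas f"
  shows "smooth_map (tangent_bundle A) vector_atlas (differential A f)"
proof -
  note V = smooth_atlas_vector[where 'e = 'f]
  let ?e = "bundle_chart vector_atlas (vector_chart :: ('f, 'f) chart)"
  have e: "?e \<in> tangent_bundle vector_atlas"
    by (auto simp: mem_tangent_bundle)
  note o = smooth_atlas_open[OF smooth_atlas_bundle[OF V] e]
  have sm: "smooth_on (snd ?e ` fst ?e) (\<lambda>x. snd (chart_inv ?e x) vector_chart)"
    by (rule smooth_on_cong[OF o _ smooth_on_bounded_linear[OF bounded_linear_snd o]])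
      (use chart_inv_left[OF smooth_atlas_bundle[OF V] e] in auto)
  have "smooth_map (tangent_bundle vector_atlas) vector_atlas (\<lambda>w :: ('f, 'f) tvec. snd w vector_chart)"
    unfolding smooth_map_vector_iff[OF smooth_atlas_bundle[OF V]]
  proof
    fix k :: "(('f, 'f) tvec, 'f \<times> 'f) chart" assume "k \<in> tangent_bundle vector_atlas"
    then have "k = ?e"
      unfolding mem_tangent_bundle Bex_def mem_vector_atlas by simp
    then show "smooth_on (snd k ` fst k) (\<lambda>x. snd (chart_inv k x) vector_chart)"
      using sm by simp
  qed
  from smooth_map_compose[OF smooth_atlas_bundle[OF A] smooth_atlas_bundle[OF V] V smooth_map_tangent_map[OF A V f] this]
  show ?thesis
    by (simp add: differential_def[abs_def])
qed

subsection \<open>Tangent vectors of a product with a vector space\<close>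

text \<open>The splitting of the tangent space of a product, written with the same two inclusions as
  \<open>prod_identification\<close>, so that the latter is its instance at the identity and the
  vector 0.\<close>

definition pair_tangent ::
    "('m, 'e::real_normed_vector) atlas \<Rightarrow> ('m, 'e) tvec \<Rightarrow> 'h::real_normed_vector \<Rightarrow> 'h \<Rightarrow> ('m \<times> 'h, 'e \<times> 'h) tvec" where
  "pair_tangent A w v \<eta> = tadd (tangent_map A (prod_atlas A vector_atlas) (\<lambda>x. (x, v)) w)
     (tangent_map vector_atlas (prod_atlas A vector_atlas) (\<lambda>u. (fst w, u)) (vec_tangent v \<eta>))"

lemma fst_pair_tangent [simp]: "fst (pair_tangent A w v \<eta>) = (fst w, v)"
  by (simp add: pair_tangent_def)

lemma prod_vector_chart: "c \<in> A \<Longrightarrow> prod_chart c vector_chart \<in> prod_atlas A vector_atlas"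
  unfolding mem_prod_atlas by (metis mem_vector_atlas)

lemma tadd_zero: "tadd w (fst w, \<lambda>_. 0) = w" "tadd (fst w, \<lambda>_. 0) w = w"
  by (auto intro: tvec_eqI)

text \<open>Each inclusion followed by a projection is the identity or a constant map, and a
  constant map has zero tangent map.\<close>

lemma
  fixes A :: "('m, 'e::euclidean_space) atlas" and v :: "'h::euclidean_space"
  assumes A: "smooth_atlas A" and w: "w \<in> tangent_space A p"
  shows pair_tangent_tangent_space: "pair_tangent A w v \<eta> \<in> tangent_space (prod_atlas A vector_atlas) (p, v)"
    and tangent_map_fst_pair: "tangent_map (prod_atlas A vector_atlas) A fst (pair_tangent A w v \<eta>) = w"
    and differential_snd_pair: "differential (prod_atlas A vector_atlas) snd (pair_tangent A w v \<eta>) = \<eta>"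
proof -
  note V = smooth_atlas_vector[where 'e = 'h]
  note PA = smooth_atlas_prod[OF A V] and F = smooth_map_fst[OF A V] and S = smooth_map_snd[OF A V]
  have p: "p \<in> points A" "fst w = p"
    using w by (auto intro: tangent_space_point tangent_space_fst)
  have i: "smooth_map A (prod_atlas A vector_atlas) (\<lambda>x. (x, v))"
    by (rule smooth_map_Pair[OF A A V smooth_map_id[OF A] smooth_map_const[OF A V]]) simp
  have j: "smooth_map vector_atlas (prod_atlas A vector_atlas) (\<lambda>u :: 'h. (p, u))"
    by (rule smooth_map_Pair[OF V A V smooth_map_const[OF V A p(1)] smooth_map_id[OF V]])
  have iw: "tangent_map A (prod_atlas A vector_atlas) (\<lambda>x. (x, v)) w \<in> tangent_space (prod_atlas A vector_atlas) (p, v)"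
    using tangent_map_tangent_space[OF A PA i w] .
  have j\<eta>: "tangent_map vector_atlas (prod_atlas A vector_atlas) (\<lambda>u. (p, u)) (vec_tangent v \<eta>) \<in>
      tangent_space (prod_atlas A vector_atlas) (p, v)"
    using tangent_map_tangent_space[OF V PA j vec_tangent_tangent_space] .
  show "pair_tangent A w v \<eta> \<in> tangent_space (prod_atlas A vector_atlas) (p, v)"
    unfolding pair_tangent_def p(2) by (rule tadd_tangent_space[OF PA iw j\<eta>])
  have "tangent_map (prod_atlas A vector_atlas) A fst (pair_tangent A w v \<eta>) = tadd w (p, \<lambda>_. 0)"
    unfolding pair_tangent_def p(2) tangent_map_tadd[OF PA A F iw j\<eta>]
    using tangent_map_compose[OF A PA A i F _ w] tangent_map_compose[OF V PA A j F _ vec_tangent_tangent_space]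
    by (simp add: smooth_map_id[OF A] smooth_map_const[OF V A p(1)] tangent_map_id[OF A w]
        tangent_map_const[OF V A p(1) vec_tangent_tangent_space])
  then show "tangent_map (prod_atlas A vector_atlas) A fst (pair_tangent A w v \<eta>) = w"
    using tadd_zero[of w] p by simp
  have "tangent_map (prod_atlas A vector_atlas) vector_atlas snd (pair_tangent A w v \<eta>) =
      tadd (v, \<lambda>_. 0) (vec_tangent v \<eta>)"
    unfolding pair_tangent_def p(2) tangent_map_tadd[OF PA V S iw j\<eta>]
    using tangent_map_compose[OF A PA V i S _ w] tangent_map_compose[OF V PA V j S _ vec_tangent_tangent_space]
    by (simp add: smooth_map_id[OF V] smooth_map_const[OF A V] tangent_map_id[OF V vec_tangent_tangent_space]
        tangent_map_const[OF A V _ w])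
  then show "differential (prod_atlas A vector_atlas) snd (pair_tangent A w v \<eta>) = \<eta>"
    by (simp add: differential_def)
qed

lemma
  fixes A :: "('m, 'e::euclidean_space) atlas" and v :: "'h::euclidean_space"
  assumes A: "smooth_atlas A" and z: "z \<in> tangent_space (prod_atlas A vector_atlas) (p, v)"
    and c: "c \<in> A" "p \<in> fst c"
  shows snd_tangent_map_fst: "snd (tangent_map (prod_atlas A vector_atlas) A fst z) c = fst (snd z (prod_chart c vector_chart))"
    and differential_snd: "differential (prod_atlas A vector_atlas) snd z = snd (snd z (prod_chart c vector_chart))"
proof -
  note V = smooth_atlas_vector[where 'e = 'h]
  note PA = smooth_atlas_prod[OF A V] and F = smooth_map_fst[OF A V] and S = smooth_map_snd[OF A V]
  let ?c = "prod_chart c (vector_chart :: ('h, 'h) chart)"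
  have pc: "?c \<in> prod_atlas A vector_atlas" "(p, v) \<in> fst ?c"
    using c by (auto intro: prod_vector_chart)
  note o = smooth_atlas_open[OF PA pc(1)]
  have x: "snd ?c (p, v) \<in> snd ?c ` fst ?c"
    using pc by blast
  have inv: "chart_inv ?c x = (chart_inv c (fst x), snd x) \<and> fst x \<in> snd c ` fst c" if "x \<in> snd ?c ` fst ?c" for x
    using that chart_inv_prod[OF A V c(1), of vector_chart "fst x" "snd x"]
    by (auto simp: prod_chart_image)
  have "((\<lambda>x. snd c (fst (chart_inv ?c x))) has_derivative fst) (at (snd ?c (p, v)))"
    by (rule has_derivative_transform_within_open[OF has_derivative_fst[OF has_derivative_ident] o x])
      (use inv chart_inv_left[OF A c(1)] in auto)
  then have "chart_deriv ?c c fst (p, v) = fst"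
    unfolding chart_deriv_def using frechet_derivative_at by metis
  then show "snd (tangent_map (prod_atlas A vector_atlas) A fst z) c = fst (snd z ?c)"
    using snd_tangent_map[OF PA F z pc c(1)] c(2) by simp
  have "((\<lambda>x. snd (chart_inv ?c x)) has_derivative snd) (at (snd ?c (p, v)))"
    by (rule has_derivative_transform_within_open[OF has_derivative_snd[OF has_derivative_ident] o x])
      (use inv in auto)
  then show "differential (prod_atlas A vector_atlas) snd z = snd (snd z ?c)"
    unfolding differential_chart[OF PA S z pc] using frechet_derivative_at by metis
qed

lemma snd_pair_tangent:
  fixes A :: "('m, 'e::euclidean_space) atlas" and v :: "'h::euclidean_space"
  assumes A: "smooth_atlas A" and w: "w \<in> tangent_space A p" and c: "c \<in> A" "p \<in> fst c"
  shows "snd (pair_tangent A w v \<eta>) (prod_chart c vector_chart) = (snd w c, \<eta>)"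
  using snd_tangent_map_fst[OF A pair_tangent_tangent_space[OF A w, of v \<eta>] c]
    differential_snd[OF A pair_tangent_tangent_space[OF A w, of v \<eta>] c]
  by (simp add: tangent_map_fst_pair[OF A w] differential_snd_pair[OF A w] prod_eq_iff)

text \<open>In a product chart the component of \<open>z\<close> is the pair formed by the
  components of its two projections. From here on tangent vectors of the product are compared
  through projections instead of charts.\<close>

lemma pair_tangent_eqI:
  fixes A :: "('m, 'e::euclidean_space) atlas" and v :: "'h::euclidean_space"
  assumes A: "smooth_atlas A" and z: "z \<in> tangent_space (prod_atlas A vector_atlas) (p, v)"
    and w: "tangent_map (prod_atlas A vector_atlas) A fst z = w" and \<eta>: "differential (prod_atlas A vector_atlas) snd z = \<eta>"
  shows "z = pair_tangent A w v \<eta>"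
proof -
  note V = smooth_atlas_vector[where 'e = 'h]
  note PA = smooth_atlas_prod[OF A V]
  have w': "w \<in> tangent_space A p"
    using tangent_map_tangent_space[OF PA A smooth_map_fst[OF A V] z] w by simp
  obtain c where c: "c \<in> A" "p \<in> fst c"
    using points_chart[OF tangent_space_point[OF w']] by blast
  show ?thesis
  proof (rule tangent_space_eqI[OF z pair_tangent_tangent_space[OF A w']])
    show "prod_chart c vector_chart \<in> prod_atlas A vector_atlas" "(p, v) \<in> fst (prod_chart c vector_chart)"
      using c by (auto intro: prod_vector_chart)
    show "snd z (prod_chart c vector_chart) = snd (pair_tangent A w v \<eta>) (prod_chart c vector_chart)"
      unfolding snd_pair_tangent[OF A w' c]
      using snd_tangent_map_fst[OF A z c] differential_snd[OF A z c] w \<eta> by (simp add: prod_eq_iff)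
  qed
qed

lemma tangent_map_Pair:
  fixes A :: "('m, 'e::euclidean_space) atlas" and M :: "('n, 'f::euclidean_space) atlas"
    and h :: "'n \<Rightarrow> 'h::euclidean_space"
  assumes M: "smooth_atlas M" and A: "smooth_atlas A" and f: "smooth_map M A f" and h: "smooth_map M vector_atlas h"
    and w: "w \<in> tangent_space M p"
  shows "tangent_map M (prod_atlas A vector_atlas) (\<lambda>x. (f x, h x)) w =
    pair_tangent A (tangent_map M A f w) (h p) (differential M h w)"
proof (rule pair_tangent_eqI[OF A])
  note V = smooth_atlas_vector[where 'e = 'h]
  note PA = smooth_atlas_prod[OF A V]
  note fh = smooth_map_Pair[OF M A V f h]
  show "tangent_map M (prod_atlas A vector_atlas) (\<lambda>x. (f x, h x)) w \<in> tangent_space (prod_atlas A vector_atlas) (f p, h p)"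
    using tangent_map_tangent_space[OF M PA fh w] .
  show "tangent_map (prod_atlas A vector_atlas) A fst (tangent_map M (prod_atlas A vector_atlas) (\<lambda>x. (f x, h x)) w) =
      tangent_map M A f w"
    using tangent_map_compose[OF M PA A fh smooth_map_fst[OF A V] _ w] f by simp
  show "differential (prod_atlas A vector_atlas) snd (tangent_map M (prod_atlas A vector_atlas) (\<lambda>x. (f x, h x)) w) =
      differential M h w"
    using differential_compose[OF M PA fh smooth_map_snd[OF A V] _ w] h by simp
qed

lemma
  fixes A :: "('m, 'e::euclidean_space) atlas" and v :: "'h::euclidean_space"
  assumes A: "smooth_atlas A" and w: "w \<in> tangent_space A p"
  shows tadd_pair_tangent: "w' \<in> tangent_space A p \<Longrightarrow>
      tadd (pair_tangent A w v \<eta>) (pair_tangent A w' v \<eta>') = pair_tangent A (tadd w w') v (\<eta> + \<eta>')"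
    and tscale_pair_tangent: "tscale t (pair_tangent A w v \<eta>) = pair_tangent A (tscale t w) v (t *\<^sub>R \<eta>)"
proof -
  note V = smooth_atlas_vector[where 'e = 'h]
  note PA = smooth_atlas_prod[OF A V] and F = smooth_map_fst[OF A V] and S = smooth_map_snd[OF A V]
  note pw = pair_tangent_tangent_space[OF A]
  show "tadd (pair_tangent A w v \<eta>) (pair_tangent A w' v \<eta>') = pair_tangent A (tadd w w') v (\<eta> + \<eta>')"
    if w': "w' \<in> tangent_space A p"
    by (rule pair_tangent_eqI[OF A tadd_tangent_space[OF PA pw[OF w] pw[OF w']]])
      (simp_all add: tangent_map_tadd[OF PA A F pw[OF w] pw[OF w']] differential_def
        tangent_map_tadd[OF PA V S pw[OF w] pw[OF w']] tangent_map_fst_pair[OF A w] tangent_map_fst_pair[OF A w']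
        differential_snd_pair[OF A w, unfolded differential_def] differential_snd_pair[OF A w', unfolded differential_def])
  show "tscale t (pair_tangent A w v \<eta>) = pair_tangent A (tscale t w) v (t *\<^sub>R \<eta>)"
    by (rule pair_tangent_eqI[OF A tscale_tangent_space[OF PA pw[OF w]]])
      (simp_all add: tangent_map_tscale[OF PA A F pw[OF w]] differential_def tangent_map_tscale[OF PA V S pw[OF w]]
        tangent_map_fst_pair[OF A w] differential_snd_pair[OF A w, unfolded differential_def])
qed

lemma smooth_map_pair_tangent:
  fixes A :: "('m, 'e::euclidean_space) atlas" and M :: "('n, 'f::euclidean_space) atlas"
    and h k :: "'n \<Rightarrow> 'h::euclidean_space"
  assumes M: "smooth_atlas M" and A: "smooth_atlas A" and f: "smooth_map M (tangent_bundle A) f"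
    and h: "smooth_map M vector_atlas h" and k: "smooth_map M vector_atlas k"
  shows "smooth_map M (tangent_bundle (prod_atlas A vector_atlas)) (\<lambda>x. pair_tangent A (f x) (h x) (k x))"
proof -
  note V = smooth_atlas_vector[where 'e = 'h]
  note PA = smooth_atlas_prod[OF A V]
  show ?thesis
  proof (rule smooth_map_localI[OF M smooth_atlas_bundle[OF PA]])
    fix x assume x: "x \<in> points M"
    obtain i d N where N: "i \<in> M" "d \<in> tangent_bundle A" "open N" "x \<in> fst i" "f x \<in> fst d" "snd i x \<in> N" "N \<subseteq> snd i ` fst i"
      "\<And>x. x \<in> N \<Longrightarrow> f (chart_inv i x) \<in> fst d" "smooth_on N (\<lambda>x. snd d (f (chart_inv i x)))"
      using smooth_map_localE[OF f M x] by blast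
    obtain c where c: "c \<in> A" "d = bundle_chart A c"
      using N(2) mem_tangent_bundle by blast
    let ?c = "prod_chart c (vector_chart :: ('h, 'h) chart)"
    let ?d = "bundle_chart (prod_atlas A vector_atlas) ?c"
    have pc: "?c \<in> prod_atlas A vector_atlas"
      using c by (auto intro: prod_vector_chart)
    have hk: "smooth_on N (\<lambda>x. h (chart_inv i x))" "smooth_on N (\<lambda>x. k (chart_inv i x))"
      using h k N(1,7) unfolding smooth_map_vector_iff[OF M] by (auto intro: smooth_on_subset)
    have fd: "f (chart_inv i x) \<in> tangent_space A (fst (f (chart_inv i x)))" "fst (f (chart_inv i x)) \<in> fst c" if "x \<in> N" for x
      using N(8)[OF that] by (simp_all add: c(2) mem_fst_bundle_chart)
    have "smooth_on N (\<lambda>x. snd c (fst (f (chart_inv i x))))" "smooth_on N (\<lambda>x. snd (f (chart_inv i x)) c)"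
      using smooth_on_linear_compose[OF bounded_linear_fst N(3,9)] smooth_on_linear_compose[OF bounded_linear_snd N(3,9)]
      by (simp_all add: c(2))
    then have "smooth_on N (\<lambda>x. ((snd c (fst (f (chart_inv i x))), h (chart_inv i x)),
        (snd (f (chart_inv i x)) c, k (chart_inv i x))))"
      using hk by (intro smooth_on_Pair N(3))
    then have "smooth_on N (\<lambda>x. snd ?d (pair_tangent A (f (chart_inv i x)) (h (chart_inv i x)) (k (chart_inv i x))))"
      by (rule smooth_on_cong[OF N(3), rotated]) (simp add: snd_pair_tangent[OF A fd(1) c(1) fd(2)])
    moreover have "\<forall>x\<in>N. pair_tangent A (f (chart_inv i x)) (h (chart_inv i x)) (k (chart_inv i x)) \<in> fst ?d"
      by (simp add: mem_fst_bundle_chart pair_tangent_tangent_space[OF A fd(1)] fd(2))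
    moreover have "?d \<in> tangent_bundle (prod_atlas A vector_atlas)"
      using pc mem_tangent_bundle by blast
    ultimately show "\<exists>c\<in>M. \<exists>d\<in>tangent_bundle (prod_atlas A vector_atlas). \<exists>N. open N \<and> x \<in> fst c \<and> snd c x \<in> N \<and>
        N \<subseteq> snd c ` fst c \<and> (\<forall>x\<in>N. pair_tangent A (f (chart_inv c x)) (h (chart_inv c x)) (k (chart_inv c x)) \<in> fst d) \<and>
        smooth_on N (\<lambda>x. snd d (pair_tangent A (f (chart_inv c x)) (h (chart_inv c x)) (k (chart_inv c x))))"
      using N(1,3,4,6,7) by blast
  qed
qed

section \<open>Parallelisms and connections\<close>

text \<open>A global frame, given as a trivialization of the tangent bundle: \<open>R\<close> sends a constant vector to a
  vector field and \<open>K\<close> sends a tangent vector to its coordinates.\<close>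

definition parallelism ::
    "('m, 'e::real_normed_vector) atlas \<Rightarrow> ('h::real_normed_vector \<Rightarrow> 'm \<Rightarrow> ('m, 'e) tvec) \<Rightarrow> (('m, 'e) tvec \<Rightarrow> 'h) \<Rightarrow> bool" where
  "parallelism A R K \<longleftrightarrow>
     (\<forall>p\<in>points A. \<forall>u v t. R (u + v) p = tadd (R u p) (R v p) \<and> R (t *\<^sub>R u) p = tscale t (R u p)) \<and>
     (\<forall>p\<in>points A. \<forall>u. R u p \<in> tangent_space A p \<and> K (R u p) = u) \<and>
     (\<forall>p\<in>points A. \<forall>w\<in>tangent_space A p. R (K w) p = w) \<and>
     smooth_map (tangent_bundle A) vector_atlas K \<and>
     smooth_map (prod_atlas A vector_atlas) (tangent_bundle A) (\<lambda>z. R (snd z) (fst z))"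

lemma
  assumes "parallelism A R K"
  shows parallelism_add: "p \<in> points A \<Longrightarrow> R (u + v) p = tadd (R u p) (R v p)"
    and parallelism_scale: "p \<in> points A \<Longrightarrow> R (t *\<^sub>R u) p = tscale t (R u p)"
    and parallelism_tangent_space: "p \<in> points A \<Longrightarrow> R u p \<in> tangent_space A p"
    and parallelism_coord: "p \<in> points A \<Longrightarrow> K (R u p) = u"
    and parallelism_of_coord: "w \<in> tangent_space A p \<Longrightarrow> R (K w) p = w"
    and parallelism_smooth_coord: "smooth_map (tangent_bundle A) vector_atlas K"
    and parallelism_smooth: "smooth_map (prod_atlas A vector_atlas) (tangent_bundle A) (\<lambda>z. R (snd z) (fst z))"
  using assms tangent_space_point[of w A p] unfolding parallelism_def by blast+

lemma parallelism_zero: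
  assumes "parallelism A R K" "p \<in> points A"
  shows "R 0 p = (p, \<lambda>_. 0)"
proof -
  have "R 0 p = tscale 0 (R 0 p)"
    using parallelism_scale[OF assms, of 0 0] by simp
  also have "\<dots> = (p, \<lambda>_. 0)"
    using tangent_space_fst[OF parallelism_tangent_space[OF assms]] by (simp add: tscale_def)
  finally show ?thesis .
qed

lemma vector_field_cong:
  "smooth_atlas A \<Longrightarrow> vector_field A X \<Longrightarrow> (\<And>p. p \<in> points A \<Longrightarrow> X p = Y p) \<Longrightarrow> vector_field A Y"
  unfolding vector_field_def using smooth_map_cong[of A "tangent_bundle A" X Y] by simp

lemma vector_field_push:
  fixes A :: "('m, 'e::euclidean_space) atlas" and B :: "('n, 'f::euclidean_space) atlas"
  assumes A: "smooth_atlas A" and B: "smooth_atlas B" and f: "smooth_map A B f" and g: "smooth_map B A g"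
    and fg: "\<And>q. q \<in> points B \<Longrightarrow> f (g q) = q" and X: "vector_field A X"
  shows "vector_field B (\<lambda>q. tangent_map A B f (X (g q)))"
proof -
  note TA = smooth_atlas_bundle[OF A] and TB = smooth_atlas_bundle[OF B]
  have "smooth_map B (tangent_bundle A) (\<lambda>q. X (g q))"
    using smooth_map_compose[OF B A TA g] X by (simp add: vector_field_def)
  from smooth_map_compose[OF B TA TB this smooth_map_tangent_map[OF A B f]]
  have "smooth_map B (tangent_bundle B) (\<lambda>q. tangent_map A B f (X (g q)))" .
  moreover have "tangent_map A B f (X (g q)) \<in> tangent_space B q" if "q \<in> points B" for q
    using tangent_map_tangent_space[OF A B f, of "X (g q)" "g q"] X smooth_map_points[OF g that] fg[OF that]
    by (simp add: vector_field_def)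
  ultimately show ?thesis
    by (simp add: vector_field_def)
qed

lemma parallelism_vector_field:
  fixes A :: "('m, 'e::euclidean_space) atlas" and x :: "'m \<Rightarrow> 'h::euclidean_space"
  assumes A: "smooth_atlas A" and par: "parallelism A R K" and x: "smooth_map A vector_atlas x"
  shows "vector_field A (\<lambda>p. R (x p) p)"
proof -
  note V = smooth_atlas_vector[where 'e = 'h]
  have "smooth_map A (tangent_bundle A) (\<lambda>p. R (x p) p)"
    using smooth_map_compose[OF A smooth_atlas_prod[OF A V] smooth_atlas_bundle[OF A]
        smooth_map_Pair[OF A A V smooth_map_id[OF A] x] parallelism_smooth[OF par]] by simp
  then show ?thesis
    using parallelism_tangent_space[OF par] by (simp add: vector_field_def)
qed

lemma parallelism_vector_field_const:
  fixes A :: "('m, 'e::euclidean_space) atlas" and u :: "'h::euclidean_space"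
  assumes A: "smooth_atlas A" and par: "parallelism A R K"
  shows "vector_field A (R u)"
  using parallelism_vector_field[OF A par smooth_map_const[OF A smooth_atlas_vector, of u]] by simp

lemma parallelism_vector_field_coord:
  fixes A :: "('m, 'e::euclidean_space) atlas" and K :: "('m, 'e) tvec \<Rightarrow> 'h::euclidean_space"
  assumes A: "smooth_atlas A" and par: "parallelism A R K" and X: "vector_field A X"
  shows "smooth_map A vector_atlas (\<lambda>p. K (X p))"
  using smooth_map_compose[OF A smooth_atlas_bundle[OF A] smooth_atlas_vector _ parallelism_smooth_coord[OF par]] X
  by (simp add: vector_field_def)

lemma parallelism_cong:
  fixes A :: "('m, 'e::euclidean_space) atlas" and R :: "'h::euclidean_space \<Rightarrow> 'm \<Rightarrow> ('m, 'e) tvec"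
  assumes A: "smooth_atlas A" and par: "parallelism A R K" and eq: "\<And>u p. p \<in> points A \<Longrightarrow> R u p = R' u p"
  shows "parallelism A R' K"
proof -
  have "smooth_map (prod_atlas A vector_atlas) (tangent_bundle A) (\<lambda>z. R' (snd z) (fst z))"
    using smooth_map_cong[OF smooth_atlas_prod[OF A smooth_atlas_vector] parallelism_smooth[OF par],
        of "\<lambda>z. R' (snd z) (fst z)"] eq by (simp add: mem_Times_iff)
  then show ?thesis
    using par eq unfolding parallelism_def by simp
qed

text \<open>Moves a frame along a diffeomorphism; the coordinates travel the opposite way, through
  \<open>g\<close>. With \<open>f\<close> equal to \<open>\<Phi>\<close> it produces the frame on
  TG.\<close>

lemma parallelism_push:
  fixes A :: "('m, 'e::euclidean_space) atlas" and B :: "('n, 'f::euclidean_space) atlas"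
    and R :: "'h::euclidean_space \<Rightarrow> 'm \<Rightarrow> ('m, 'e) tvec"
  assumes A: "smooth_atlas A" and B: "smooth_atlas B" and f: "smooth_map A B f" and g: "smooth_map B A g"
    and gf: "\<And>p. p \<in> points A \<Longrightarrow> g (f p) = p" and fg: "\<And>q. q \<in> points B \<Longrightarrow> f (g q) = q"
    and par: "parallelism A R K"
  shows "parallelism B (\<lambda>u q. tangent_map A B f (R u (g q))) (\<lambda>w. K (tangent_map B A g w))"
proof -
  note V = smooth_atlas_vector[where 'e = 'h]
  note TA = smooth_atlas_bundle[OF A] and TB = smooth_atlas_bundle[OF B]
  note PA = smooth_atlas_prod[OF A V] and PB = smooth_atlas_prod[OF B V]
  have gq: "g q \<in> points A" if "q \<in> points B" for q
    using smooth_map_points[OF g that] .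
  note RT = parallelism_tangent_space[OF par gq]
  have gf_w: "tangent_map B A g (tangent_map A B f w) = w" if w: "w \<in> tangent_space A p" for w p
    using tangent_map_compose[OF A B A f g smooth_map_compose[OF A B A f g] w]
      tangent_map_cong[OF A w smooth_map_compose[OF A B A f g], of "\<lambda>p. p"] gf tangent_map_id[OF A w] by simp
  have fg_w: "tangent_map A B f (tangent_map B A g w) = w" if w: "w \<in> tangent_space B p" for w p
    using tangent_map_compose[OF B A B g f smooth_map_compose[OF B A B g f] w]
      tangent_map_cong[OF B w smooth_map_compose[OF B A B g f], of "\<lambda>p. p"] fg tangent_map_id[OF B w] by simp
  have "smooth_map (prod_atlas B vector_atlas) (tangent_bundle A) (\<lambda>z :: 'n \<times> 'h. R (snd z) (g (fst z)))"
    using smooth_map_compose[OF PB PA TA smooth_map_Pair[OF PB A V smooth_map_compose[OF PB B A smooth_map_fst[OF B V] g]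
          smooth_map_snd[OF B V]] parallelism_smooth[OF par]] by simp
  from smooth_map_compose[OF PB TA TB this smooth_map_tangent_map[OF A B f]]
  have 1: "smooth_map (prod_atlas B vector_atlas) (tangent_bundle B) (\<lambda>z :: 'n \<times> 'h. tangent_map A B f (R (snd z) (g (fst z))))" .
  have 2: "smooth_map (tangent_bundle B) vector_atlas (\<lambda>w. K (tangent_map B A g w))"
    by (rule smooth_map_compose[OF TB TA V smooth_map_tangent_map[OF B A g] parallelism_smooth_coord[OF par]])
  have 3: "tangent_map A B f (R u (g q)) \<in> tangent_space B q" if "q \<in> points B" for u q
    using tangent_map_tangent_space[OF A B f RT[OF that]] fg[OF that] by simp
  have 4: "tangent_map A B f (R (K (tangent_map B A g w)) (g q)) = w" if w: "w \<in> tangent_space B q" for w q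
    using parallelism_of_coord[OF par tangent_map_tangent_space[OF B A g w]] fg_w[OF w] by simp
  show ?thesis
    unfolding parallelism_def
    using 1 2 3 4 parallelism_add[OF par gq] parallelism_scale[OF par gq] tangent_map_tadd[OF A B f RT RT]
      tangent_map_tscale[OF A B f RT] gf_w[OF RT] parallelism_coord[OF par gq] by simp
qed

section \<open>Connections determined by their values on a frame\<close>

lemma
  assumes "connection A D"
  shows connection_cong: "vector_field A X \<Longrightarrow> vector_field A X' \<Longrightarrow> vector_field A Y \<Longrightarrow> vector_field A Y' \<Longrightarrow>
      points_eq A X X' \<Longrightarrow> points_eq A Y Y' \<Longrightarrow> p \<in> points A \<Longrightarrow> D X Y p = D X' Y' p"
    and connection_add_left: "vector_field A X \<Longrightarrow> vector_field A X' \<Longrightarrow> vector_field A Y \<Longrightarrow> p \<in> points A \<Longrightarrow>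
      D (\<lambda>p. tadd (X p) (X' p)) Y p = tadd (D X Y p) (D X' Y p)"
    and connection_scale_left: "smooth_function A f \<Longrightarrow> vector_field A X \<Longrightarrow> vector_field A Y \<Longrightarrow> p \<in> points A \<Longrightarrow>
      D (\<lambda>p. tscale (f p) (X p)) Y p = tscale (f p) (D X Y p)"
    and connection_add_right: "vector_field A X \<Longrightarrow> vector_field A Y \<Longrightarrow> vector_field A Y' \<Longrightarrow> p \<in> points A \<Longrightarrow>
      D X (\<lambda>p. tadd (Y p) (Y' p)) p = tadd (D X Y p) (D X Y' p)"
    and connection_scale_right: "smooth_function A f \<Longrightarrow> vector_field A X \<Longrightarrow> vector_field A Y \<Longrightarrow> p \<in> points A \<Longrightarrow>
      D X (\<lambda>p. tscale (f p) (Y p)) p = tadd (tscale (f p) (D X Y p)) (tscale (differential A f (X p)) (Y p))"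
proof -
  note c = assms[unfolded connection_def]
  note c' = c[THEN conjunct2] and pe = points_eq_def
  show "vector_field A X \<Longrightarrow> vector_field A X' \<Longrightarrow> vector_field A Y \<Longrightarrow> vector_field A Y' \<Longrightarrow>
      points_eq A X X' \<Longrightarrow> points_eq A Y Y' \<Longrightarrow> p \<in> points A \<Longrightarrow> D X Y p = D X' Y' p"
    using c'[THEN conjunct1, rule_format, of X X' Y Y'] by (simp add: pe)
  show "vector_field A X \<Longrightarrow> vector_field A X' \<Longrightarrow> vector_field A Y \<Longrightarrow> p \<in> points A \<Longrightarrow>
      D (\<lambda>p. tadd (X p) (X' p)) Y p = tadd (D X Y p) (D X' Y p)"
    using c'[THEN conjunct2, THEN conjunct1, rule_format, of X X' Y] by (simp add: pe)
  show "smooth_function A f \<Longrightarrow> vector_field A X \<Longrightarrow> vector_field A Y \<Longrightarrow> p \<in> points A \<Longrightarrow>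
      D (\<lambda>p. tscale (f p) (X p)) Y p = tscale (f p) (D X Y p)"
    using c'[THEN conjunct2, THEN conjunct2, THEN conjunct1, rule_format, of f X Y] by (simp add: pe)
  show "vector_field A X \<Longrightarrow> vector_field A Y \<Longrightarrow> vector_field A Y' \<Longrightarrow> p \<in> points A \<Longrightarrow>
      D X (\<lambda>p. tadd (Y p) (Y' p)) p = tadd (D X Y p) (D X Y' p)"
    using c'[THEN conjunct2, THEN conjunct2, THEN conjunct2, THEN conjunct1, rule_format, of X Y Y'] by (simp add: pe)
  show "smooth_function A f \<Longrightarrow> vector_field A X \<Longrightarrow> vector_field A Y \<Longrightarrow> p \<in> points A \<Longrightarrow>
      D X (\<lambda>p. tscale (f p) (Y p)) p = tadd (tscale (f p) (D X Y p)) (tscale (differential A f (X p)) (Y p))"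
    using c'[THEN conjunct2, THEN conjunct2, THEN conjunct2, THEN conjunct2, rule_format, of f X Y] by (simp add: pe)
qed

text \<open>Expand both fields in the frame with smooth coefficients: linearity over functions in
  \<open>X\<close> gives the bilinear term, and the Leibniz rule in \<open>Y\<close> adds the
  derivative of its coordinates. Two connections with the same \<open>b\<close> therefore agree on
  all vector fields.\<close>

lemma connection_parallelism:
  fixes A :: "('m, 'e::euclidean_space) atlas" and R :: "'h::euclidean_space \<Rightarrow> 'm \<Rightarrow> ('m, 'e) tvec"
  assumes A: "smooth_atlas A" and par: "parallelism A R K" and D: "connection A D" and b: "bilinear b"
    and DR: "\<And>u v. points_eq A (D (R u) (R v)) (R (b u v))"
    and X: "vector_field A X" and Y: "vector_field A Y" and p: "p \<in> points A"
  shows "D X Y p = R (differential A (\<lambda>q. K (Y q)) (X p) + b (K (X p)) (K (Y p))) p"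
proof -
  note R_add = parallelism_add[OF par] and R_scale = parallelism_scale[OF par]
  note vf = parallelism_vector_field[OF A par] and R_vf = parallelism_vector_field_const[OF A par]
  \<comment> \<open>Partial sums over a subset of \<open>Basis\<close>, so that the binary axioms of
    a connection can be used by induction. Summing coordinates before applying \<open>R\<close>
    avoids sums of tangent vectors and makes every partial sum a smooth field at once.\<close>
  define part where "part = (\<lambda>x :: 'm \<Rightarrow> 'h. \<lambda>S p. R (\<Sum>i\<in>S. (x p \<bullet> i) *\<^sub>R i) p)"
  have comp: "smooth_map A vector_atlas (\<lambda>p. x p \<bullet> i)" if "smooth_map A vector_atlas x" for x and i :: 'h
    using smooth_map_linear_compose[OF A that bounded_linear_inner_left] .
  have term_vf: "vector_field A (\<lambda>p. tscale (x p \<bullet> i) (R i p))" if x: "smooth_map A vector_atlas x" for x and i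
    by (rule vector_field_cong[OF A vf[OF smooth_map_linear_compose[OF A x
            bounded_linear_compose[OF bounded_linear_scaleR_left bounded_linear_inner_left]]]])
      (rule R_scale)
  have part_vf: "vector_field A (part x S)" if x: "smooth_map A vector_atlas x" for x S
    unfolding part_def
    by (rule vf[OF smooth_map_sum[OF A smooth_map_linear_compose[OF A x
            bounded_linear_compose[OF bounded_linear_scaleR_left bounded_linear_inner_left]]]])
  have part_insert: "part x (insert i S) p = tadd (tscale (x p \<bullet> i) (R i p)) (part x S p)"
    if "finite S" "i \<notin> S" "p \<in> points A" for x i S p
    using that by (simp add: part_def R_add R_scale)
  have sum_vf: "vector_field A (\<lambda>p. tadd (tscale (x p \<bullet> i) (R i p)) (part x S p))"
    if x: "smooth_map A vector_atlas x" and S: "finite S" "i \<notin> S" for x i S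
    by (rule vector_field_cong[OF A part_vf[OF x] part_insert[OF S]])
  have part_Basis: "part (\<lambda>q. K (Z q)) Basis p = Z p" if "vector_field A Z" "p \<in> points A" for Z p
    using parallelism_of_coord[OF par, of "Z p" p] that by (simp add: part_def euclidean_representation vector_field_def)
  define x where "x = (\<lambda>q. K (X q))"
  define y where "y = (\<lambda>q. K (Y q))"
  have x: "smooth_map A vector_atlas x" and y: "smooth_map A vector_atlas y"
    unfolding x_def y_def by (rule parallelism_vector_field_coord[OF A par] X Y)+
  have Xp: "X p \<in> tangent_space A p"
    using X p by (simp add: vector_field_def)
  note add_b = bilinear_radd[OF b] and b_add = bilinear_ladd[OF b] and b_scale = bilinear_lmul[OF b]
    and scale_b = bilinear_rmul[OF b]
  have left: "D (part x S) (R v) p = R (b (\<Sum>i\<in>S. (x p \<bullet> i) *\<^sub>R i) v) p" if "finite S" for S v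
    using that
  proof (induction S)
    case empty
    \<comment> \<open>The empty partial sum is \<open>R 0\<close>, itself a member of the frame, so
      the assumption on frame fields also covers the base case.\<close>
    have "D (part x {}) (R v) p = R (b 0 v) p"
      using DR[of 0 v] p by (simp add: part_def points_eq_def)
    then show ?case
      by simp
  next
    case (insert i S)
    have "D (part x (insert i S)) (R v) p = D (\<lambda>p. tadd (tscale (x p \<bullet> i) (R i p)) (part x S p)) (R v) p"
      by (rule connection_cong[OF D part_vf[OF x] sum_vf[OF x insert(1,2)] R_vf R_vf _ _ p])
        (use part_insert[OF insert(1,2)] in \<open>simp_all add: points_eq_def\<close>)
    also have "\<dots> = tadd (D (\<lambda>p. tscale (x p \<bullet> i) (R i p)) (R v) p) (D (part x S) (R v) p)"
      by (rule connection_add_left[OF D term_vf[OF x] part_vf[OF x] R_vf p])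
    also have "D (\<lambda>p. tscale (x p \<bullet> i) (R i p)) (R v) p = tscale (x p \<bullet> i) (D (R i) (R v) p)"
      by (rule connection_scale_left[OF D _ R_vf R_vf p]) (use comp[OF x] in \<open>simp add: smooth_function_def\<close>)
    also have "D (R i) (R v) p = R (b i v) p"
      using DR p by (simp add: points_eq_def)
    finally show ?case
      using insert p by (simp add: R_add R_scale b_add b_scale)
  qed
  have DXR: "D X (R v) p = R (b (x p) v) p" for v
  proof -
    have "D X (R v) p = D (part x Basis) (R v) p"
      by (rule connection_cong[OF D X part_vf[OF x] R_vf R_vf _ _ p])
        (use part_Basis[OF X] in \<open>simp_all add: points_eq_def x_def\<close>)
    then show ?thesis
      by (simp add: left euclidean_representation)
  qed
  have right: "D X (part y S) p = R ((\<Sum>i\<in>S. (differential A y (X p) \<bullet> i) *\<^sub>R i) + b (x p) (\<Sum>i\<in>S. (y p \<bullet> i) *\<^sub>R i)) p"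
    if "finite S" for S
    using that
  proof (induction S)
    case empty
    have "D X (part y {}) p = R (b (x p) 0) p"
      using DXR[of 0] by (simp add: part_def[abs_def])
    then show ?case
      by simp
  next
    case (insert i S)
    have "D X (part y (insert i S)) p = D X (\<lambda>p. tadd (tscale (y p \<bullet> i) (R i p)) (part y S p)) p"
      by (rule connection_cong[OF D X X part_vf[OF y] sum_vf[OF y insert(1,2)] _ _ p])
        (use part_insert[OF insert(1,2)] in \<open>simp_all add: points_eq_def\<close>)
    also have "\<dots> = tadd (D X (\<lambda>p. tscale (y p \<bullet> i) (R i p)) p) (D X (part y S) p)"
      by (rule connection_add_right[OF D X term_vf[OF y] part_vf[OF y] p])
    also have "D X (\<lambda>p. tscale (y p \<bullet> i) (R i p)) p =
        tadd (tscale (y p \<bullet> i) (D X (R i) p)) (tscale (differential A (\<lambda>p. y p \<bullet> i) (X p)) (R i p))"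
      by (rule connection_scale_right[OF D _ X R_vf p]) (use comp[OF y] in \<open>simp add: smooth_function_def\<close>)
    also have "differential A (\<lambda>p. y p \<bullet> i) (X p) = differential A y (X p) \<bullet> i"
      by (rule differential_linear_compose[OF A y Xp bounded_linear_inner_left])
    also have "tadd (tadd (tscale (y p \<bullet> i) (D X (R i) p)) (tscale (differential A y (X p) \<bullet> i) (R i p))) (D X (part y S) p) =
        R ((y p \<bullet> i) *\<^sub>R b (x p) i + (differential A y (X p) \<bullet> i) *\<^sub>R i +
          ((\<Sum>i\<in>S. (differential A y (X p) \<bullet> i) *\<^sub>R i) + b (x p) (\<Sum>i\<in>S. (y p \<bullet> i) *\<^sub>R i))) p"
      using insert p by (simp only: R_add R_scale DXR)
    finally show ?case
      using insert by (simp add: add_b scale_b ac_simps)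
  qed
  have "D X Y p = D X (part y Basis) p"
    by (rule connection_cong[OF D X X Y part_vf[OF y] _ _ p])
      (use part_Basis[OF Y] in \<open>simp_all add: points_eq_def y_def\<close>)
  then show ?thesis
    using right[OF finite_Basis] by (simp add: euclidean_representation x_def y_def)
qed

text \<open>The product frame sheared along the vector factor: moving in direction \<open>x\<close>
  drags \<open>v\<close> by \<open>b x v\<close>, and the coordinates subtract this again. For
  \<open>b\<close> equal to \<open>m\<close> these are the right invariant fields of the semidirect
  product, by \<open>R2_eq\<close>.\<close>

lemma parallelism_prod_vector:
  fixes A :: "('m, 'e::euclidean_space) atlas" and R :: "'h::euclidean_space \<Rightarrow> 'm \<Rightarrow> ('m, 'e) tvec"
    and b :: "'h \<Rightarrow> 'k::euclidean_space \<Rightarrow> 'k"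
  assumes A: "smooth_atlas A" and par: "parallelism A R K" and b: "bilinear b"
  shows "parallelism (prod_atlas A vector_atlas)
    (\<lambda>(x, y) (p, v). pair_tangent A (R x p) v (y + b x v))
    (\<lambda>z. (K (tangent_map (prod_atlas A vector_atlas) A fst z),
       differential (prod_atlas A vector_atlas) snd z -
         b (K (tangent_map (prod_atlas A vector_atlas) A fst z)) (snd (fst z))))"
    (is "parallelism ?P ?R ?K")
proof -
  note V = smooth_atlas_vector[where 'e = 'k] and VH = smooth_atlas_vector[where 'e = "'h \<times> 'k"] and H = smooth_atlas_vector[where 'e = 'h]
  note P = smooth_atlas_prod[OF A V] and F = smooth_map_fst[OF A V] and S = smooth_map_snd[OF A V]
  note TP = smooth_atlas_bundle[OF P] and TA = smooth_atlas_bundle[OF A] and Q = smooth_atlas_prod[OF P VH]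
  have bb: "bounded_bilinear b"
    using b bilinear_conv_bounded_bilinear by blast
  note RT = parallelism_tangent_space[OF par]
  have fstz: "tangent_map ?P A fst z \<in> tangent_space A p" if "z \<in> tangent_space ?P (p, v)" for z p v
    using tangent_map_tangent_space[OF P A F that] by simp
  have a: "smooth_map (tangent_bundle ?P) vector_atlas (\<lambda>z. K (tangent_map ?P A fst z))"
    by (rule smooth_map_compose[OF TP TA H smooth_map_tangent_map[OF P A F] parallelism_smooth_coord[OF par]])
  have v: "smooth_map (tangent_bundle ?P) vector_atlas (\<lambda>z. snd (fst z))"
    by (rule smooth_map_compose[OF TP P V smooth_map_bundle_fst[OF P] S])
  have "smooth_map (tangent_bundle ?P) vector_atlas (\<lambda>z. (K (tangent_map ?P A fst z),
      differential ?P snd z + - b (K (tangent_map ?P A fst z)) (snd (fst z))))"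
    by (intro smooth_map_vector_Pair[OF TP] a smooth_map_add[OF TP] smooth_map_velocity[OF P S]
        smooth_map_linear_compose[OF TP _ bounded_linear_minus[OF bounded_linear_ident]] smooth_map_bilinear[OF TP a bb v])
  then have K: "smooth_map (tangent_bundle ?P) vector_atlas ?K"
    by simp
  note f1 = smooth_map_compose[OF Q P A smooth_map_fst[OF P VH] F]
    and f2 = smooth_map_compose[OF Q P V smooth_map_fst[OF P VH] S]
    and f3 = smooth_map_linear_compose[OF Q smooth_map_snd[OF P VH] bounded_linear_fst]
    and f4 = smooth_map_linear_compose[OF Q smooth_map_snd[OF P VH] bounded_linear_snd]
  have "smooth_map (prod_atlas ?P vector_atlas) (tangent_bundle A) (\<lambda>z :: ('m \<times> 'k) \<times> 'h \<times> 'k. R (fst (snd z)) (fst (fst z)))"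
    using smooth_map_compose[OF Q smooth_atlas_prod[OF A H] TA smooth_map_Pair[OF Q A H f1 f3] parallelism_smooth[OF par]] by simp
  from smooth_map_pair_tangent[OF Q A this f2 smooth_map_add[OF Q f4 smooth_map_bilinear[OF Q f3 bb f2]]]
  have R: "smooth_map (prod_atlas ?P vector_atlas) (tangent_bundle ?P) (\<lambda>z. ?R (snd z) (fst z))"
    by (simp add: case_prod_beta)
  have RK: "?R (?K z) q = z" if z: "z \<in> tangent_space ?P q" for z q
  proof -
    obtain p v where q: "q = (p, v)"
      by (metis prod.collapse)
    then have "fst z = (p, v)"
      using tangent_space_fst z by metis
    then show ?thesis
      using pair_tangent_eqI[OF A z[unfolded q] refl refl] parallelism_of_coord[OF par fstz[OF z[unfolded q]]] by (simp add: q)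
  qed
  show ?thesis
    unfolding parallelism_def
  proof (intro conjI ballI allI)
    fix q u w t assume "q \<in> points ?P"
    then have q: "fst q \<in> points A"
      by auto
    note RT' = RT[OF q] and bl = bilinear_ladd[OF b] bilinear_lmul[OF b]
    show "?R (u + w) q = tadd (?R u q) (?R w q)"
      by (simp add: case_prod_beta tadd_pair_tangent[OF A RT' RT'] parallelism_add[OF par q] bl algebra_simps)
    show "?R (t *\<^sub>R u) q = tscale t (?R u q)"
      by (simp add: case_prod_beta tscale_pair_tangent[OF A RT'] parallelism_scale[OF par q] bl algebra_simps)
    show "?R u q \<in> tangent_space ?P q"
      using pair_tangent_tangent_space[OF A RT', where v = "snd q"] by (simp add: case_prod_beta)
    show "?K (?R u q) = u"
      by (simp add: case_prod_beta tangent_map_fst_pair[OF A RT'] differential_snd_pair[OF A RT'] parallelism_coord[OF par q])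
  qed (use K R RK in auto)
qed

section \<open>Right invariant fields on a Lie group\<close>

locale identified_lie_group =
  fixes G :: "'a monoid" and A :: "('a, 'e::euclidean_space) atlas" and \<iota> :: "'g::euclidean_space \<Rightarrow> ('a, 'e) tvec"
  assumes lie_group: "lie_group G A" and identification: "is_identification G A \<iota>"
begin

sublocale group G
  using lie_group by (simp add: lie_group_def)

abbreviation R :: "'g \<Rightarrow> 'a \<Rightarrow> ('a, 'e) tvec" where
  "R \<equiv> right_inv_field G A \<iota>"

text \<open>The right Maurer-Cartan form, read through \<open>\<iota>\<close>.\<close>

definition K :: "('a, 'e) tvec \<Rightarrow> 'g" where
  "K w = snd (right_trivialization G A \<iota> w)"

lemma A_smooth: "smooth_atlas A"
  using lie_group by (simp add: lie_group_def smooth_manifold_smooth_atlas)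

lemma points_A [simp]: "points A = carrier G"
  using lie_group by (simp add: lie_group_def)

lemma smooth_mult: "smooth_map (prod_atlas A A) A (\<lambda>z. fst z \<otimes>\<^bsub>G\<^esub> snd z)"
  using lie_group by (simp add: lie_group_def case_prod_unfold)

lemma smooth_inv: "smooth_map A A (\<lambda>x. inv\<^bsub>G\<^esub> x)"
  using lie_group by (simp add: lie_group_def)

lemma smooth_right_mult: "x \<in> carrier G \<Longrightarrow> smooth_map A A (\<lambda>y. y \<otimes>\<^bsub>G\<^esub> x)"
  using smooth_map_compose[OF A_smooth smooth_atlas_prod[OF A_smooth A_smooth] A_smooth
      smooth_map_Pair[OF A_smooth A_smooth A_smooth smooth_map_id[OF A_smooth] smooth_map_const[OF A_smooth A_smooth]] smooth_mult] by simp

lemma tangent_map_right_mult_inverse: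
  assumes x: "x \<in> carrier G" "y \<in> carrier G" "x \<otimes>\<^bsub>G\<^esub> y = \<one>\<^bsub>G\<^esub>" and w: "w \<in> tangent_space A p"
  shows "tangent_map A A (\<lambda>z. z \<otimes>\<^bsub>G\<^esub> y) (tangent_map A A (\<lambda>z. z \<otimes>\<^bsub>G\<^esub> x) w) = w"
proof -
  note xy = smooth_map_compose[OF A_smooth A_smooth A_smooth smooth_right_mult[OF x(1)] smooth_right_mult[OF x(2)]]
  have "tangent_map A A (\<lambda>z. z \<otimes>\<^bsub>G\<^esub> x \<otimes>\<^bsub>G\<^esub> y) w = tangent_map A A (\<lambda>z. z) w"
    by (rule tangent_map_cong[OF A_smooth w xy]) (use x in \<open>simp add: m_assoc\<close>)
  then show ?thesis
    using tangent_map_compose[OF A_smooth A_smooth A_smooth smooth_right_mult[OF x(1)] smooth_right_mult[OF x(2)] xy w]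
      tangent_map_id[OF A_smooth w] by simp
qed

lemma \<iota>_tangent: "\<iota> u \<in> tangent_space A \<one>\<^bsub>G\<^esub>"
  and \<iota>_inj: "inj \<iota>"
  and \<iota>_surj: "w \<in> tangent_space A \<one>\<^bsub>G\<^esub> \<Longrightarrow> w \<in> range \<iota>"
  and \<iota>_add: "\<iota> (u + v) = tadd (\<iota> u) (\<iota> v)"
  and \<iota>_scale: "\<iota> (t *\<^sub>R u) = tscale t (\<iota> u)"
  using identification by (auto simp: is_identification_def bij_betw_def)

lemma K_eq: "K w = inv_into UNIV \<iota> (tangent_map A A (\<lambda>y. y \<otimes>\<^bsub>G\<^esub> inv\<^bsub>G\<^esub> (fst w)) w)"
  by (simp add: K_def right_trivialization_def)

lemma R_eq: "R u x = tangent_map A A (\<lambda>y. y \<otimes>\<^bsub>G\<^esub> x) (\<iota> u)"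
  by (simp add: right_inv_field_def)

text \<open>\<open>R u g\<close> is the partial tangent map of the multiplication at
  \<open>\<iota> u\<close> and \<open>g\<close>, which gives smoothness in both variables. For
  \<open>K\<close>, translation to the identity lands in one fibre, where a chart component followed
  by a linear map recovers the algebra element.\<close>

lemma parallelism_right_inv: "parallelism A R K"
proof -
  note V = smooth_atlas_vector[where 'e = 'g] and TA_smooth = smooth_atlas_bundle[OF A_smooth]
  note P = smooth_atlas_prod[OF A_smooth V] and Q = smooth_atlas_prod[OF TA_smooth A_smooth]
  obtain c where c: "c \<in> A" "\<one>\<^bsub>G\<^esub> \<in> fst c"
    using points_chart[of "\<one>\<^bsub>G\<^esub>" A] by auto
  \<comment> \<open>\<open>\<iota>\<close> read in a chart around the identity. The algebra
    \<open>'g\<close> and the model space \<open>'e\<close> are different types, so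
    \<open>\<iota>\<close> is inverted through a linear left inverse of the injection
    \<open>j\<close>.\<close>
  define j where "j = (\<lambda>u. snd (\<iota> u) c)"
  have j: "linear j"
    by (rule linearI) (simp_all add: j_def \<iota>_add \<iota>_scale)
  have "inj j"
    unfolding j_def inj_def using tangent_space_eqI[OF \<iota>_tangent \<iota>_tangent c] injD[OF \<iota>_inj] by blast
  then obtain L where L: "linear L" "\<And>u. L (j u) = u"
    using linear_injective_left_inverse[OF j] by (metis comp_apply id_apply)
  have \<iota>_chart: "chart_vec A c \<one>\<^bsub>G\<^esub> (j u) = \<iota> u" for u
    by (rule tangent_space_eqI[OF chart_vec_tangent_space[OF A_smooth c] \<iota>_tangent c]) (simp add: snd_chart_vec[OF A_smooth c] j_def)
  have RT: "R u p \<in> tangent_space A p" if "p \<in> carrier G" for u p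
    using tangent_map_tangent_space[OF A_smooth A_smooth smooth_right_mult[OF that] \<iota>_tangent] that by (simp add: R_eq)
  have K_base: "tangent_map A A (\<lambda>y. y \<otimes>\<^bsub>G\<^esub> inv\<^bsub>G\<^esub> p) w \<in> tangent_space A \<one>\<^bsub>G\<^esub>" if w: "w \<in> tangent_space A p" for w p
    using tangent_map_tangent_space[OF A_smooth A_smooth smooth_right_mult w, of "inv\<^bsub>G\<^esub> p"] tangent_space_point[OF w] by simp
  have KR: "K (R u p) = u" if "p \<in> carrier G" for u p
    using tangent_map_right_mult_inverse[OF _ _ _ \<iota>_tangent, of p "inv\<^bsub>G\<^esub> p"] that inv_into_f_f[OF \<iota>_inj]
    by (simp add: K_eq tangent_space_fst[OF RT[OF that]]) (simp add: R_eq)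
  have \<iota>K: "\<iota> (K w) = tangent_map A A (\<lambda>y. y \<otimes>\<^bsub>G\<^esub> inv\<^bsub>G\<^esub> p) w" if w: "w \<in> tangent_space A p" for w p
    using f_inv_into_f[OF \<iota>_surj[OF K_base[OF w]]] by (simp add: K_eq tangent_space_fst[OF w])
  have RK: "R (K w) p = w" if w: "w \<in> tangent_space A p" for w p
    using tangent_map_right_mult_inverse[OF _ _ _ w, of "inv\<^bsub>G\<^esub> p" p] tangent_space_point[OF w]
    by (simp add: R_eq[of "K w"] \<iota>K[OF w])
  have "smooth_map (prod_atlas A vector_atlas) (tangent_bundle A) (\<lambda>z :: 'a \<times> 'g. chart_vec A c \<one>\<^bsub>G\<^esub> (j (snd z)))"
    by (rule smooth_map_chart_vec[OF P A_smooth c smooth_map_linear_compose[OF P smooth_map_snd[OF A_smooth V]]])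
      (use j linear_conv_bounded_linear in blast)
  from smooth_map_compose[OF P Q TA_smooth smooth_map_Pair[OF P TA_smooth A_smooth this smooth_map_fst[OF A_smooth V]]
      smooth_map_partial_tangent_map[OF A_smooth A_smooth A_smooth smooth_mult]]
  have smooth_R: "smooth_map (prod_atlas A vector_atlas) (tangent_bundle A) (\<lambda>z. R (snd z) (fst z))"
    by (simp add: \<iota>_chart R_eq)
  \<comment> \<open>Here the parameter of the partial tangent map is the inverse of the base point
    of the argument; this is where smoothness of the inversion enters.\<close>
  from smooth_map_compose[OF TA_smooth Q TA_smooth smooth_map_Pair[OF TA_smooth TA_smooth A_smooth smooth_map_id[OF TA_smooth]
        smooth_map_compose[OF TA_smooth A_smooth A_smooth smooth_map_bundle_fst[OF A_smooth] smooth_inv]] smooth_map_partial_tangent_map[OF A_smooth A_smooth A_smooth smooth_mult]]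
  have "smooth_map (tangent_bundle A) (tangent_bundle A) (\<lambda>w. tangent_map A A (\<lambda>y. y \<otimes>\<^bsub>G\<^esub> inv\<^bsub>G\<^esub> (fst w)) w)"
    by simp
  from smooth_map_fibre_coordinates[OF TA_smooth this _ c]
  have "smooth_map (tangent_bundle A) vector_atlas (\<lambda>w. snd (tangent_map A A (\<lambda>y. y \<otimes>\<^bsub>G\<^esub> inv\<^bsub>G\<^esub> (fst w)) w) c)"
    using points_bundle_fst by fastforce
  from smooth_map_linear_compose[OF TA_smooth this, of L]
  have "smooth_map (tangent_bundle A) vector_atlas (\<lambda>w. L (snd (tangent_map A A (\<lambda>y. y \<otimes>\<^bsub>G\<^esub> inv\<^bsub>G\<^esub> (fst w)) w) c))"
    using L(1) linear_conv_bounded_linear by blast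
  then have smooth_K: "smooth_map (tangent_bundle A) vector_atlas K"
  proof (rule smooth_map_cong[OF TA_smooth])
    fix w assume "w \<in> points (tangent_bundle A)"
    then have w: "w \<in> tangent_space A (fst w)"
      by (simp add: mem_points_bundle)
    show "L (snd (tangent_map A A (\<lambda>y. y \<otimes>\<^bsub>G\<^esub> inv\<^bsub>G\<^esub> (fst w)) w) c) = K w"
      using L(2)[of "K w"] \<iota>K[OF w] by (simp add: j_def)
  qed
  show ?thesis
    unfolding parallelism_def
    using RT KR RK smooth_R smooth_K tangent_map_tadd[OF A_smooth A_smooth smooth_right_mult \<iota>_tangent \<iota>_tangent]
      tangent_map_tscale[OF A_smooth A_smooth smooth_right_mult \<iota>_tangent] by (simp add: R_eq[abs_def] \<iota>_add \<iota>_scale)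
qed

section \<open>The right trivialization and its inverse\<close>

abbreviation TA :: "(('a, 'e) tvec, 'e \<times> 'e) atlas" where
  "TA \<equiv> tangent_bundle A"

abbreviation PA :: "('a \<times> 'g, 'e \<times> 'g) atlas" where
  "PA \<equiv> prod_atlas A vector_atlas"

abbreviation F :: "('a, 'e) tvec \<Rightarrow> 'a \<times> 'g" where
  "F \<equiv> right_trivialization G A \<iota>"

text \<open>The smooth inverse of \<open>F\<close>, in place of the \<open>inv_into\<close> that
  occurs in the transported structures.\<close>

definition \<Phi> :: "'a \<times> 'g \<Rightarrow> ('a, 'e) tvec" where
  "\<Phi> z = R (snd z) (fst z)"

lemma PA_smooth: "smooth_atlas PA" and TA_smooth: "smooth_atlas TA"
  by (rule smooth_atlas_prod[OF A_smooth smooth_atlas_vector] smooth_atlas_bundle[OF A_smooth])+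

lemma F_eq: "F w = (fst w, K w)"
  by (simp add: K_def right_trivialization_def)

lemma smooth_F: "smooth_map TA PA F"
  using smooth_map_Pair[OF TA_smooth A_smooth smooth_atlas_vector smooth_map_bundle_fst[OF A_smooth]
      parallelism_smooth_coord[OF parallelism_right_inv]] by (simp flip: F_eq)

lemma smooth_\<Phi>: "smooth_map PA TA \<Phi>"
  using parallelism_smooth[OF parallelism_right_inv] by (simp add: \<Phi>_def[abs_def])

lemma F_\<Phi>: "z \<in> points PA \<Longrightarrow> F (\<Phi> z) = z"
  using parallelism_tangent_space[OF parallelism_right_inv, of "fst z" "snd z"]
    parallelism_coord[OF parallelism_right_inv, of "fst z" "snd z"]
  by (auto simp: F_eq \<Phi>_def tangent_space_fst)

lemma \<Phi>_F: "w \<in> points TA \<Longrightarrow> \<Phi> (F w) = w"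
  using parallelism_of_coord[OF parallelism_right_inv, of w "fst w"] by (simp add: F_eq \<Phi>_def mem_points_bundle)

lemma inv_F: "z \<in> points PA \<Longrightarrow> inv_into (points TA) F z = \<Phi> z"
  by (metis F_\<Phi> \<Phi>_F inv_into_f_eq inj_on_inverseI smooth_\<Phi> smooth_map_points)

text \<open>\<open>push_connection\<close> pulls fields back by pushing them along the inverse of
  \<open>F\<close>, and unfolding that push produces the inverse of the inverse.\<close>

lemma inv_inv_F:
  assumes w: "w \<in> points TA"
  shows "inv_into (points PA) (inv_into (points TA) F) w = F w"
proof (rule inv_into_f_eq)
  show "inj_on (inv_into (points TA) F) (points PA)"
    by (rule inj_on_inverseI[where g = F]) (simp only: inv_F F_\<Phi>)
  show Fw: "F w \<in> points PA"
    by (rule smooth_map_points[OF smooth_F w])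
  show "inv_into (points TA) F (F w) = w"
    using inv_F[OF Fw] \<Phi>_F[OF w] by simp
qed

lemma tangent_map_inv_F: "w \<in> tangent_space PA z \<Longrightarrow> tangent_map PA TA (inv_into (points TA) F) w = tangent_map PA TA \<Phi> w"
  using tangent_map_cong[OF PA_smooth _ smooth_\<Phi>] inv_F by metis

lemma tangent_map_F_\<Phi>:
  assumes w: "w \<in> tangent_space PA z"
  shows "tangent_map TA PA F (tangent_map PA TA \<Phi> w) = w"
  using tangent_map_compose[OF PA_smooth TA_smooth PA_smooth smooth_\<Phi> smooth_F smooth_map_compose[OF PA_smooth TA_smooth PA_smooth smooth_\<Phi> smooth_F] w]
    tangent_map_cong[OF PA_smooth w smooth_map_compose[OF PA_smooth TA_smooth PA_smooth smooth_\<Phi> smooth_F], of "\<lambda>z. z"] F_\<Phi> tangent_map_id[OF PA_smooth w]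
  by simp

end

section \<open>The right invariant structures on the semidirect product\<close>

locale flat_lie_group = identified_lie_group G A \<iota>
  for G :: "'a monoid" and A :: "('a, 'e::euclidean_space) atlas" and \<iota> :: "'g::euclidean_space \<Rightarrow> ('a, 'e) tvec" +
  fixes m :: "'g \<Rightarrow> 'g \<Rightarrow> 'g" and \<rho> :: "'a \<Rightarrow> 'g \<Rightarrow>\<^sub>L 'g"
    and nabla :: "('a \<Rightarrow> ('a, 'e) tvec) \<Rightarrow> ('a \<Rightarrow> ('a, 'e) tvec) \<Rightarrow> 'a \<Rightarrow> ('a, 'e) tvec"
  assumes m_bilinear: "bilinear m"
    and rho_smooth: "smooth_map A vector_atlas \<rho>"
    and rho_hom: "\<rho> \<in> hom G general_linear_group"
    and rho_deriv: "\<And>u v. blinfun_apply (differential A \<rho> (\<iota> u)) v = m u v"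
    and nabla: "is_right_inv_connection G A \<iota> (\<lambda>u v. - m u v) nabla"
begin

text \<open>By multiplicativity the value at the identity is idempotent, and an idempotent with a
  left inverse is the identity.\<close>

lemma rho_one: "\<rho> \<one>\<^bsub>G\<^esub> = id_blinfun"
proof -
  have idem: "\<rho> \<one>\<^bsub>G\<^esub> o\<^sub>L \<rho> \<one>\<^bsub>G\<^esub> = \<rho> \<one>\<^bsub>G\<^esub>"
    using hom_mult[OF rho_hom one_closed one_closed] by (simp add: general_linear_group_def)
  obtain f' where f': "f' o\<^sub>L \<rho> \<one>\<^bsub>G\<^esub> = id_blinfun"
    using hom_in_carrier[OF rho_hom one_closed] by (auto simp: general_linear_group_def)
  show ?thesis
  proof (rule blinfun_eqI)
    fix v
    show "blinfun_apply (\<rho> \<one>\<^bsub>G\<^esub>) v = blinfun_apply id_blinfun v"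
      using arg_cong[OF idem, of "\<lambda>B. blinfun_apply f' (blinfun_apply B v)"]
        arg_cong[OF f', of "\<lambda>B. blinfun_apply B v"]
        arg_cong[OF f', of "\<lambda>B. blinfun_apply B (blinfun_apply (\<rho> \<one>\<^bsub>G\<^esub>) v)"] by simp
  qed
qed

abbreviation R2 :: "'g \<times> 'g \<Rightarrow> 'a \<times> 'g \<Rightarrow> ('a \<times> 'g, 'e \<times> 'g) tvec" where
  "R2 \<equiv> right_inv_field (semidirect G \<rho>) PA (prod_identification G A \<iota>)"

text \<open>Right translation by \<open>(g, v)\<close> sends \<open>(y, s)\<close> to
  \<open>(y g, s + \<rho>(y) v)\<close>. Its derivative at the identity in direction
  \<open>(a, b)\<close> is \<open>R a g\<close> in the first factor and \<open>b\<close> plus the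
  derivative of \<open>\<rho>(y) v\<close>, that is \<open>m a v\<close>, in the second.\<close>

lemma R2_eq:
  assumes g: "g \<in> carrier G"
  shows "R2 (a, b) (g, v) = pair_tangent A (R a g) v (b + m a v)"
proof -
  note V = smooth_atlas_vector[where 'e = 'g] and \<iota>a = \<iota>_tangent[of a]
  let ?z = "pair_tangent A (\<iota> a) (0 :: 'g) b"
  have z: "?z \<in> tangent_space PA (\<one>\<^bsub>G\<^esub>, 0)"
    using pair_tangent_tangent_space[OF A_smooth \<iota>a] .
  have \<kappa>: "prod_identification G A \<iota> (a, b) = ?z"
    using tangent_space_fst[OF \<iota>a] by (simp add: prod_identification_def pair_tangent_def)
  note F' = smooth_map_fst[OF A_smooth V] and S = smooth_map_snd[OF A_smooth V]
  \<comment> \<open>Evaluation at \<open>v\<close> is linear and replaces the operator valued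
    \<open>\<rho>\<close> by a map into the Euclidean space \<open>'g\<close>, to which the
    composition lemmas apply.\<close>
  have bl: "bounded_linear (\<lambda>B :: 'g \<Rightarrow>\<^sub>L 'g. blinfun_apply B v)"
    by (rule blinfun.bounded_linear_left)
  note \<rho>v = smooth_map_linear_compose[OF A_smooth rho_smooth bl]
  note \<rho>v' = smooth_map_compose[OF PA_smooth A_smooth V F' \<rho>v]
  note f = smooth_map_compose[OF PA_smooth A_smooth A_smooth F' smooth_right_mult[OF g]] and h = smooth_map_add[OF PA_smooth S \<rho>v']
  have "R2 (a, b) (g, v) = tangent_map PA PA (\<lambda>y. (fst y \<otimes>\<^bsub>G\<^esub> g, snd y + blinfun_apply (\<rho> (fst y)) v)) ?z"
    by (simp add: right_inv_field_def \<kappa> semidirect_def case_prod_beta)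
  also have "\<dots> = pair_tangent A (tangent_map PA A (\<lambda>y. fst y \<otimes>\<^bsub>G\<^esub> g) ?z) v
      (differential PA (\<lambda>y. snd y + blinfun_apply (\<rho> (fst y)) v) ?z)"
    using tangent_map_Pair[OF PA_smooth A_smooth f h z] by (simp add: rho_one)
  also have "tangent_map PA A (\<lambda>y. fst y \<otimes>\<^bsub>G\<^esub> g) ?z = R a g"
    using tangent_map_compose[OF PA_smooth A_smooth A_smooth F' smooth_right_mult[OF g] f z] tangent_map_fst_pair[OF A_smooth \<iota>a, of 0 b]
    by (simp add: R_eq)
  also have "differential PA (\<lambda>y. snd y + blinfun_apply (\<rho> (fst y)) v) ?z = b + m a v"
    using differential_add[OF PA_smooth S z \<rho>v'] differential_compose[OF PA_smooth A_smooth F' \<rho>v \<rho>v' z]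
      differential_linear_compose[OF A_smooth rho_smooth \<iota>a bl] tangent_map_fst_pair[OF A_smooth \<iota>a, of 0 b]
      differential_snd_pair[OF A_smooth \<iota>a, of 0 b] rho_deriv by simp
  finally show ?thesis .
qed

definition K2 :: "('a \<times> 'g, 'e \<times> 'g) tvec \<Rightarrow> 'g \<times> 'g" where
  "K2 z = (K (tangent_map PA A fst z), differential PA snd z - m (K (tangent_map PA A fst z)) (snd (fst z)))"

lemma parallelism_R2: "parallelism PA R2 K2"
  unfolding K2_def[abs_def]
  by (rule parallelism_cong[OF PA_smooth parallelism_prod_vector[OF A_smooth parallelism_right_inv m_bilinear]]) (auto simp: R2_eq)

text \<open>The right invariant frame of the semidirect product carried to TG. Its halves
  \<open>E (a, 0)\<close> and \<open>E (0, b)\<close> turn out to be the horizontal lift of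
  \<open>R a\<close> and the vertical lift of \<open>R b\<close>.\<close>

definition E :: "'g \<times> 'g \<Rightarrow> ('a, 'e) tvec \<Rightarrow> (('a, 'e) tvec, 'e \<times> 'e) tvec" where
  "E u w = tangent_map PA TA \<Phi> (R2 u (F w))"

definition KE :: "(('a, 'e) tvec, 'e \<times> 'e) tvec \<Rightarrow> 'g \<times> 'g" where
  "KE \<xi> = K2 (tangent_map TA PA F \<xi>)"

lemma parallelism_E: "parallelism TA E KE"
  unfolding E_def[abs_def] KE_def[abs_def]
  by (rule parallelism_push[OF PA_smooth TA_smooth smooth_\<Phi> smooth_F F_\<Phi> \<Phi>_F parallelism_R2])

lemma points_F: "w \<in> points TA \<Longrightarrow> F w \<in> points PA"
  using smooth_map_points[OF smooth_F] .

lemma tangent_map_F_E: "w \<in> points TA \<Longrightarrow> tangent_map TA PA F (E u w) = R2 u (F w)"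
  unfolding E_def using tangent_map_F_\<Phi>[OF parallelism_tangent_space[OF parallelism_R2 points_F]] .

text \<open>\<open>\<Phi>\<close> is linear on fibres, so the straight line in the fibre through
  \<open>v\<close> is the image of a straight line in \<open>'g\<close> over a fixed base
  point.\<close>

lemma vertical_lift_R:
  assumes v: "v \<in> points TA"
  shows "vertical_lift A (R b (fst v)) v = E (0, b) v"
proof -
  note V = smooth_atlas_vector[where 'e = real] and U = smooth_atlas_vector[where 'e = 'g]
  note par = parallelism_right_inv
  let ?p = "fst v" and ?y = "K v"
  let ?k = "\<lambda>t::real. ?y + t *\<^sub>R b"
  have p: "?p \<in> carrier G"
    using points_bundle_fst[OF v] by simp
  have v': "v = R ?y ?p"
    using parallelism_of_coord[OF par] v by (simp add: mem_points_bundle)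
  have curve: "(\<lambda>t. tadd v (tscale t (R b ?p))) = (\<lambda>t. \<Phi> (?p, ?k t))"
    using parallelism_add[OF par, of ?p] parallelism_scale[OF par, of ?p] p v' by (simp add: \<Phi>_def)
  have k: "smooth_map vector_atlas vector_atlas ?k"
    by (intro smooth_map_add[OF V] smooth_map_const[OF V U] smooth_map_linear_compose[OF V smooth_map_id[OF V]]
        bounded_linear_scaleR_left) simp
  note c = smooth_map_const[OF V A_smooth, of ?p]
  have pk: "smooth_map vector_atlas PA (\<lambda>t. (?p, ?k t))"
    using smooth_map_Pair[OF V A_smooth U c k] p by simp
  have t: "vec_tangent 0 1 \<in> tangent_space vector_atlas (0 :: real)"
    by (rule vec_tangent_tangent_space)
  have "((\<lambda>t. ?k t) has_derivative (\<lambda>s. s *\<^sub>R b)) (at 0)"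
    by (auto intro!: derivative_eq_intros)
  then have dk: "differential vector_atlas ?k (vec_tangent 0 1) = b"
    using differential_chart[OF V k t, of vector_chart] frechet_derivative_at[of ?k "\<lambda>s. s *\<^sub>R b" 0] by simp
  have "vertical_lift A (R b ?p) v = tangent_map vector_atlas TA (\<lambda>t. \<Phi> (?p, ?k t)) (vec_tangent 0 1)"
    by (simp add: vertical_lift_def curve)
  also have "\<dots> = tangent_map PA TA \<Phi> (tangent_map vector_atlas PA (\<lambda>t. (?p, ?k t)) (vec_tangent 0 1))"
    using tangent_map_compose[OF V PA_smooth TA_smooth pk smooth_\<Phi> smooth_map_compose[OF V PA_smooth TA_smooth pk smooth_\<Phi>] t] by simp
  \<comment> \<open>The base point is constant along the curve; writing its zero velocity as
    \<open>R 0\<close> brings the vector into the form of \<open>R2_eq\<close> with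
    \<open>a = 0\<close>, where the shear term vanishes.\<close>
  also have "tangent_map vector_atlas PA (\<lambda>t. (?p, ?k t)) (vec_tangent 0 1) = pair_tangent A (R 0 ?p) ?y b"
    using tangent_map_Pair[OF V A_smooth c k t] p tangent_map_const[OF V A_smooth _ t, of ?p] dk by (simp add: parallelism_zero[OF par])
  also have "pair_tangent A (R 0 ?p) ?y b = R2 (0, b) (F v)"
    using R2_eq[OF p] by (simp add: F_eq bilinear_lzero[OF m_bilinear])
  finally show ?thesis
    by (simp add: E_def)
qed

lemma nabla_R:
  assumes "vector_field A X" "vector_field A Y" "p \<in> carrier G"
  shows "nabla X Y p = R (differential A (\<lambda>q. K (Y q)) (X p) - m (K (X p)) (K (Y p))) p"
proof -
  have "bilinear (\<lambda>u v. - m u v)"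
    using m_bilinear unfolding bilinear_def by (simp add: linear_compose_neg)
  then show ?thesis
    using connection_parallelism[OF A_smooth parallelism_right_inv _ _ _ assms(1,2), of nabla "\<lambda>u v. - m u v" p] nabla assms(3)
    by (simp add: is_right_inv_connection_def)
qed

lemma tdiff_tadd: "fst w = fst w' \<Longrightarrow> tdiff (tadd w w') w' = w"
  by (rule tvec_eqI) (simp_all add: tdiff_def)

text \<open>For a field \<open>Y\<close> with coordinates \<open>y\<close>, the tangent vector of
  \<open>Y\<close> along \<open>R a\<close> has second component \<open>dy\<close>, and the vertical
  correction is \<open>dy - m a y\<close>. The derivative cancels, so the difference
  \<open>m a y\<close> is the same for all admissible fields.\<close>

lemma horizontal_lift_R:
  assumes v: "v \<in> points TA"
  shows "horizontal_lift A nabla (R a (fst v)) v = E (a, 0) v"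
proof -
  note par = parallelism_right_inv and U = smooth_atlas_vector[where 'e = 'g]
  let ?p = "fst v" and ?y = "K v"
  let ?w = "R a ?p"
  have p: "?p \<in> carrier G"
    using points_bundle_fst[OF v] by simp
  have v': "R ?y ?p = v"
    using parallelism_of_coord[OF par] v by (simp add: mem_points_bundle)
  have w: "R u ?p \<in> tangent_space A ?p" for u
    using parallelism_tangent_space[OF par] p by simp
  have fst_w: "fst ?w = ?p"
    using tangent_space_fst[OF w] .
  note vf = parallelism_vector_field_const[OF A_smooth par] and R2T = parallelism_tangent_space[OF parallelism_R2 points_F[OF v]]
  have main: "tdiff (tangent_map A TA Y ?w) (vertical_lift A (nabla X Y ?p) v) = E (a, 0) v"
    if X: "vector_field A X" "X ?p = ?w" and Y: "vector_field A Y" "Y ?p = v" for X Y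
  proof -
    define y where "y = (\<lambda>q. K (Y q))"
    have y: "smooth_map A vector_atlas y" "y ?p = ?y"
      using parallelism_vector_field_coord[OF A_smooth par Y(1)] Y(2) by (simp_all add: y_def)
    note iy = smooth_map_Pair[OF A_smooth A_smooth U smooth_map_id[OF A_smooth] y(1)]
    let ?d = "differential A y ?w"
    have "smooth_map A TA (\<lambda>q. \<Phi> (q, y q))"
      using smooth_map_compose[OF A_smooth PA_smooth TA_smooth iy smooth_\<Phi>] .
    then have "tangent_map A TA Y ?w = tangent_map A TA (\<lambda>q. \<Phi> (q, y q)) ?w"
      by (intro tangent_map_cong[OF A_smooth w, symmetric])
        (use parallelism_of_coord[OF par] Y(1) in \<open>auto simp: \<Phi>_def y_def vector_field_def\<close>)
    also have "\<dots> = tangent_map PA TA \<Phi> (tangent_map A PA (\<lambda>q. (q, y q)) ?w)"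
      using tangent_map_compose[OF A_smooth PA_smooth TA_smooth iy smooth_\<Phi> smooth_map_compose[OF A_smooth PA_smooth TA_smooth iy smooth_\<Phi>] w] by simp
    also have "tangent_map A PA (\<lambda>q. (q, y q)) ?w = pair_tangent A ?w ?y ?d"
      using tangent_map_Pair[OF A_smooth A_smooth smooth_map_id[OF A_smooth] y(1) w] y(2) by (simp add: tangent_map_id[OF A_smooth w])
    \<comment> \<open>The second component is split so that the first summand is the frame vector of
      \<open>(a, 0)\<close>, shear included, and the second is exactly the vertical lift to be
      subtracted.\<close>
    also have "\<dots> = tadd (pair_tangent A ?w ?y (m a ?y)) (pair_tangent A (R 0 ?p) ?y (?d - m a ?y))"
      using tadd_pair_tangent[OF A_smooth w[of a] w[of 0], of ?y "m a ?y" "?d - m a ?y"]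
        parallelism_add[OF par, of ?p a 0] p by simp
    also have "pair_tangent A ?w ?y (m a ?y) = R2 (a, 0) (F v)"
      using R2_eq[OF p, of a 0] by (simp add: F_eq)
    also have "pair_tangent A (R 0 ?p) ?y (?d - m a ?y) = R2 (0, ?d - m a ?y) (F v)"
      using R2_eq[OF p, of 0] by (simp add: F_eq bilinear_lzero[OF m_bilinear])
    also have "tangent_map PA TA \<Phi> (tadd (R2 (a, 0) (F v)) (R2 (0, ?d - m a ?y) (F v))) =
        tadd (E (a, 0) v) (E (0, ?d - m a ?y) v)"
      using tangent_map_tadd[OF PA_smooth TA_smooth smooth_\<Phi> R2T R2T] by (simp add: E_def)
    finally have TY: "tangent_map A TA Y ?w = tadd (E (a, 0) v) (E (0, ?d - m a ?y) v)" .
    have "nabla X Y ?p = R (?d - m a ?y) ?p"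
      using nabla_R[OF X(1) Y(1) p] X(2) Y(2) parallelism_coord[OF par] p by (simp add: y_def)
    then have "vertical_lift A (nabla X Y ?p) v = E (0, ?d - m a ?y) v"
      using vertical_lift_R[OF v] by simp
    then show ?thesis
      using TY tdiff_tadd parallelism_tangent_space[OF parallelism_E v] by (metis tangent_space_fst)
  qed
  show ?thesis
    unfolding horizontal_lift_def fst_w
  proof (rule the_equality)
    show "\<forall>X Y. vector_field A X \<and> vector_field A Y \<and> X ?p = ?w \<and> Y ?p = v \<longrightarrow>
        E (a, 0) v = tdiff (tangent_map A TA Y ?w) (vertical_lift A (nabla X Y ?p) v)"
      using main by simp
    \<comment> \<open>The condition under \<open>THE\<close> quantifies over fields through
      \<open>?w\<close> and \<open>v\<close>, so uniqueness requires that such fields exist: the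
      frame fields \<open>R a\<close> and \<open>R ?y\<close> do.\<close>
    show "\<xi> = E (a, 0) v" if "\<forall>X Y. vector_field A X \<and> vector_field A Y \<and> X ?p = ?w \<and> Y ?p = v \<longrightarrow>
        \<xi> = tdiff (tangent_map A TA Y ?w) (vertical_lift A (nabla X Y ?p) v)" for \<xi>
      using that[rule_format, of "R a" "R ?y"] main[of "R a" "R ?y"] vf v' by simp
  qed
qed

section \<open>Lifts and components in the transported frame\<close>

lemma hlift_field_R: "v \<in> points TA \<Longrightarrow> hlift_field A nabla (R a) v = E (a, 0) v"
  and vlift_field_R: "v \<in> points TA \<Longrightarrow> vlift_field A (R a) v = E (0, a) v"
  by (simp_all add: hlift_field_def vlift_field_def horizontal_lift_R vertical_lift_R)

lemma E_split: "v \<in> points TA \<Longrightarrow> E (a, b) v = tadd (E (a, 0) v) (E (0, b) v)"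
  using parallelism_add[OF parallelism_E, of v "(a, 0)" "(0, b)"] by simp

lemma E_inj: "v \<in> points TA \<Longrightarrow> E u v = E u' v \<Longrightarrow> u = u'"
  using parallelism_coord[OF parallelism_E] by metis

text \<open>Sums of a horizontal and a vertical lift are exactly frame vectors, and frame
  coordinates are unique; so both \<open>THE\<close> descriptions are met by one vector
  each.\<close>

lemma
  assumes v: "v \<in> points TA"
  shows horizontal_part_E: "horizontal_part A nabla (E (a, b) v) = R a (fst v)"
    and vertical_part_E: "vertical_part A nabla (E (a, b) v) = R b (fst v)"
proof -
  note par = parallelism_right_inv
  let ?T = "tangent_space A (fst v)"
  have p: "fst v \<in> carrier G"
    using points_bundle_fst[OF v] by simp
  have RT: "R u (fst v) \<in> ?T" for u
    using parallelism_tangent_space[OF par] p by simp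
  have fst_E: "fst (E (a, b) v) = v"
    using tangent_space_fst[OF parallelism_tangent_space[OF parallelism_E v]] .
  have lifts: "tadd (horizontal_lift A nabla w v) (vertical_lift A w' v) = E (K w, K w') v" if "w \<in> ?T" "w' \<in> ?T" for w w'
    using that parallelism_of_coord[OF par] horizontal_lift_R[OF v, of "K w"] vertical_lift_R[OF v, of "K w'"]
      E_split[OF v, of "K w" "K w'"] by simp
  have uniq: "w = R a (fst v) \<and> w' = R b (fst v)"
    if "w \<in> ?T" "w' \<in> ?T" "E (a, b) v = tadd (horizontal_lift A nabla w v) (vertical_lift A w' v)" for w w'
    using that lifts E_inj[OF v, of "(a, b)"] parallelism_of_coord[OF par] by (metis prod.inject)
  have ex: "E (a, b) v = tadd (horizontal_lift A nabla (R a (fst v)) v) (vertical_lift A (R b (fst v)) v)"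
    using E_split[OF v, of a b] horizontal_lift_R[OF v, of a] vertical_lift_R[OF v, of b] by simp
  show "horizontal_part A nabla (E (a, b) v) = R a (fst v)"
    unfolding horizontal_part_def fst_E by (rule the_equality) (use RT ex uniq in blast)+
  show "vertical_part A nabla (E (a, b) v) = R b (fst v)"
    unfolding vertical_part_def fst_E by (rule the_equality) (use RT ex uniq in blast)+
qed

text \<open>\<open>P\<close> is prescribed on lifts of 1-forms, whereas the claim concerns single
  covectors. At the point \<open>x\<close> a covector is split into its values on the two halves of
  the frame, each half is extended to a right invariant 1-form on \<open>G\<close>, and the pullback
  to TG is the sum of the two lifted forms at \<open>v\<close>.\<close>

lemma push_bivector_eq:
  fixes r :: "('g \<Rightarrow>\<^sub>L real) \<Rightarrow> ('g \<Rightarrow>\<^sub>L real) \<Rightarrow> real"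
  assumes P: "is_tangent_poisson A nabla (right_inv_bivector G A \<iota> r) P"
    and x: "x \<in> points PA" and \<alpha>: "covector PA x \<alpha>" and \<beta>: "covector PA x \<beta>"
  shows "push_bivector TA PA F P x \<alpha> \<beta> =
    right_inv_bivector (semidirect G \<rho>) PA (prod_identification G A \<iota>) (double_tensor r) x \<alpha> \<beta>"
proof -
  note parE = parallelism_E and par = parallelism_right_inv and par2 = parallelism_R2
  define v where "v = \<Phi> x"
  have v: "v \<in> points TA"
    unfolding v_def by (rule smooth_map_points[OF smooth_\<Phi> x])
  have Fv: "F v = x"
    unfolding v_def by (rule F_\<Phi>[OF x])
  have p: "fst v \<in> carrier G"
    using points_bundle_fst[OF v] by simp
  define f where "f = (\<lambda>\<gamma> a. \<gamma> (R2 (a, 0) x) :: real)"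
  define g where "g = (\<lambda>\<gamma> b. \<gamma> (R2 (0, b) x) :: real)"
  \<comment> \<open>\<open>f \<gamma>\<close> and \<open>g \<gamma>\<close> are linear forms with
    coefficients read off at \<open>x\<close>; composed with \<open>K\<close> they become right
    invariant 1-forms on \<open>G\<close>, smooth because \<open>K\<close> is.
    \<open>H \<gamma>\<close> sees only horizontal coordinates and \<open>W \<gamma>\<close> only
    vertical ones.\<close>
  define H where "H = (\<lambda>\<gamma>. hlift_form A nabla (\<lambda>w. f \<gamma> (K w)))"
  define W where "W = (\<lambda>\<gamma>. vlift_form A nabla (\<lambda>w. g \<gamma> (K w)))"
  have lin: "linear (\<lambda>u. \<gamma> (R2 u x))" if "covector PA x \<gamma>" for \<gamma>
    using that parallelism_add[OF par2 x] parallelism_scale[OF par2 x] parallelism_tangent_space[OF par2 x]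
    by (intro linearI) (simp_all add: covector_def)
  have "linear (\<lambda>a :: 'g. (a, 0 :: 'g))" "linear (\<lambda>b :: 'g. (0 :: 'g, b))"
    by (auto intro: linearI)
  then have f: "linear (f \<gamma>)" and g: "linear (g \<gamma>)" if "covector PA x \<gamma>" for \<gamma>
    using linear_compose[OF _ lin[OF that]] unfolding f_def g_def comp_def by blast+
  have oneform: "one_form A (\<lambda>w. l (K w))" if l: "linear l" for l :: "'g \<Rightarrow> real"
  proof -
    have "K (tadd w w') = K w + K w'" "K (tscale t w) = t *\<^sub>R K w"
      if "w \<in> tangent_space A q" "w' \<in> tangent_space A q" for w w' t q
      using that parallelism_of_coord[OF par] parallelism_add[OF par, of q "K w" "K w'"]
        parallelism_scale[OF par, of q t "K w"] parallelism_coord[OF par, of q] tangent_space_point by metis+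
    then show ?thesis
      using smooth_map_linear_compose[OF TA_smooth parallelism_smooth_coord[OF par], of l] l
      by (auto simp: one_form_def smooth_function_def covector_def linear_add linear_cmul linear_conv_bounded_linear)
  qed
  have H_E: "H \<gamma> (E (a, b) v) = f \<gamma> a" and W_E: "W \<gamma> (E (a, b) v) = g \<gamma> b" for \<gamma> a b
    using parallelism_coord[OF par] p
    by (simp_all add: H_def W_def hlift_form_def vlift_form_def horizontal_part_E[OF v] vertical_part_E[OF v])
  have T_E: "\<exists>a b. \<xi> = E (a, b) v" if "\<xi> \<in> tangent_space TA v" for \<xi>
    using parallelism_of_coord[OF parE that] by (metis prod.collapse)
  have E_add: "tadd (E (a, b) v) (E (a', b') v) = E (a + a', b + b') v"
    and E_scale: "tscale t (E (a, b) v) = E (t *\<^sub>R a, t *\<^sub>R b) v" for a b a' b' t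
    using parallelism_add[OF parE v, of "(a, b)" "(a', b')"] parallelism_scale[OF parE v, of t "(a, b)"] by simp_all
  have covH: "covector TA v (H \<gamma>)" and covW: "covector TA v (W \<gamma>)" if "covector PA x \<gamma>" for \<gamma>
    unfolding covector_def using f[OF that] g[OF that]
    by (auto dest!: T_E simp: E_add E_scale H_E W_E linear_add linear_cmul)
  \<comment> \<open>The factor \<open>1 *\<close> gives the sum the shape in which
    \<open>bivector_field\<close> states linearity.\<close>
  have pull: "(\<gamma> \<circ> tangent_map TA PA F) (E (a, b) v) = H \<gamma> (E (a, b) v) + 1 * W \<gamma> (E (a, b) v)"
    if "covector PA x \<gamma>" for \<gamma> a b
    using linear_add[OF lin[OF that], of "(a, 0)" "(0, b)"] tangent_map_F_E[OF v]
    by (simp add: Fv H_E W_E f_def g_def)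
  have cov_pull: "covector TA v (\<gamma> \<circ> tangent_map TA PA F)" and cov_sum: "covector TA v (\<lambda>\<xi>. H \<gamma> \<xi> + 1 * W \<gamma> \<xi>)"
    if "covector PA x \<gamma>" for \<gamma>
    unfolding covector_def using f[OF that] g[OF that]
    by (auto dest!: T_E simp: E_add E_scale pull[OF that, unfolded comp_def] H_E W_E linear_add linear_cmul algebra_simps)
  have bi: "bivector_field TA P"
    using P by (simp add: is_tangent_poisson_def)
  \<comment> \<open>The pulled back covectors and the sums of lifts are known to agree only on the
    tangent space at \<open>v\<close>; the value of a bivector field depends on nothing
    else.\<close>
  have "P v (\<alpha> \<circ> tangent_map TA PA F) (\<beta> \<circ> tangent_map TA PA F) =
      P v (\<lambda>\<xi>. H \<alpha> \<xi> + 1 * W \<alpha> \<xi>) (\<lambda>\<xi>. H \<beta> \<xi> + 1 * W \<beta> \<xi>)"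
    by (rule bi[unfolded bivector_field_def, THEN conjunct2, THEN conjunct1, rule_format, OF v])
      (use cov_pull[OF \<alpha>] cov_pull[OF \<beta>] cov_sum[OF \<alpha>] cov_sum[OF \<beta>] pull[OF \<alpha>] pull[OF \<beta>] T_E in blast)
  also have "\<dots> = P v (H \<alpha>) (H \<beta>) + P v (H \<alpha>) (W \<beta>) + (P v (W \<alpha>) (H \<beta>) + P v (W \<alpha>) (W \<beta>))"
  proof -
    note lin_P = bi[unfolded bivector_field_def, THEN conjunct2, THEN conjunct2, rule_format, OF v]
    show ?thesis
      using lin_P[of "H \<alpha>" "W \<alpha>" "\<lambda>\<xi>. H \<beta> \<xi> + 1 * W \<beta> \<xi>" 1] lin_P[of "H \<beta>" "W \<beta>" "H \<alpha>" 1]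
        lin_P[of "H \<beta>" "W \<beta>" "W \<alpha>" 1] covH[OF \<alpha>] covW[OF \<alpha>] covH[OF \<beta>] covW[OF \<beta>] cov_sum[OF \<beta>] by simp
  qed
  \<comment> \<open>Only the mixed terms survive. \<open>H \<alpha>\<close> with
    \<open>W \<beta>\<close> is the positive case; \<open>W \<alpha>\<close> with
    \<open>H \<beta>\<close> falls under the antisymmetric rule, hence the minus sign with
    \<open>f \<beta>\<close> in front of \<open>g \<alpha>\<close>, the order found in
    \<open>double_tensor\<close>.\<close>
  also have "\<dots> = right_inv_bivector G A \<iota> r (fst v) (\<lambda>w. f \<alpha> (K w)) (\<lambda>w. g \<beta> (K w)) -
      right_inv_bivector G A \<iota> r (fst v) (\<lambda>w. f \<beta> (K w)) (\<lambda>w. g \<alpha> (K w))"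
  proof -
    note lifts = P[unfolded is_tangent_poisson_def, THEN conjunct2, rule_format, OF _ v]
    have o: "one_form A (\<lambda>w. f \<gamma> (K w))" "one_form A (\<lambda>w. g \<gamma> (K w))" if "covector PA x \<gamma>" for \<gamma>
      using oneform f[OF that] g[OF that] by blast+
    show ?thesis
      using lifts[OF conjI[OF o(1)[OF \<alpha>] o(1)[OF \<beta>]]] lifts[OF conjI[OF o(1)[OF \<alpha>] o(2)[OF \<beta>]]]
        lifts[OF conjI[OF o(1)[OF \<beta>] o(2)[OF \<alpha>]]] lifts[OF conjI[OF o(2)[OF \<alpha>] o(2)[OF \<beta>]]]
      unfolding H_def W_def by simp
  qed
  also have "\<dots> = r (Blinfun (f \<alpha>)) (Blinfun (g \<beta>)) - r (Blinfun (f \<beta>)) (Blinfun (g \<alpha>))"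
    using parallelism_coord[OF par] p by (simp add: right_inv_bivector_def)
  \<comment> \<open>Linear forms on a Euclidean space are bounded, so \<open>Blinfun\<close> loses
    nothing, and restriction to the two factors returns \<open>f\<close> and
    \<open>g\<close>.\<close>
  also have "\<dots> = double_tensor r (Blinfun (\<lambda>u. \<alpha> (R2 u x))) (Blinfun (\<lambda>u. \<beta> (R2 u x)))"
    using lin[OF \<alpha>] lin[OF \<beta>]
    by (simp add: double_tensor_def dual_fst_def dual_snd_def f_def g_def bounded_linear_Blinfun_apply linear_conv_bounded_linear)
  finally show ?thesis
    using inv_F[OF x] by (simp add: push_bivector_def right_inv_bivector_def v_def)
qed

text \<open>Each tangent vector is a frame vector at its base point, and \<open>J\<close> is linear
  on fibres; so its values on the horizontal and the vertical half of the frame suffice.\<close>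

lemma push_endomorphism_eq:
  assumes J: "is_tangent_complex_structure A nabla J" and w: "w \<in> points (tangent_bundle PA)"
  shows "push_endomorphism TA PA F J w =
    right_inv_endomorphism (semidirect G \<rho>) PA (prod_identification G A \<iota>) double_complex_structure w"
proof -
  note parE = parallelism_E and par2 = parallelism_R2
  define x where "x = fst w"
  have wx: "w \<in> tangent_space PA x" and x: "x \<in> points PA"
    using w points_bundle_fst[OF w] by (simp_all add: mem_points_bundle x_def)
  define v where "v = \<Phi> x"
  have v: "v \<in> points TA"
    unfolding v_def by (rule smooth_map_points[OF smooth_\<Phi> x])
  have Fv: "F v = x"
    unfolding v_def by (rule F_\<Phi>[OF x])
  obtain a b where ab: "K2 w = (a, b)"
    by (metis prod.collapse)
  have R2w: "R2 (a, b) x = w"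
    using parallelism_of_coord[OF par2 wx] ab by simp
  have "tangent_map PA TA (inv_into (points TA) F) w = E (a, b) v"
    using tangent_map_inv_F[OF wx] R2w by (simp add: E_def Fv)
  moreover have "J (E (a, b) v) = E (- b, a) v"
  proof -
    have ET: "E u v \<in> tangent_space TA v" for u
      using parallelism_tangent_space[OF parE v] .
    have "J (tadd (E (a, 0) v) (E (0, b) v)) = tadd (J (E (a, 0) v)) (J (E (0, b) v))"
      using J v ET by (simp add: is_tangent_complex_structure_def endomorphism_field_def)
    moreover have "J (E (a, 0) v) = E (0, a) v" "J (E (0, b) v) = tscale (- 1) (E (b, 0) v)"
      using J[unfolded is_tangent_complex_structure_def, THEN conjunct2, rule_format,
          OF parallelism_vector_field_const[OF A_smooth parallelism_right_inv] v]
      by (simp_all add: hlift_field_R[OF v] vlift_field_R[OF v])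
    ultimately show ?thesis
      using E_split[OF v, of a b] parallelism_scale[OF parE v, of "- 1" "(b, 0)"]
        parallelism_add[OF parE v, of "(0, a)" "(- b, 0)"] by simp
  qed
  ultimately have "push_endomorphism TA PA F J w = R2 (- b, a) x"
    using tangent_map_F_E[OF v] by (simp add: push_endomorphism_def Fv)
  moreover have "(THE u. R2 u x = w) = (a, b)"
  proof (rule the_equality[where P = "\<lambda>u. R2 u x = w", OF R2w])
    show "u = (a, b)" if "R2 u x = w" for u
      using parallelism_coord[OF par2 x, of u] that ab by simp
  qed
  ultimately show ?thesis
    by (simp add: right_inv_endomorphism_def double_complex_structure_def flip: x_def)
qed

text \<open>Additive expansion into the four rules for lifts. The two terms with a vertical first
  argument vanish, which leaves \<open>a\<close> acting by left multiplication on both components of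
  the second argument; the sign is that of \<open>nabla\<close>.\<close>

lemma tangent_connection_E:
  assumes D: "is_tangent_connection A nabla Dbar"
  shows "points_eq TA (Dbar (E u) (E w)) (E (- double_product m u w))"
  unfolding points_eq_def
proof
  fix v assume v: "v \<in> points TA"
  note parE = parallelism_E and par = parallelism_right_inv
  obtain a b c d where u: "u = (a, b)" and w: "w = (c, d)"
    by (metis prod.collapse)
  have con: "connection TA Dbar"
    using D by (simp add: is_tangent_connection_def)
  note E_vf = parallelism_vector_field_const[OF TA_smooth parE] and R_vf = parallelism_vector_field_const[OF A_smooth par]
  \<comment> \<open>The axioms of a connection speak of smooth fields only; the lifts qualify
    because they coincide with frame fields on all points.\<close>
  have h_vf: "vector_field TA (hlift_field A nabla (R a))" and v_vf: "vector_field TA (vlift_field A (R a))" for a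
    by (rule vector_field_cong[OF TA_smooth E_vf], simp add: hlift_field_R vlift_field_R)+
  have h_eq: "points_eq TA (E (a, 0)) (hlift_field A nabla (R a))"
    and v_eq: "points_eq TA (E (0, a)) (vlift_field A (R a))" for a
    by (simp_all add: points_eq_def hlift_field_R vlift_field_R)
  have sum_vf: "vector_field TA (\<lambda>v. tadd (E (a, 0) v) (E (0, b) v))" for a b
    by (rule vector_field_cong[OF TA_smooth E_vf E_split])
  have split: "points_eq TA (E (a, b)) (\<lambda>v. tadd (E (a, 0) v) (E (0, b) v))" for a b
    by (simp add: points_eq_def E_split[symmetric])
  have DR: "nabla (R a) (R c) (fst v) = R (- m a c) (fst v)" for a c
    using nabla points_bundle_fst[OF v] by (simp add: is_right_inv_connection_def points_eq_def)
  have zero: "E 0 v = (v, \<lambda>_. 0)"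
    by (rule parallelism_zero[OF parE v])
  note lifts = D[unfolded is_tangent_connection_def points_eq_def, THEN conjunct2, rule_format, OF conjI[OF R_vf R_vf]]
  have "Dbar (E (a, 0)) (E (c, 0)) v = E (- m a c, 0) v" for a c
    using connection_cong[OF con E_vf h_vf E_vf h_vf h_eq h_eq v] lifts[THEN conjunct1, rule_format, OF v]
    by (simp add: hlift_field_def DR horizontal_lift_R[OF v])
  moreover have "Dbar (E (a, 0)) (E (0, d)) v = E (0, - m a d) v" for a d
    using connection_cong[OF con E_vf h_vf E_vf v_vf h_eq v_eq v]
      lifts[THEN conjunct2, THEN conjunct1, rule_format, OF v]
    by (simp add: vlift_field_def DR vertical_lift_R[OF v])
  moreover have "Dbar (E (0, b)) (E (c, 0)) v = E 0 v" for b c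
    using connection_cong[OF con E_vf v_vf E_vf h_vf v_eq h_eq v]
      lifts[THEN conjunct2, THEN conjunct2, THEN conjunct1, rule_format, OF v] by (simp add: zero)
  moreover have "Dbar (E (0, b)) (E (0, d)) v = E 0 v" for b d
    using connection_cong[OF con E_vf v_vf E_vf v_vf v_eq v_eq v]
      lifts[THEN conjunct2, THEN conjunct2, THEN conjunct2, rule_format, OF v] by (simp add: zero)
  moreover have "Dbar (E (a, b)) (E (c, d)) v = tadd (tadd (Dbar (E (a, 0)) (E (c, 0)) v) (Dbar (E (a, 0)) (E (0, d)) v))
      (tadd (Dbar (E (0, b)) (E (c, 0)) v) (Dbar (E (0, b)) (E (0, d)) v))"
    using connection_cong[OF con E_vf sum_vf E_vf sum_vf split split v, of a b c d]
      connection_add_left[OF con E_vf E_vf sum_vf v, of "(a, 0)" "(0, b)" c d]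
      connection_add_right[OF con E_vf E_vf E_vf v, of _ "(c, 0)" "(0, d)"] by simp
  ultimately show "Dbar (E u) (E w) v = E (- double_product m u w) v"
    using parallelism_add[OF parE v, symmetric] by (simp add: u w double_product_def)
qed

text \<open>In the frames \<open>E\<close> and \<open>R2\<close> both connections have the
  coefficients \<open>- double_product m\<close>, so \<open>connection_parallelism\<close> gives the
  same expression for each. What remains is to match coordinates: those of \<open>Z\<close> at
  \<open>F w\<close> and of its pullback at \<open>w\<close> are equal.\<close>

lemma push_connection_eq:
  assumes D: "is_tangent_connection A nabla Dbar"
    and Dt: "is_right_inv_connection (semidirect G \<rho>) PA (prod_identification G A \<iota>) (\<lambda>x y. - double_product m x y) Dt"
    and X: "vector_field PA X" and Y: "vector_field PA Y"
  shows "points_eq PA (push_connection TA PA F Dbar X Y) (Dt X Y)"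
  unfolding points_eq_def
proof
  fix x assume x: "x \<in> points PA"
  note parE = parallelism_E and par2 = parallelism_R2
  let ?b = "\<lambda>x y. - double_product m x y"
  have b: "bilinear ?b"
    unfolding bilinear_def double_product_def
    by (auto intro!: linearI simp: bilinear_ladd[OF m_bilinear] bilinear_radd[OF m_bilinear]
        bilinear_lmul[OF m_bilinear] bilinear_rmul[OF m_bilinear])
  \<comment> \<open>The pullback in the literal form that \<open>push_connection\<close> contains;
    \<open>p_eq\<close> replaces its nested inverses by \<open>F\<close> and
    \<open>\<Phi>\<close>.\<close>
  define p where "p = (\<lambda>X. push_field PA TA (inv_into (points TA) F) X)"
  have Z_F: "Z (F w) \<in> tangent_space PA (F w)" if "vector_field PA Z" "w \<in> points TA" for Z w
    using that(1) points_F[OF that(2)] unfolding vector_field_def by blast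
  have p_eq: "tangent_map PA TA \<Phi> (Z (F w)) = p Z w" if "vector_field PA Z" "w \<in> points TA" for Z w
    unfolding p_def push_field_def inv_inv_F[OF that(2)] tangent_map_inv_F[OF Z_F[OF that]] ..
  have p_vf: "vector_field TA (p Z)" if "vector_field PA Z" for Z
    by (rule vector_field_cong[OF TA_smooth vector_field_push[OF PA_smooth TA_smooth smooth_\<Phi> smooth_F \<Phi>_F that] p_eq[OF that]])
  have F_p: "tangent_map TA PA F (p Z w) = Z (F w)" if "vector_field PA Z" "w \<in> points TA" for Z w
    using tangent_map_F_\<Phi>[OF Z_F[OF that]] p_eq[OF that] by simp
  have KE_p: "KE (p Z w) = K2 (Z (F w))" if "vector_field PA Z" "w \<in> points TA" for Z w
    using F_p[OF that] by (simp add: KE_def)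
  define v where "v = \<Phi> x"
  have v: "v \<in> points TA"
    unfolding v_def by (rule smooth_map_points[OF smooth_\<Phi> x])
  have Fv: "F v = x"
    unfolding v_def by (rule F_\<Phi>[OF x])
  have pXv: "p X v \<in> tangent_space TA v"
    using p_vf[OF X] v by (simp add: vector_field_def)
  note k = parallelism_vector_field_coord[OF PA_smooth par2 Y] parallelism_vector_field_coord[OF TA_smooth parE p_vf[OF Y]]
  \<comment> \<open>The derivative terms match by the chain rule: the coordinates on TG are those of
    \<open>Y\<close> composed with \<open>F\<close>, and the tangent map of \<open>F\<close> sends
    \<open>p X\<close> back to \<open>X\<close>.\<close>
  have "differential TA (\<lambda>w. KE (p Y w)) (p X v) = differential TA (\<lambda>w. K2 (Y (F w))) (p X v)"
    unfolding differential_def using tangent_map_cong[OF TA_smooth pXv k(2) KE_p[OF Y]] by simp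
  also have "\<dots> = differential PA (\<lambda>x. K2 (Y x)) (X x)"
    using differential_compose[OF TA_smooth PA_smooth smooth_F k(1) smooth_map_compose[OF TA_smooth PA_smooth smooth_atlas_vector smooth_F k(1)] pXv]
      F_p[OF X v] by (simp add: Fv)
  finally have d: "differential TA (\<lambda>w. KE (p Y w)) (p X v) = differential PA (\<lambda>x. K2 (Y x)) (X x)" .
  note Dt' = Dt[unfolded is_right_inv_connection_def]
  have con: "connection TA Dbar"
    using D by (simp add: is_tangent_connection_def)
  have "Dbar (p X) (p Y) v = E (differential PA (\<lambda>x. K2 (Y x)) (X x) + ?b (K2 (X x)) (K2 (Y x))) v"
    using connection_parallelism[where D = Dbar and b = ?b, OF TA_smooth parE con b tangent_connection_E[OF D] p_vf[OF X] p_vf[OF Y] v]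
      KE_p[OF X v] KE_p[OF Y v] by (simp add: d Fv)
  moreover have "Dt X Y x = R2 (differential PA (\<lambda>x. K2 (Y x)) (X x) + ?b (K2 (X x)) (K2 (Y x))) x"
    by (rule connection_parallelism[where D = Dt and b = ?b, OF PA_smooth par2 Dt'[THEN conjunct1] b
          Dt'[THEN conjunct2, rule_format] X Y x])
  ultimately show "push_connection TA PA F Dbar X Y x = Dt X Y x"
    using inv_F[OF x] tangent_map_F_E[OF v] by (simp add: push_connection_def push_field_def[of TA] Fv flip: p_def v_def)
qed

end

theorem theorem6p4:
  fixes m :: "'g::euclidean_space \<Rightarrow> 'g \<Rightarrow> 'g"
    and G :: "'a monoid"
    and A :: "('a, 'e::euclidean_space) atlas"
    and \<iota> :: "'g \<Rightarrow> ('a, 'e) tvec"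
    and \<rho> :: "'a \<Rightarrow> 'g \<Rightarrow>\<^sub>L 'g"
    and r :: "('g \<Rightarrow>\<^sub>L real) \<Rightarrow> ('g \<Rightarrow>\<^sub>L real) \<Rightarrow> real"
  assumes lsa: "left_symmetric_algebra m"
    and lie_group: "lie_group G A"
    and connected: "connected_space (atlas_topology A)"
    and lie_algebra: "has_lie_algebra G A \<iota> (commutator m)"
    and rho_smooth: "smooth_map A vector_atlas \<rho>"
    and rho_hom: "\<rho> \<in> hom G general_linear_group"
    and rho_deriv: "\<And>u v. blinfun_apply (differential A \<rho> (\<iota> u)) v = m u v"
    and r_bilinear: "bilinear r"
    and r_symmetric: "\<And>\<alpha> \<beta>. r \<alpha> \<beta> = r \<beta> \<alpha>"
    and r_schouten: "\<And>\<alpha> \<beta> \<gamma>. schouten m r \<alpha> \<beta> \<gamma> = 0"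
    and nabla: "is_right_inv_connection G A \<iota> (\<lambda>u v. - m u v) nabla"
    and nabla_bar: "is_tangent_connection A nabla nabla_bar"
    and J: "is_tangent_complex_structure A nabla J"
    and P: "is_tangent_poisson A nabla (right_inv_bivector G A \<iota> r) P"
    and nabla_tilde: "is_right_inv_connection (semidirect G \<rho>) (prod_atlas A vector_atlas)
            (prod_identification G A \<iota>) (\<lambda>x y. - double_product m x y) nabla_tilde"
  shows "(\<forall>x\<in>points (prod_atlas A vector_atlas). \<forall>\<alpha> \<beta>.
            covector (prod_atlas A vector_atlas) x \<alpha> \<and> covector (prod_atlas A vector_atlas) x \<beta> \<longrightarrow>
            push_bivector (tangent_bundle A) (prod_atlas A vector_atlas)
              (right_trivialization G A \<iota>) P x \<alpha> \<beta> =
            right_inv_bivector (semidirect G \<rho>) (prod_atlas A vector_atlas)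
              (prod_identification G A \<iota>) (double_tensor r) x \<alpha> \<beta>) \<and>
         (\<forall>X Y. vector_field (prod_atlas A vector_atlas) X \<and>
            vector_field (prod_atlas A vector_atlas) Y \<longrightarrow>
            points_eq (prod_atlas A vector_atlas)
              (push_connection (tangent_bundle A) (prod_atlas A vector_atlas)
                (right_trivialization G A \<iota>) nabla_bar X Y)
              (nabla_tilde X Y)) \<and>
         (\<forall>w\<in>points (tangent_bundle (prod_atlas A vector_atlas)).
            push_endomorphism (tangent_bundle A) (prod_atlas A vector_atlas)
              (right_trivialization G A \<iota>) J w =
            right_inv_endomorphism (semidirect G \<rho>) (prod_atlas A vector_atlas)
              (prod_identification G A \<iota>) double_complex_structure w)"
proof -
  have m: "bilinear m"
    using lsa by (simp add: left_symmetric_algebra_def)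
  interpret flat_lie_group G A \<iota> m \<rho> nabla
    using lie_group lie_algebra m rho_smooth rho_hom rho_deriv nabla
    by unfold_locales (auto simp: has_lie_algebra_def)
  show ?thesis
    using push_bivector_eq[OF P] push_connection_eq[OF nabla_bar nabla_tilde] push_endomorphism_eq[OF J] by blast
qed

end
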